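(* Let $G$ be a finite simple graph such that for every independent set $A$ of $G$ (including $A=\emptyset$) for which $G\setminus N_G[A]$ has at least one vertex, the graph $G\setminus N_G[A]$ has a simplicial vertex. Then the following are equivalent: (1) $\mathcal{B}_{G\setminus N_G[A]}$ is a vertex decomposable graph for every independent set $A$ of $G$; (2) $J(G)^{(k)}$ has linear quotients for all $k\ge 1$; (3) $J(G)^{(k)}$ is a componentwise linear ideal for all $k\ge 1$; (4) $J(G)^{(k)}$ is a componentwise linear ideal for some $k\ge 2$.
   Context: Graphs are finite, simple, undirected. For $A\subseteq V(G)$, $N_G(A)$ is the set of vertices adjacent to some vertex of $A$, and $N_G[A]=N_G(A)\cup A$ (so $N_G[\emptyset]=\emptyset$); $G\setminus U$ is the induced subgraph on $V(G)\setminus U$. A vertex $x$ is simplicial if its neighbors form a clique (the empty clique is allowed). Cover ideals. Let $V(G)=\{x_1,\dots,x_n\}$ and $R=\mathbb{K}[x_1,\dots,x_n]$, $\mathbb{K}$ a field. The cover ideal is $J(G)=\bigcap_{\{x_i,x_j\}\in E(G)}(x_i,x_j)$, and its $k$-th symbolic power is $J(G)^{(k)}=\bigcap_{\{x_i,x_j\}\in E(G)}(x_i,x_j)^k$. A homogeneous ideal $I$ is componentwise linear if for each $\ell$ the ideal generated by all degree $\ell$ elements of $I$ has a linear resolution. A monomial ideal $I$ has linear quotients if its minimal monomial generators can be ordered $u_1,\dots,u_m$ so that for every $2\le i\le m$ the ideal $(u_1,\dots,u_{i-1}):(u_i)$ is generated by a subset of the variables. Vertex decomposability. A vertex $x$ of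 $G$ is a shedding vertex if no independent set of $G\setminus N_G[x]$ is a maximal independent set of $G\setminus x$. $G$ is (recursively) vertex decomposable if it has no edges, or it has a shedding vertex $x$ such that $G\setminus x$ and $G\setminus N_G[x]$ are both vertex decomposable. Under the hypothesis of the theorem, $G$ and all the graphs $G\setminus N_G[A]$ ($A$ independent) are known to be vertex decomposable. The graph $\mathcal{B}_H$. Let $H$ be a vertex decomposable graph. A shedding order of $H$ is a sequence $(a_1,\dots,a_l)$ of vertices such that $a_1$ is a shedding vertex of $H$, $a_i$ is a shedding vertex of $H\setminus\{a_1,\dots,a_{i-1}\}$ for $1<i\le l$, and $H\setminus\{a_1,\dots,a_l\}$ has no edges; the remaining vertices $\{b_1,\dots,b_r\}=V(H)\setminus\{a_1,\dots,a_l\}$ form the corresponding $i$-order. Given such a shedding order, $\mathcal{B}_H$ is the spanning bipartite subgraph of $H$ with vertex set $V(H)=\{b_1,\dots,b_r\}\sqcup\{a_1,\dots,a_l\}$ and edge set $\{\{b_i,a_j\}\in E(H): 1\le i\le r,\ 1\le j\le l\}$. For each vertex decomposable graph $H$ one (arbitrary) shedding order is fixed and $\mathcal{B}_H$ is formed from it. *)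

theory Defs
  imports
    "HOL-Library.Poly_Mapping"
    "HOL-Algebra.Ideal_Product"
    "Jordan_Normal_Form.Matrix"
begin

section \<open>Graphs\<close>

type_synonym 'v graph = "'v set \<times> 'v set set"

abbreviation verts :: "'v graph \<Rightarrow> 'v set" where "verts \<equiv> fst"
abbreviation edges :: "'v graph \<Rightarrow> 'v set set" where "edges \<equiv> snd"

definition simple_graph :: "'v graph \<Rightarrow> bool" where
  "simple_graph G \<longleftrightarrow> finite (verts G) \<and>
     (\<forall>e\<in>edges G. \<exists>u\<in>verts G. \<exists>v\<in>verts G. u \<noteq> v \<and> e = {u, v})"

definition nbrs :: "'v graph \<Rightarrow> 'v set \<Rightarrow> 'v set" where
  "nbrs G A = {v \<in> verts G. \<exists>u\<in>A. {u, v} \<in> edges G}"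

definition closed_nbrs :: "'v graph \<Rightarrow> 'v set \<Rightarrow> 'v set" where
  "closed_nbrs G A = nbrs G A \<union> A"

definition delete_verts :: "'v graph \<Rightarrow> 'v set \<Rightarrow> 'v graph" where
  "delete_verts G U = (verts G - U, {e \<in> edges G. e \<inter> U = {}})"

definition indep_set :: "'v graph \<Rightarrow> 'v set \<Rightarrow> bool" where
  "indep_set G S \<longleftrightarrow> S \<subseteq> verts G \<and> (\<forall>u\<in>S. \<forall>v\<in>S. {u, v} \<notin> edges G)"

definition maximal_indep_set :: "'v graph \<Rightarrow> 'v set \<Rightarrow> bool" where
  "maximal_indep_set G S \<longleftrightarrow>
     indep_set G S \<and> (\<forall>T. indep_set G T \<longrightarrow> S \<subseteq> T \<longrightarrow> T = S)"

definition simplicial :: "'v graph \<Rightarrow> 'v \<Rightarrow> bool" where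
  "simplicial G x \<longleftrightarrow> x \<in> verts G \<and>
     (\<forall>u\<in>nbrs G {x}. \<forall>v\<in>nbrs G {x}. u \<noteq> v \<longrightarrow> {u, v} \<in> edges G)"

definition shedding_vertex :: "'v graph \<Rightarrow> 'v \<Rightarrow> bool" where
  "shedding_vertex G x \<longleftrightarrow> x \<in> verts G \<and>
     \<not> (\<exists>S. indep_set (delete_verts G (closed_nbrs G {x})) S \<and>
            maximal_indep_set (delete_verts G {x}) S)"

inductive vertex_decomposable :: "'v graph \<Rightarrow> bool" where
  edgeless: "edges G = {} \<Longrightarrow> vertex_decomposable G"
| shed: "\<lbrakk>shedding_vertex G x;
          vertex_decomposable (delete_verts G {x});
          vertex_decomposable (delete_verts G (closed_nbrs G {x}))\<rbrakk>
         \<Longrightarrow> vertex_decomposable G"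

definition shedding_order :: "'v graph \<Rightarrow> 'v list \<Rightarrow> bool" where
  "shedding_order H as \<longleftrightarrow>
     (\<forall>i<length as. shedding_vertex (delete_verts H (set (take i as))) (as ! i)) \<and>
     edges (delete_verts H (set as)) = {}"

text \<open>The graph \<open>\<B>\<^sub>H\<close> formed from the shedding order \<open>as\<close> of \<open>H\<close>.\<close>

definition shed_bip :: "'v graph \<Rightarrow> 'v list \<Rightarrow> 'v graph" where
  "shed_bip H as =
     (verts H, {{b, a} | b a. b \<in> verts H - set as \<and> a \<in> set as \<and> {b, a} \<in> edges H})"

section \<open>Polynomial rings and ideals\<close>

text \<open>A monomial is its exponent vector; a polynomial maps monomials to coefficients, and
  multiplication is convolution.\<close>

type_synonym 'v monom = "'v \<Rightarrow>\<^sub>0 nat"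
type_synonym ('v, 'k) mpoly = "('v \<Rightarrow>\<^sub>0 nat) \<Rightarrow>\<^sub>0 'k"

definition mono :: "'v monom \<Rightarrow> ('v, 'k::field) mpoly" where
  "mono t = Poly_Mapping.single t 1"

definition var :: "'v \<Rightarrow> ('v, 'k::field) mpoly" where
  "var x = mono (Poly_Mapping.single x 1)"

definition mdeg :: "'v monom \<Rightarrow> nat" where
  "mdeg t = (\<Sum>x\<in>Poly_Mapping.keys t. Poly_Mapping.lookup t x)"

definition homogeneous :: "nat \<Rightarrow> ('v, 'k::field) mpoly \<Rightarrow> bool" where
  "homogeneous d p \<longleftrightarrow> (\<forall>t\<in>Poly_Mapping.keys p. mdeg t = d)"

text \<open>The polynomial ring in the variables indexed by \<open>V\<close>: its elements are the polynomials
  all of whose monomials involve only variables from \<open>V\<close>.\<close>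

definition poly_ring :: "'v set \<Rightarrow> ('v, 'k::field) mpoly ring" where
  "poly_ring V = \<lparr>carrier = {p. \<forall>t\<in>Poly_Mapping.keys p. Poly_Mapping.keys t \<subseteq> V},
     monoid.mult = (*), one = 1, zero = 0, add = (+)\<rparr>"

lemma cring_poly_ring: "cring (poly_ring V :: ('v, 'k::field) mpoly ring)"
proof (rule cringI)
  let ?R = "poly_ring V :: ('v, 'k) mpoly ring"
  have ops: "p \<oplus>\<^bsub>?R\<^esub> q = p + q" "p \<otimes>\<^bsub>?R\<^esub> q = p * q" "\<zero>\<^bsub>?R\<^esub> = 0" "\<one>\<^bsub>?R\<^esub> = 1" for p q
    by (simp_all add: poly_ring_def)
  have zero_one: "0 \<in> carrier ?R" "1 \<in> carrier ?R"
    by (simp_all add: poly_ring_def)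
  have neg: "- p \<in> carrier ?R" if "p \<in> carrier ?R" for p
    using that by (simp add: poly_ring_def)
  have add: "p + q \<in> carrier ?R" if "p \<in> carrier ?R" "q \<in> carrier ?R" for p q
    using that Poly_Mapping.keys_add[of p q] by (auto simp: poly_ring_def)
  have mul: "p * q \<in> carrier ?R" if pq: "p \<in> carrier ?R" "q \<in> carrier ?R" for p q
  proof -
    have "Poly_Mapping.keys t \<subseteq> V" if t: "t \<in> Poly_Mapping.keys (p * q)" for t
    proof -
      obtain a c where ac: "a \<in> Poly_Mapping.keys p" "c \<in> Poly_Mapping.keys q" "t = a + c"
        using t Poly_Mapping.keys_mult[of p q] by auto
      then have "Poly_Mapping.keys a \<subseteq> V" "Poly_Mapping.keys c \<subseteq> V"
        using pq by (auto simp: poly_ring_def)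
      then show ?thesis using ac(3) Poly_Mapping.keys_add[of a c] by blast
    qed
    then show ?thesis by (simp add: poly_ring_def)
  qed
  show "abelian_group ?R"
  proof (rule abelian_groupI)
    fix p assume "p \<in> carrier ?R"
    then show "\<exists>q\<in>carrier ?R. q \<oplus>\<^bsub>?R\<^esub> p = \<zero>\<^bsub>?R\<^esub>"
      using neg by (intro bexI[of _ "- p"]) (simp_all add: ops)
  qed (simp_all add: ops zero_one add ac_simps)
  show "comm_monoid ?R"
    by (rule comm_monoidI) (simp_all add: ops zero_one mul ac_simps)
  show "(p \<oplus>\<^bsub>?R\<^esub> q) \<otimes>\<^bsub>?R\<^esub> r = p \<otimes>\<^bsub>?R\<^esub> r \<oplus>\<^bsub>?R\<^esub> q \<otimes>\<^bsub>?R\<^esub> r" for p q r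
    by (simp add: ops distrib_right)
qed

definition ideal_colon ::
  "('a, 'b) ring_scheme \<Rightarrow> 'a set \<Rightarrow> 'a set \<Rightarrow> 'a set" where
  "ideal_colon R I J = {r \<in> carrier R. \<forall>j\<in>J. r \<otimes>\<^bsub>R\<^esub> j \<in> I}"

text \<open>The power of an ideal is taken in the multiplicative monoid of ideals, so the zeroth
  power is the whole ring. For an edgeless graph the intersection is the whole ring as well.\<close>

definition cover_ideal_sympow :: "'v graph \<Rightarrow> nat \<Rightarrow> ('v, 'k::field) mpoly set" where
  "cover_ideal_sympow G k =
     (let R = poly_ring (verts G)
      in {p \<in> carrier R. \<forall>e\<in>edges G. p \<in> (Idl\<^bsub>R\<^esub> (var ` e)) [^]\<^bsub>ideals_set R\<^esub> k})"

section \<open>Linear quotients\<close>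

definition minimal_monomial_generators ::
  "'v set \<Rightarrow> ('v, 'k::field) mpoly set \<Rightarrow> 'v monom set \<Rightarrow> bool" where
  "minimal_monomial_generators V I M \<longleftrightarrow>
     (\<forall>t\<in>M. Poly_Mapping.keys t \<subseteq> V) \<and> Idl\<^bsub>poly_ring V\<^esub> (mono ` M) = I \<and>
     (\<forall>N. N \<subset> M \<longrightarrow> Idl\<^bsub>poly_ring V\<^esub> (mono ` N) \<noteq> I)"

text \<open>The list \<open>us\<close> is indexed from \<open>0\<close>, so \<open>i\<close> starts at \<open>1\<close>.\<close>

definition linear_quotients :: "'v set \<Rightarrow> ('v, 'k::field) mpoly set \<Rightarrow> bool" where
  "linear_quotients V I \<longleftrightarrow>
     (\<exists>us. distinct us \<and> minimal_monomial_generators V I (set us) \<and>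
        (\<forall>i. 1 \<le> i \<and> i < length us \<longrightarrow>
           (\<exists>X\<subseteq>V. ideal_colon (poly_ring V)
                     (Idl\<^bsub>poly_ring V\<^esub> (mono ` set (take i us)))
                     (Idl\<^bsub>poly_ring V\<^esub> {mono (us ! i)})
                 = (Idl\<^bsub>poly_ring V\<^esub> (var ` X) :: ('v, 'k) mpoly set))))"

section \<open>Graded free resolutions and componentwise linear ideals\<close>

definition free_module :: "'v set \<Rightarrow> nat \<Rightarrow> ('v, 'k::field) mpoly vec set" where
  "free_module V n = {v \<in> carrier_vec n. \<forall>i<n. v $ i \<in> carrier (poly_ring V)}"

definition mat_image :: "'v set \<Rightarrow> ('v, 'k::field) mpoly mat \<Rightarrow> ('v, 'k) mpoly vec set" where
  "mat_image V A = (\<lambda>v. A *\<^sub>v v) ` free_module V (dim_col A)"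

definition mat_ker :: "'v set \<Rightarrow> ('v, 'k::field) mpoly mat \<Rightarrow> ('v, 'k) mpoly vec set" where
  "mat_ker V A = {v \<in> free_module V (dim_col A). A *\<^sub>v v = 0\<^sub>v (dim_row A)}"

text \<open>The complex
  \<open>\<dots> \<rightarrow> F\<^sub>1 \<rightarrow> F\<^sub>0 \<rightarrow> I \<rightarrow> 0\<close> with \<open>F\<^sub>i\<close> free of rank \<open>b i\<close>, the \<open>q\<close>-th basis element
  of \<open>F\<^sub>i\<close> being placed in degree \<open>e i q\<close>. The row \<open>\<phi> 0\<close> is the augmentation
  \<open>F\<^sub>0 \<rightarrow> I\<close>, and \<open>\<phi> (i + 1)\<close> is the matrix of \<open>F\<^sub>i\<^sub>+\<^sub>1 \<rightarrow> F\<^sub>i\<close>. The conditions on the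
  entries say that all maps preserve degrees.\<close>

definition graded_free_resolution ::
  "'v set \<Rightarrow> ('v, 'k::field) mpoly set \<Rightarrow> (nat \<Rightarrow> nat) \<Rightarrow> (nat \<Rightarrow> nat \<Rightarrow> int) \<Rightarrow>
   (nat \<Rightarrow> ('v, 'k) mpoly mat) \<Rightarrow> bool" where
  "graded_free_resolution V I b e \<phi> \<longleftrightarrow>
     \<phi> 0 \<in> carrier_mat 1 (b 0) \<and>
     (\<forall>i. \<phi> (Suc i) \<in> carrier_mat (b i) (b (Suc i))) \<and>
     (\<forall>i. elements_mat (\<phi> i) \<subseteq> carrier (poly_ring V)) \<and>
     (\<forall>q<b 0. \<forall>t\<in>Poly_Mapping.keys (\<phi> 0 $$ (0, q)). int (mdeg t) = e 0 q) \<and>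
     (\<forall>i. \<forall>p<b i. \<forall>q<b (Suc i). \<forall>t\<in>Poly_Mapping.keys (\<phi> (Suc i) $$ (p, q)).
        int (mdeg t) + e i p = e (Suc i) q) \<and>
     (\<lambda>v. v $ 0) ` mat_image V (\<phi> 0) = I \<and>
     (\<forall>i. mat_image V (\<phi> (Suc i)) = mat_ker V (\<phi> i))"

text \<open>Minimality: the image of \<open>F\<^sub>i\<^sub>+\<^sub>1\<close> lies in \<open>\<mm> F\<^sub>i\<close>, where \<open>\<mm>\<close> is generated by the variables.\<close>

definition minimal_graded_free_resolution ::
  "'v set \<Rightarrow> ('v, 'k::field) mpoly set \<Rightarrow> (nat \<Rightarrow> nat) \<Rightarrow> (nat \<Rightarrow> nat \<Rightarrow> int) \<Rightarrow>
   (nat \<Rightarrow> ('v, 'k) mpoly mat) \<Rightarrow> bool" where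
  "minimal_graded_free_resolution V I b e \<phi> \<longleftrightarrow>
     graded_free_resolution V I b e \<phi> \<and>
     (\<forall>i. elements_mat (\<phi> (Suc i)) \<subseteq> Idl\<^bsub>poly_ring V\<^esub> (var ` V))"

text \<open>Linearity: \<open>F\<^sub>i\<close> is a direct sum of copies of \<open>R(-d-i)\<close>. The zero ideal, resolved by the
  zero complex, counts as having a linear resolution.\<close>

definition has_linear_resolution :: "'v set \<Rightarrow> ('v, 'k::field) mpoly set \<Rightarrow> bool" where
  "has_linear_resolution V I \<longleftrightarrow>
     (\<exists>b e \<phi>. minimal_graded_free_resolution V I b e \<phi> \<and>
        (\<exists>d. \<forall>i. \<forall>q<b i. e i q = d + int i))"

definition homogeneous_ideal :: "'v set \<Rightarrow> ('v, 'k::field) mpoly set \<Rightarrow> bool" where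
  "homogeneous_ideal V I \<longleftrightarrow>
     ideal I (poly_ring V) \<and> I = Idl\<^bsub>poly_ring V\<^esub> {p \<in> I. \<exists>d. homogeneous d p}"

definition componentwise_linear :: "'v set \<Rightarrow> ('v, 'k::field) mpoly set \<Rightarrow> bool" where
  "componentwise_linear V I \<longleftrightarrow> homogeneous_ideal V I \<and>
     (\<forall>l. has_linear_resolution V (Idl\<^bsub>poly_ring V\<^esub> {p \<in> I. homogeneous l p}))"

end

theory Submission
  imports Defs
begin

text \<open>For (1) \<open>\<Longrightarrow>\<close> (2) call a graph residually simplicial if every nonempty
  \<open>G \<setminus> N[A]\<close> with \<open>A\<close> independent has a simplicial vertex. Such graphs are vertex
  decomposable, since the neighbours of a simplicial vertex are shedding vertices. Condition (1)
  makes the polarization \<open>G\<^sub>k\<close>, on the vertices \<open>(v, p)\<close> with \<open>1 \<le> p \<le> k\<close> and the edges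
  \<open>(u, p)(v, q)\<close> with \<open>uv\<close> an edge and \<open>p + q \<le> k + 1\<close>, residually simplicial as well: looking for
  a simplicial vertex at levels \<open>1\<close> and \<open>k\<close> leads to the bipartite graph \<open>\<B>\<^sub>H\<close>, and if
  these levels are empty then \<open>k\<close> drops by two. A shelling of the independence complex of \<open>G\<^sub>k\<close>
  is an order of the minimal \<open>k\<close>-covers of \<open>G\<close> with linear quotients.

  For (2) \<open>\<Longrightarrow>\<close> (3) linear quotients pass to the degree components of the ideal, and then to
  the syzygies, which are linear.

  For (4) \<open>\<Longrightarrow>\<close> (1) two generators of a degree component with linear resolution are
  joined by linear steps inside their least common multiple. If \<open>\<B>\<^sub>H\<close> were not vertex
  decomposable, a residual bipartite graph would have all degrees at least two; the \<open>k\<close>-covers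
  with values \<open>0, 1\<close> on the \<open>b\<^sub>i\<close> and \<open>k - 1, k\<close> on the \<open>a\<^sub>j\<close> built from
  its two sides admit no such step.\<close>

section \<open>Vertex decomposable graphs\<close>

text \<open>The shedding orders in (1) are arbitrary and chosen anew for every residual graph. The
  choice is harmless because the b_i always form an independent set of maximum size. Of the shelling
  of the bipartite graph only \<open>leaf_condition\<close> is kept, a statement about
  \<open>H\<close> and one such set \<open>B\<close>; the set \<open>U\<close> to which it is
  applied is dictated by the polarization and turns out to lie in every maximum independent set.
  Residual simpliciality serves both directions. It passes to the polarization, where it produces a
  shelling; and in a bipartite graph a vertex is simplicial iff it has at most one neighbour, which
  is what its failure contradicts. The values 0, 1 and k - 1, k come from tightness: on an edge
  between a b_i and an a_j with exactly one end in the chosen vertex cover they sum to k, as 1 + (k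
  - 1) or 0 + k, so neither end can be lowered alone. Two adjacent a_j carry at least 2(k - 1),
  which is enough because k is at least 2.\<close>

abbreviation adj :: "'v graph \<Rightarrow> 'v \<Rightarrow> 'v \<Rightarrow> bool" where
  "adj G u v \<equiv> {u, v} \<in> edges G"

abbreviation residual :: "'v graph \<Rightarrow> 'v set \<Rightarrow> 'v graph" where
  "residual G A \<equiv> delete_verts G (closed_nbrs G A)"

definition residually_simplicial :: "'v graph \<Rightarrow> bool" where
  "residually_simplicial G \<longleftrightarrow>
     (\<forall>A. indep_set G A \<longrightarrow> verts (residual G A) \<noteq> {} \<longrightarrow> (\<exists>x. simplicial (residual G A) x))"

lemma adj_sym: "adj G u v \<longleftrightarrow> adj G v u"
  by (simp add: insert_commute)

lemma simple_graphD:
  assumes "simple_graph G" "adj G u v"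
  shows "u \<in> verts G" "v \<in> verts G" "u \<noteq> v"
  using assms unfolding simple_graph_def by (fastforce simp: doubleton_eq_iff)+

lemma simple_graph_finite: "simple_graph G \<Longrightarrow> finite (verts G)"
  by (simp add: simple_graph_def)

lemma simple_graph_edgeE:
  assumes "simple_graph G" "e \<in> edges G"
  obtains u v where "e = {u, v}" "u \<in> verts G" "v \<in> verts G" "u \<noteq> v"
  using assms unfolding simple_graph_def by blast

lemma verts_delete [simp]: "verts (delete_verts G U) = verts G - U"
  by (simp add: delete_verts_def)

lemma adj_delete [simp]: "adj (delete_verts G U) u v \<longleftrightarrow> adj G u v \<and> u \<notin> U \<and> v \<notin> U"
  by (auto simp: delete_verts_def)

lemma delete_delete: "delete_verts (delete_verts G U) W = delete_verts G (U \<union> W)"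
  by (auto simp: delete_verts_def)

lemma simple_delete: "simple_graph G \<Longrightarrow> simple_graph (delete_verts G U)"
  unfolding simple_graph_def delete_verts_def by fastforce

lemma in_nbrs: "simple_graph G \<Longrightarrow> v \<in> nbrs G A \<longleftrightarrow> (\<exists>u\<in>A. adj G u v)"
  unfolding nbrs_def by (auto dest: simple_graphD)

lemma in_closed_nbrs:
  "simple_graph G \<Longrightarrow> v \<in> closed_nbrs G A \<longleftrightarrow> v \<in> A \<or> (\<exists>u\<in>A. adj G u v)"
  unfolding closed_nbrs_def by (auto simp: in_nbrs)

lemma nbrs_subset: "nbrs G A \<subseteq> verts G"
  by (auto simp: nbrs_def)

lemma simplicial_iff:
  assumes "simple_graph G"
  shows "simplicial G x \<longleftrightarrow>
    x \<in> verts G \<and> (\<forall>u v. adj G x u \<longrightarrow> adj G x v \<longrightarrow> u \<noteq> v \<longrightarrow> adj G u v)"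
  unfolding simplicial_def by (auto simp: in_nbrs[OF assms])

lemma indep_setD: "indep_set G S \<Longrightarrow> u \<in> S \<Longrightarrow> v \<in> S \<Longrightarrow> \<not> adj G u v"
  by (auto simp: indep_set_def)

lemma indep_set_delete:
  "indep_set (delete_verts G U) S \<longleftrightarrow> indep_set G S \<and> S \<inter> U = {}"
  unfolding indep_set_def by auto

lemma indep_set_mono: "indep_set G S \<Longrightarrow> T \<subseteq> S \<Longrightarrow> indep_set G T"
  unfolding indep_set_def by blast

lemma indep_set_insert:
  assumes "simple_graph G"
  shows "indep_set G (insert x S) \<longleftrightarrow> x \<in> verts G \<and> indep_set G S \<and> (\<forall>s\<in>S. \<not> adj G x s)"
proof -
  have "\<not> adj G x x" using simple_graphD(3)[OF assms, of x x] by blast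
  thus ?thesis unfolding indep_set_def using adj_sym[of _ x G] by blast
qed

lemma residual_residual:
  assumes "simple_graph G" "B \<subseteq> verts (residual G A)"
  shows "residual (residual G A) B = residual G (A \<union> B)"
proof -
  have B: "u \<notin> A \<and> (\<forall>a\<in>A. \<not> adj G a u)" if "u \<in> B" for u
    using assms(2) that by (auto simp: in_closed_nbrs[OF assms(1)])
  have "closed_nbrs G A \<union> closed_nbrs (residual G A) B = closed_nbrs G (A \<union> B)"
    using B by (auto simp: in_closed_nbrs[OF assms(1)]
      in_closed_nbrs[OF simple_delete[OF assms(1)]])
  thus ?thesis by (simp add: delete_delete)
qed

lemma indep_set_residual_Un:
  assumes "simple_graph G" "indep_set G A" "indep_set (residual G A) B"
  shows "indep_set G (A \<union> B)" "B \<subseteq> verts (residual G A)"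
proof -
  show "B \<subseteq> verts (residual G A)" using assms(3) by (simp add: indep_set_def)
  have "u \<notin> A \<and> (\<forall>a\<in>A. \<not> adj G a u)" if "u \<in> B" for u
    using assms(3) that by (auto simp: indep_set_delete disjoint_iff in_closed_nbrs[OF assms(1)])
  moreover have "indep_set G B" using assms(3) by (simp add: indep_set_delete)
  ultimately show "indep_set G (A \<union> B)"
    using assms(2) adj_sym[of _ _ G] unfolding indep_set_def by blast
qed

lemma residually_simplicial_residual:
  assumes "simple_graph G" "residually_simplicial G" "indep_set G A"
  shows "residually_simplicial (residual G A)"
  unfolding residually_simplicial_def
proof (intro allI impI)
  fix B assume B: "indep_set (residual G A) B" "verts (residual (residual G A) B) \<noteq> {}"
  show "\<exists>x. simplicial (residual (residual G A) B) x"
    using assms(2) B indep_set_residual_Un[OF assms(1,3) B(1)]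
      residual_residual[OF assms(1)]
    unfolding residually_simplicial_def by metis
qed

lemma closed_nbrs_empty: "closed_nbrs G {} = {}"
  by (simp add: closed_nbrs_def nbrs_def)

lemma indep_set_empty: "indep_set G {}"
  by (simp add: indep_set_def)

text \<open>All other neighbours of \<open>x\<close> are adjacent to \<open>y\<close>. So an
  independent set avoiding N[y] contains neither \<open>x\<close> nor a neighbour of
  \<open>x\<close>, and it can be enlarged by \<open>x\<close> without using
  \<open>y\<close>.\<close>

lemma simplicial_nbr_shedding:
  assumes G: "simple_graph G" and x: "simplicial G x" and xy: "adj G x y"
  shows "shedding_vertex G y"
  unfolding shedding_vertex_def
proof (intro conjI notI)
  show "y \<in> verts G" using simple_graphD[OF G xy] by simp
  assume "\<exists>S. indep_set (residual G {y}) S \<and> maximal_indep_set (delete_verts G {y}) S"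
  then obtain S where S: "indep_set (residual G {y}) S" "maximal_indep_set (delete_verts G {y}) S"
    by blast
  have disj: "s \<noteq> y \<and> \<not> adj G y s" if "s \<in> S" for s
    using S(1) that by (auto simp: indep_set_delete in_closed_nbrs[OF G])
  have "\<not> adj G x s" if "s \<in> S" for s
    using x disj[OF that] xy unfolding simplicial_iff[OF G] by metis
  hence "indep_set (delete_verts G {y}) (insert x S)"
    using S(1) disj x simple_graphD[OF G xy]
    by (auto simp: indep_set_delete indep_set_insert[OF G] simplicial_def)
  hence "x \<in> S" using S(2) unfolding maximal_indep_set_def by blast
  thus False using disj xy adj_sym by metis
qed

text \<open>If \<open>y\<close> has a neighbour in \<open>A\<close>, deleting \<open>y\<close>
  beforehand does not change the residual graph. Otherwise \<open>A\<close> avoids N[x], because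
  every neighbour of \<open>x\<close> other than \<open>y\<close> is a neighbour of
  \<open>y\<close>; then \<open>x\<close> survives and remains simplicial.\<close>

lemma residually_simplicial_delete:
  assumes G: "simple_graph G" "residually_simplicial G" and x: "simplicial G x" and xy: "adj G x y"
  shows "residually_simplicial (delete_verts G {y})"
  unfolding residually_simplicial_def
proof (intro allI impI)
  let ?G = "delete_verts G {y}"
  note G' = simple_delete[OF G(1), of "{y}"]
  fix A assume A: "indep_set ?G A" "verts (residual ?G A) \<noteq> {}"
  have A': "indep_set G A" "y \<notin> A" using A(1) by (auto simp: indep_set_delete)
  show "\<exists>x. simplicial (residual ?G A) x"
  proof (cases "\<exists>a\<in>A. adj G a y")
    case True
    have "{y} \<union> closed_nbrs ?G A = closed_nbrs G A"
      using True A'(2) by (auto simp: in_closed_nbrs[OF G(1)] in_closed_nbrs[OF G'])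
    hence "residual ?G A = residual G A" by (simp add: delete_delete)
    thus ?thesis using A A'(1) G(2) unfolding residually_simplicial_def by metis
  next
    case False
    have "x \<noteq> y" using simple_graphD[OF G(1) xy] by simp
    have "a \<noteq> x \<and> \<not> adj G a x" if "a \<in> A" for a
      using x xy False that A'(2) adj_sym[of a x G] unfolding simplicial_iff[OF G(1)] by metis
    hence "x \<notin> closed_nbrs ?G A" by (auto simp: in_closed_nbrs[OF G'])
    hence "simplicial (residual ?G A) x"
      using x \<open>x \<noteq> y\<close> by (auto simp: simplicial_iff[OF G(1)] simplicial_iff[OF simple_delete[OF G']])
    thus ?thesis ..
  qed
qed

lemma residually_simplicial_imp_vertex_decomposable:
  assumes "simple_graph G" "residually_simplicial G"
  shows "vertex_decomposable G"
  using assms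
proof (induction "card (verts G)" arbitrary: G rule: less_induct)
  case less
  note G = less.prems
  show ?case
  proof (cases "edges G = {}")
    case True thus ?thesis by (rule vertex_decomposable.edgeless)
  next
    case False
    \<comment> \<open>Isolated vertices are simplicial but have no neighbour to shed. They form an
      independent set, and the hypothesis applied to it returns a simplicial vertex that has a
      neighbour.\<close>
    define A where "A = {v \<in> verts G. \<forall>u. \<not> adj G v u}"
    have nA: "v \<notin> A" if "adj G u v" for u v
      using that adj_sym[of u v G] by (auto simp: A_def)
    have A: "indep_set G A" by (auto simp: indep_set_def A_def)
    have clA: "closed_nbrs G A = A"
      using nA by (auto simp: in_closed_nbrs[OF G(1)] A_def)
    obtain u v where uv: "adj G u v" using False G(1) by (metis equals0I simple_graph_edgeE)
    have "v \<in> verts (residual G A)" using nA[OF uv] simple_graphD[OF G(1) uv] clA by simp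
    then obtain x where x: "simplicial (residual G A) x"
      using G(2) A unfolding residually_simplicial_def by blast
    hence xA: "x \<in> verts G" "x \<notin> A" using clA by (auto simp: simplicial_def)
    then obtain y where xy: "adj G x y" by (auto simp: A_def)
    have xs: "simplicial G x"
      unfolding simplicial_iff[OF G(1)]
    proof (intro conjI allI impI)
      fix u v assume uv: "adj G x u" "adj G x v" "u \<noteq> v"
      have "adj (residual G A) x u" "adj (residual G A) x v" using uv nA xA clA by simp_all
      hence "adj (residual G A) u v"
        using x uv(3) unfolding simplicial_iff[OF simple_delete[OF G(1)]] by blast
      thus "adj G u v" by simp
    qed (fact xA(1))
    have yV: "y \<in> verts G" using simple_graphD[OF G(1) xy] by simp
    have fin: "finite (verts G)" using G(1) by (rule simple_graph_finite)
    have iy: "indep_set G {y}" using yV simple_graphD[OF G(1), of y y] by (auto simp: indep_set_def)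
    have c: "y \<in> closed_nbrs G {y}" by (simp add: closed_nbrs_def)
    show ?thesis
    proof (rule vertex_decomposable.shed[of G y])
      show "shedding_vertex G y" by (rule simplicial_nbr_shedding[OF G(1) xs xy])
      show "vertex_decomposable (delete_verts G {y})"
        using less.hyps[OF _ simple_delete[OF G(1)] residually_simplicial_delete[OF G xs xy]]
          card_Diff1_less[OF fin yV] by simp
      show "vertex_decomposable (residual G {y})"
        using less.hyps[OF _ simple_delete[OF G(1)] residually_simplicial_residual[OF G iy]] yV c
          psubset_card_mono[OF fin, of "verts (residual G {y})"] by auto
    qed
  qed
qed

section \<open>Maximal independent sets and shellings of the independence complex\<close>

lemma maximal_indep_setD:
  assumes "simple_graph G" "maximal_indep_set G F" "v \<in> verts G" "v \<notin> F"
  shows "\<exists>u\<in>F. adj G v u"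
  using assms indep_set_insert[OF assms(1), of v F] unfolding maximal_indep_set_def by blast

lemma maximal_indep_setI:
  assumes "simple_graph G" "indep_set G F" "\<And>v. v \<in> verts G \<Longrightarrow> v \<notin> F \<Longrightarrow> \<exists>u\<in>F. adj G v u"
  shows "maximal_indep_set G F"
  unfolding maximal_indep_set_def
proof (intro conjI allI impI)
  fix T assume T: "indep_set G T" "F \<subseteq> T"
  hence "v \<in> F" if "v \<in> T" for v
    using assms(3)[of v] that unfolding indep_set_def by blast
  thus "T = F" using T by blast
qed (fact assms(2))

lemma indep_set_extend:
  assumes "simple_graph G" "indep_set G S"
  shows "\<exists>F. maximal_indep_set G F \<and> S \<subseteq> F"
proof -
  have fin: "finite {T. indep_set G T \<and> S \<subseteq> T}"
    by (rule finite_subset[of _ "Pow (verts G)"])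
       (auto simp: indep_set_def simple_graph_finite[OF assms(1)])
  obtain F where F: "F \<in> {T. indep_set G T \<and> S \<subseteq> T}"
    "\<forall>T\<in>{T. indep_set G T \<and> S \<subseteq> T}. F \<subseteq> T \<longrightarrow> F = T"
    using finite_has_maximal2[OF fin, of S] assms(2) by blast
  thus ?thesis unfolding maximal_indep_set_def by (intro exI[of _ F]) auto
qed

text \<open>A nonpure shelling of the independence complex: \<open>Fs\<close> lists its facets,
  which may differ in size.\<close>

definition shelled :: "'v graph \<Rightarrow> bool" where
  "shelled G \<longleftrightarrow> (\<exists>Fs. distinct Fs \<and> set Fs = {F. maximal_indep_set G F} \<and>
     (\<forall>i<length Fs. \<forall>j<i. \<exists>y\<in>Fs ! i - Fs ! j. \<exists>l<i. Fs ! i - Fs ! l = {y}))"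

text \<open>The facets through \<open>x\<close> come from the link in any case. Shedding is what
  makes a facet of the deletion a facet of \<open>G\<close>: it must contain a neighbour of
  \<open>x\<close>.\<close>

lemma maximal_indep_set_shedding:
  assumes G: "simple_graph G" and x: "shedding_vertex G x"
  shows "{F. maximal_indep_set G F} =
    {F. maximal_indep_set (delete_verts G {x}) F} \<union> insert x ` {F. maximal_indep_set (residual G {x}) F}"
    (is "?L = ?A \<union> ?B")
proof (intro equalityI subsetI)
  note Gx = simple_delete[OF G, of "{x}"]
  note Gr = simple_delete[OF G, of "closed_nbrs G {x}"]
  have xV: "x \<in> verts G" using x by (simp add: shedding_vertex_def)
  fix F
  {
    assume F: "F \<in> ?L"
    hence Fi: "indep_set G F" by (simp add: maximal_indep_set_def)
    show "F \<in> ?A \<union> ?B"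
    proof (cases "x \<in> F")
      case False
      hence "maximal_indep_set (delete_verts G {x}) F"
        using F unfolding maximal_indep_set_def by (auto simp: indep_set_delete)
      thus ?thesis by simp
    next
      case True
      have Fx: "\<not> adj G x v" if "v \<in> F" for v using Fi that True by (auto simp: indep_set_def)
      have "maximal_indep_set (residual G {x}) (F - {x})"
      proof (rule maximal_indep_setI[OF Gr])
        show "indep_set (residual G {x}) (F - {x})"
          using Fi Fx by (auto simp: indep_set_delete in_closed_nbrs[OF G] intro: indep_set_mono)
        fix v assume v: "v \<in> verts (residual G {x})" "v \<notin> F - {x}"
        hence v': "v \<in> verts G" "v \<notin> F" "\<not> adj G x v" by (auto simp: in_closed_nbrs[OF G])
        then obtain u where "u \<in> F" "adj G v u" using maximal_indep_setD[OF G] F by blast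
        thus "\<exists>u\<in>F - {x}. adj (residual G {x}) v u"
          using v v' Fx adj_sym[of v x G] by (auto simp: in_closed_nbrs[OF G])
      qed
      hence "F \<in> ?B" using True by (intro image_eqI[of _ _ "F - {x}"]) auto
      thus ?thesis by simp
    qed
  }
  assume F: "F \<in> ?A \<union> ?B"
  then consider "maximal_indep_set (delete_verts G {x}) F"
    | F' where "maximal_indep_set (residual G {x}) F'" "F = insert x F'" by blast
  thus "F \<in> ?L"
  proof cases
    case 1
    hence i: "indep_set G F" "x \<notin> F" by (auto simp: maximal_indep_set_def indep_set_delete)
    have "maximal_indep_set G F"
    proof (rule maximal_indep_setI[OF G i(1)])
      fix v assume v: "v \<in> verts G" "v \<notin> F"
      show "\<exists>u\<in>F. adj G v u"
      proof (cases "v = x")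
        case False
        thus ?thesis using maximal_indep_setD[OF Gx 1, of v] v by auto
      next
        case True
        have "\<not> indep_set (residual G {x}) F" using x 1 by (auto simp: shedding_vertex_def)
        thus ?thesis using i True by (auto simp: indep_set_delete in_closed_nbrs[OF G])
      qed
    qed
    thus ?thesis by simp
  next
    case 2
    hence i: "indep_set G F'" "x \<notin> F'" "\<forall>v\<in>F'. \<not> adj G x v"
      by (auto simp: maximal_indep_set_def indep_set_delete in_closed_nbrs[OF G])
    have "maximal_indep_set G F"
    proof (rule maximal_indep_setI[OF G])
      show "indep_set G F" using i xV 2 by (simp add: indep_set_insert[OF G])
      fix v assume v: "v \<in> verts G" "v \<notin> F"
      show "\<exists>u\<in>F. adj G v u"
      proof (cases "adj G x v")
        case True
        thus ?thesis using 2(2) adj_sym[of x v G] by (intro bexI[of _ x]) simp_all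
      next
        case False
        hence "v \<in> verts (residual G {x})" "v \<notin> F'"
          using v 2 by (auto simp: in_closed_nbrs[OF G])
        thus ?thesis using maximal_indep_setD[OF Gr 2(1)] 2(2) by auto
      qed
    qed
    thus ?thesis by simp
  qed
qed

lemma vertex_decomposable_imp_shelled:
  assumes "vertex_decomposable G" "simple_graph G"
  shows "shelled G"
  using assms
proof (induction rule: vertex_decomposable.induct)
  case (edgeless G)
  have "{F. maximal_indep_set G F} = {verts G}"
    using edgeless.hyps unfolding maximal_indep_set_def indep_set_def by auto
  thus ?case unfolding shelled_def by (intro exI[of _ "[verts G]"]) auto
next
  case (shed G x)
  note G = shed.prems
  note Gx = simple_delete[OF G, of "{x}"]
  obtain Fs where Fs: "distinct Fs" "set Fs = {F. maximal_indep_set (delete_verts G {x}) F}"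
    "\<And>i j. i<length Fs \<Longrightarrow> j<i \<Longrightarrow> \<exists>y\<in>Fs ! i - Fs ! j. \<exists>l<i. Fs ! i - Fs ! l = {y}"
    using shed.IH(1)[OF simple_delete[OF G]] unfolding shelled_def by blast
  obtain Ks where Ks: "distinct Ks" "set Ks = {F. maximal_indep_set (residual G {x}) F}"
    "\<And>i j. i<length Ks \<Longrightarrow> j<i \<Longrightarrow> \<exists>y\<in>Ks ! i - Ks ! j. \<exists>l<i. Ks ! i - Ks ! l = {y}"
    using shed.IH(2)[OF simple_delete[OF G]] unfolding shelled_def by blast
  have xF: "x \<notin> F" if "F \<in> set Fs" for F
    using that Fs(2) by (auto simp: maximal_indep_set_def indep_set_delete)
  have xK: "x \<notin> F" if "F \<in> set Ks" for F
    using that Ks(2) by (auto simp: maximal_indep_set_def indep_set_delete in_closed_nbrs[OF G])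
  \<comment> \<open>The facets avoiding \<open>x\<close> go first, so that each facet through
    \<open>x\<close> has a predecessor from which it differs in \<open>x\<close> alone.\<close>
  let ?L = "Fs @ map (insert x) Ks"
  have "\<exists>y\<in>?L ! i - ?L ! j. \<exists>l<i. ?L ! i - ?L ! l = {y}" if i: "i < length ?L" and j: "j < i" for i j
  proof (cases "i < length Fs")
    case True
    obtain y l where "y \<in> Fs ! i - Fs ! j" "l < i" "Fs ! i - Fs ! l = {y}"
      using Fs(3)[OF True j] by blast
    thus ?thesis using True j by (intro bexI[of _ y] exI[of _ l]) (auto simp: nth_append)
  next
    case False
    define i' where "i' = i - length Fs"
    have i': "i' < length Ks" "?L ! i = insert x (Ks ! i')"
      using False i by (auto simp: i'_def nth_append)
    show ?thesis
    proof (cases "j < length Fs")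
      case True
      have Ki: "Ks ! i' \<in> set Ks" using i' by simp
      \<comment> \<open>A facet of the link is independent in the deletion, so it lies in a facet
        \<open>F\<close> there; after adding \<open>x\<close> to it, only \<open>x\<close> is
        outside \<open>F\<close>.\<close>
      hence "indep_set (delete_verts G {x}) (Ks ! i')"
        using Ks(2) by (auto simp: maximal_indep_set_def indep_set_delete in_closed_nbrs[OF G])
      then obtain F where F: "F \<in> set Fs" "Ks ! i' \<subseteq> F"
        using indep_set_extend[OF Gx] Fs(2) by blast
      then obtain l where l: "l < length Fs" "F = Fs ! l" by (metis in_set_conv_nth)
      have "x \<in> ?L ! i - ?L ! j" using i' True xF by (simp add: nth_append)
      moreover have "?L ! i - ?L ! l = {x}" using i' l F xF by (auto simp: nth_append)
      moreover have "l < i" using l False by simp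
      ultimately show ?thesis by blast
    next
      case False
      define j' where "j' = j - length Fs"
      have j': "j' < i'" "?L ! j = insert x (Ks ! j')"
        using False i j i' by (auto simp: i'_def j'_def nth_append)
      obtain y l where yl: "y \<in> Ks ! i' - Ks ! j'" "l < i'" "Ks ! i' - Ks ! l = {y}"
        using Ks(3)[OF i'(1) j'(1)] by blast
      have yx: "y \<noteq> x" using yl i' xK by (metis DiffD1 nth_mem)
      have l: "?L ! (length Fs + l) = insert x (Ks ! l)" using yl i' by (simp add: nth_append)
      show ?thesis
      proof (intro bexI[of _ y] exI[of _ "length Fs + l"] conjI)
        show "length Fs + l < i" using yl(2) i'_def by simp
        show "?L ! i - ?L ! (length Fs + l) = {y}" using yl i' l yx by auto
        show "y \<in> ?L ! i - ?L ! j" using yl i' j' yx by auto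
      qed
    qed
  qed
  moreover have "set ?L = {F. maximal_indep_set G F}"
    using maximal_indep_set_shedding[OF G shed.hyps(1)] Fs(2) Ks(2) by auto
  moreover have "distinct ?L"
  proof -
    have "inj_on (insert x) (set Ks)" using xK by (meson inj_onI insert_ident)
    thus ?thesis using Fs(1) Ks(1) xF by (auto simp: distinct_map)
  qed
  ultimately show ?case unfolding shelled_def by blast
qed

text \<open>An independent set through a_i can be traded for one avoiding it: without a_i it is
  disjoint from N[a_i], hence by shedding not maximal in the deletion, and it can regain the lost
  vertex there. In the end the set consists of b_j only, so these form a maximum independent
  set.\<close>

lemma shedding_order_max_indep:
  assumes H: "simple_graph H" and as: "shedding_order H as" and S: "indep_set H S"
  shows "card S \<le> card (verts H - set as)"
proof -
  have *: "\<exists>T. indep_set (delete_verts H (set (take i as))) T \<and> card S \<le> card T"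
    if "i \<le> length as" for i
    using that
  proof (induction i)
    case 0
    thus ?case using S by (auto simp: indep_set_delete)
  next
    case (Suc i)
    let ?K = "delete_verts H (set (take i as))" and ?a = "as ! i"
    note K = simple_delete[OF H, of "set (take i as)"]
    obtain T where T: "indep_set ?K T" "card S \<le> card T" using Suc by auto
    have eq: "delete_verts H (set (take (Suc i) as)) = delete_verts ?K {?a}"
      using Suc.prems by (simp add: delete_delete take_Suc_conv_app_nth)
    show ?case
    proof (cases "?a \<in> T")
      case False
      thus ?thesis using T unfolding eq by (auto simp: indep_set_delete)
    next
      case True
      have fin: "finite (verts ?K)" using K by (rule simple_graph_finite)
      have sh: "shedding_vertex ?K ?a" using as Suc.prems by (simp add: shedding_order_def)
      have Ti: "indep_set (residual ?K {?a}) (T - {?a})"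
        unfolding indep_set_delete[of ?K]
        using T(1) True by (auto simp: in_closed_nbrs[OF K] intro: indep_set_mono dest: indep_setD)
      have "indep_set (delete_verts ?K {?a}) (T - {?a})"
        unfolding indep_set_delete[of ?K] using T(1) by (auto intro: indep_set_mono)
      then obtain T' where T': "indep_set (delete_verts ?K {?a}) T'" "T - {?a} \<subset> T'"
        using sh Ti unfolding shedding_vertex_def maximal_indep_set_def by blast
      have "finite T'" using T'(1) fin by (auto simp: indep_set_def intro: finite_subset)
      hence "card (T - {?a}) < card T'" using T'(2) by (rule psubset_card_mono)
      moreover have "card (T - {?a}) = card T - 1" using True by (simp add: card_Diff_singleton)
      ultimately have "card T \<le> card T'" by linarith
      thus ?thesis using T T' unfolding eq by (meson order_trans)
    qed
  qed
  obtain T where T: "indep_set (delete_verts H (set as)) T" "card S \<le> card T"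
    using *[of "length as"] by auto
  have "T \<subseteq> verts H - set as" using T(1) by (auto simp: indep_set_def)
  hence "card T \<le> card (verts H - set as)"
    using H by (intro card_mono) (auto simp: simple_graph_def)
  thus ?thesis using T by simp
qed

lemma shedding_order_subset: "shedding_order H as \<Longrightarrow> set as \<subseteq> verts H"
  unfolding shedding_order_def shedding_vertex_def by (auto simp: in_set_conv_nth)

lemma shedding_order_indep:
  "shedding_order H as \<Longrightarrow> indep_set H (verts H - set as)"
  unfolding shedding_order_def indep_set_def delete_verts_def by fastforce

section \<open>The leaf condition\<close>

text \<open>This keeps what the polarization needs from the vertex decomposability of
  \<open>shed_bip H as\<close>, without mentioning the order. The hypothesis on \<open>U\<close>
  makes \<open>U\<close>, together with the vertices outside \<open>B\<close> that have no neighbour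
  in \<open>U\<close>, a maximal independent set of the bipartite graph.\<close>

definition leaf_condition :: "'v graph \<Rightarrow> bool" where
  "leaf_condition H \<longleftrightarrow> (\<exists>B. indep_set H B \<and> (\<forall>S. indep_set H S \<longrightarrow> card S \<le> card B) \<and>
     (\<forall>U. U \<subseteq> B \<longrightarrow> U \<noteq> {} \<longrightarrow>
        (\<forall>x\<in>verts H. (\<forall>a. adj H x a \<longrightarrow> (\<exists>u\<in>U. adj H u a)) \<longrightarrow> x \<in> U) \<longrightarrow>
        (\<exists>v. \<exists>!u. u \<in> U \<and> adj H v u) \<or> (\<exists>u\<in>U. \<exists>a. \<forall>w. adj H u w \<longrightarrow> w = a)))"

lemma adj_shed_bip:
  assumes "simple_graph H"
  shows "adj (shed_bip H as) u v \<longleftrightarrow> adj H u v \<and> (u \<in> set as \<longleftrightarrow> v \<notin> set as)"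
proof -
  have "adj (shed_bip H as) u v \<longleftrightarrow> (\<exists>b a. {u, v} = {b, a} \<and> b \<in> verts H - set as \<and> a \<in> set as \<and> adj H b a)"
    by (simp add: shed_bip_def)
  thus ?thesis
    using simple_graphD[OF assms, of u v] adj_sym[of u v H] by (simp add: doubleton_eq_iff) blast
qed

lemma simple_shed_bip: "simple_graph H \<Longrightarrow> simple_graph (shed_bip H as)"
  by (auto simp: simple_graph_def shed_bip_def)

lemma verts_shed_bip [simp]: "verts (shed_bip H as) = verts H"
  by (simp add: shed_bip_def)

text \<open>In a shelling compare the facets \<open>F1\<close>, made of \<open>U\<close> and the a_j
  not adjacent to it, and \<open>F2\<close>, made of all a_j. If \<open>F1\<close> comes later, some
  vertex has just one neighbour in \<open>U\<close>; if \<open>F2\<close> comes later, some vertex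
  of \<open>U\<close> has just one neighbour.\<close>

lemma shed_bip_leaf_condition:
  assumes H: "simple_graph H" and as: "shedding_order H as"
    and vd: "vertex_decomposable (shed_bip H as)"
  shows "leaf_condition H"
proof -
  define B where "B = verts H - set as"
  let ?D = "shed_bip H as"
  note D = simple_shed_bip[OF H, of as] and adjD = adj_shed_bip[OF H]
  have asV: "set as \<subseteq> verts H" using as by (rule shedding_order_subset)
  have Bi: "indep_set H B" using shedding_order_indep[OF as] by (simp add: B_def)
  have Bmax: "card S \<le> card B" if "indep_set H S" for S
    using shedding_order_max_indep[OF H as that] by (simp add: B_def)
  obtain Fs where Fs: "set Fs = {F. maximal_indep_set ?D F}"
    "\<And>i j. i<length Fs \<Longrightarrow> j<i \<Longrightarrow> \<exists>y\<in>Fs ! i - Fs ! j. \<exists>l<i. Fs ! i - Fs ! l = {y}"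
    using vertex_decomposable_imp_shelled[OF vd D] unfolding shelled_def by blast
  have "(\<exists>v. \<exists>!u. u \<in> U \<and> adj H v u) \<or> (\<exists>u\<in>U. \<exists>a. \<forall>w. adj H u w \<longrightarrow> w = a)"
    if U: "U \<subseteq> B" "U \<noteq> {}"
      and cl: "\<And>x. x \<in> verts H \<Longrightarrow> (\<forall>a. adj H x a \<longrightarrow> (\<exists>u\<in>U. adj H u a)) \<Longrightarrow> x \<in> U" for U
  proof (rule ccontr)
    assume neg: "\<not> ?thesis"
    hence no1: "\<And>v. \<not> (\<exists>!u. u \<in> U \<and> adj H v u)"
      and no2: "\<And>u a. u \<in> U \<Longrightarrow> \<exists>w. adj H u w \<and> w \<noteq> a" by blast+
    have Bnb: "w \<in> set as" if "b \<in> B" "adj H b w" for b w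
      using that Bi simple_graphD[OF H that(2)] unfolding indep_set_def B_def by blast
    have BD: "adj ?D b w \<longleftrightarrow> adj H b w" if "b \<in> B" for b w
      using that Bnb[OF that, of w] unfolding adjD by (auto simp: B_def)
    have Bas: "b \<notin> set as" "b \<in> verts H" if "b \<in> B" for b using that by (auto simp: B_def)
    define F1 where "F1 = U \<union> {a \<in> set as. \<forall>u\<in>U. \<not> adj H u a}"
    define F2 where "F2 = set as"
    have F1: "maximal_indep_set ?D F1"
    proof (rule maximal_indep_setI[OF D])
      show "indep_set ?D F1"
        unfolding indep_set_def
        using asV U(1) Bas adj_sym[of _ _ H] unfolding F1_def adjD by (auto dest: subsetD)
      fix v assume v: "v \<in> verts ?D" "v \<notin> F1"
      show "\<exists>u\<in>F1. adj ?D v u"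
      proof (cases "v \<in> set as")
        case True
        then obtain u where u: "u \<in> U" "adj H u v" using v by (auto simp: F1_def)
        hence "adj ?D v u" using BD U(1) adj_sym[of u v ?D] by blast
        thus ?thesis using u by (auto simp: F1_def)
      next
        case False
        hence "v \<in> B" "v \<notin> U" using v by (auto simp: B_def F1_def)
        then obtain a where "adj H v a" "\<forall>u\<in>U. \<not> adj H u a" using cl[of v] Bas by blast
        thus ?thesis using Bnb BD \<open>v \<in> B\<close> by (intro bexI[of _ a]) (auto simp: F1_def)
      qed
    qed
    have F2: "maximal_indep_set ?D F2"
    proof (rule maximal_indep_setI[OF D])
      show "indep_set ?D F2" using asV unfolding indep_set_def F2_def adjD by auto
      fix v assume v: "v \<in> verts ?D" "v \<notin> F2"
      hence vB: "v \<in> B" by (simp add: B_def F2_def)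
      show "\<exists>u\<in>F2. adj ?D v u"
      proof (rule ccontr)
        assume "\<not> ?thesis"
        \<comment> \<open>A vertex of \<open>B\<close> without neighbours would belong to
          \<open>U\<close> by the closure hypothesis, and there it would satisfy the second
          alternative.\<close>
        hence "\<not> adj H v a" for a using Bnb[OF vB] BD[OF vB] by (auto simp: F2_def)
        thus False using cl[of v] no2[of v] v by auto
      qed
    qed
    obtain i j where ij: "i < length Fs" "Fs ! i = F1" "j < length Fs" "Fs ! j = F2"
      using F1 F2 Fs(1) by (metis in_set_conv_nth mem_Collect_eq)
    have "F1 \<noteq> F2" using U Bas by (auto simp: F1_def F2_def)
    hence "i \<noteq> j" using ij by auto
    then consider "j < i" | "i < j" by linarith
    thus False
    proof cases
      case 1
      obtain y l where y: "y \<in> F1 - F2" "l < i" "F1 - Fs ! l = {y}"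
        using Fs(2)[OF ij(1) 1] ij by blast
      have yU: "y \<in> U" using y by (auto simp: F1_def F2_def)
      have l: "maximal_indep_set ?D (Fs ! l)" "y \<notin> Fs ! l"
        using y ij Fs(1) nth_mem[of l Fs] by auto
      obtain w where w: "w \<in> Fs ! l" "adj ?D y w"
        using maximal_indep_setD[OF D l(1), of y] l(2) yU U(1) Bas by auto
      \<comment> \<open>\<open>Fs ! l\<close> still contains all of \<open>F1\<close> but
        \<open>y\<close>, so its member \<open>w\<close> has no neighbour in \<open>U\<close> other
        than \<open>y\<close>.\<close>
      have "u = y" if "u \<in> U" "adj H w u" for u
      proof (rule ccontr)
        assume "u \<noteq> y"
        hence "u \<in> Fs ! l" using y that by (auto simp: F1_def)
        moreover have "adj ?D u w" using BD that U(1) adj_sym[of u w H] by blast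
        ultimately show False using l w by (auto simp: maximal_indep_set_def indep_set_def)
      qed
      moreover have "adj H w y" using w unfolding adjD adj_sym[of w y H] by simp
      ultimately show False using no1[of w] yU by blast
    next
      case 2
      obtain y l where y: "y \<in> F2 - F1" "l < j" "F2 - Fs ! l = {y}"
        using Fs(2)[OF ij(3) 2] ij by blast
      have yA: "y \<in> set as" using y by (auto simp: F1_def F2_def)
      then obtain u where u: "u \<in> U" "adj H u y" using y by (auto simp: F1_def F2_def)
      have l: "maximal_indep_set ?D (Fs ! l)" "y \<notin> Fs ! l"
        using y ij Fs(1) nth_mem[of l Fs] by auto
      obtain w where w: "w \<in> Fs ! l" "adj ?D y w"
        using maximal_indep_setD[OF D l(1), of y] l(2) yA asV by auto
      hence wB: "w \<in> B" using yA D simple_graphD[OF D w(2)] unfolding adjD B_def by auto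
      \<comment> \<open>\<open>Fs ! l\<close> still contains all a_j but \<open>y\<close>, so
        \<open>y\<close> is the only neighbour of \<open>w\<close>. As \<open>y\<close> has a
        neighbour in \<open>U\<close>, closure puts \<open>w\<close> into \<open>U\<close>.\<close>
      have *: "a = y" if "adj H w a" for a
      proof (rule ccontr)
        assume "a \<noteq> y"
        hence "a \<in> Fs ! l" using y that Bnb[OF wB] by (auto simp: F2_def)
        moreover have "adj ?D w a" using BD that wB by blast
        ultimately show False using l w by (auto simp: maximal_indep_set_def indep_set_def)
      qed
      hence "w \<in> U" using cl[of w] u Bas[OF wB] by blast
      thus False using no2[of w y] * by blast
    qed
  qed
  thus ?thesis unfolding leaf_condition_def
    using Bi Bmax by (intro exI[of _ B] conjI allI impI) simp_all
qed

text \<open>Choosing simplicial vertices in \<open>Q\<close> greedily covers \<open>H\<close> by cliques, each of which meets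
  the maximum independent set \<open>B\<close> exactly once, and \<open>U\<close> consists of vertices so chosen. Hence
  the sets \<open>U\<close> that matter lie in every maximum independent set, which is why the choice of
  the shedding order is irrelevant.\<close>

lemma subset_maximum_indep_set:
  assumes H: "simple_graph H" "residually_simplicial H"
    and B: "indep_set H B" "\<And>S. indep_set H S \<Longrightarrow> card S \<le> card B"
    and Q: "Q \<subseteq> verts H"
      "\<And>X x. X \<subseteq> Q \<Longrightarrow> indep_set H X \<Longrightarrow> simplicial (residual H X) x \<Longrightarrow> x \<in> Q"
    and U: "U \<subseteq> verts H" "\<And>q u. q \<in> Q \<Longrightarrow> u \<in> U \<Longrightarrow> \<not> adj H q u"
      "\<And>v. \<not> (\<exists>!u. u \<in> U \<and> adj H v u)"
  shows "U \<subseteq> B"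
proof -
  have fin: "finite (verts H)" using H(1) by (rule simple_graph_finite)
  have BV: "B \<subseteq> verts H" using B(1) by (simp add: indep_set_def)
  note finB = finite_subset[OF BV fin]
  note cn = in_closed_nbrs[OF H(1)]
  \<comment> \<open>The bound says that the cliques removed so far have cost \<open>B\<close> at
    most one vertex each. The part of \<open>U\<close> not yet covered is known to lie in
    \<open>B\<close> when the next clique is examined.\<close>
  have "U \<inter> verts (residual H X) \<subseteq> B"
    if "X \<subseteq> Q" "indep_set H X" "card (B \<inter> closed_nbrs H X) \<le> card X" for X
    using that
  proof (induction "card (verts (residual H X))" arbitrary: X rule: less_induct)
    case less
    let ?W = "verts (residual H X)"
    show ?case
    proof (cases "?W = {}")
      case True thus ?thesis by blast
    next
      case False
      then obtain x where x: "simplicial (residual H X) x"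
        using H(2) less.prems unfolding residually_simplicial_def by blast
      have xQ: "x \<in> Q" using Q(2) less.prems x by blast
      have xW: "x \<in> verts H" "x \<notin> closed_nbrs H X" using x by (auto simp: simplicial_def)
      define X' where "X' = insert x X"
      define K where "K = closed_nbrs H {x} - closed_nbrs H X"
      let ?W' = "verts (residual H X')"
      have X': "X' \<subseteq> Q" "indep_set H X'"
        using less.prems xQ xW adj_sym[of x _ H]
        by (auto simp: X'_def indep_set_insert[OF H(1)] cn)
      have cl: "closed_nbrs H X' = closed_nbrs H X \<union> K"
        by (auto simp: X'_def K_def cn)
      have finX: "finite X" using less.prems Q(1) fin by (meson finite_subset)
      have xX: "x \<notin> X" using xW by (auto simp: cn)
      have xK: "x \<in> K" using xW by (auto simp: K_def cn)
      have K1: "b = b'" if b: "b \<in> K" "b' \<in> K" "b \<in> B" "b' \<in> B" for b b'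
      proof (rule ccontr)
        assume ne: "b \<noteq> b'"
        have "adj H b b'"
        proof (cases "b = x \<or> b' = x")
          case True thus ?thesis using ne b adj_sym[of x _ H] by (auto simp: K_def cn)
        next
          case False
          hence "adj (residual H X) x b" "adj (residual H X) x b'"
            using b xW by (auto simp: K_def cn)
          thus ?thesis
            using x ne unfolding simplicial_iff[OF simple_delete[OF H(1)]] by auto
        qed
        thus False using b B(1) by (auto simp: indep_set_def)
      qed
      have "card (B \<inter> K) \<le> 1"
        using K1 finB by (simp add: card_le_Suc0_iff_eq)
      moreover have "card (B \<inter> closed_nbrs H X') \<le> card (B \<inter> closed_nbrs H X) + card (B \<inter> K)"
        unfolding cl Int_Un_distrib by (rule card_Un_le)
      ultimately have "card (B \<inter> closed_nbrs H X') \<le> card X'"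
        using less.prems(3) finX xX by (simp add: X'_def)
      moreover have "card ?W' < card ?W"
      proof (rule psubset_card_mono)
        show "?W' \<subset> ?W" using xW xK unfolding verts_delete cl by blast
      qed (use fin in simp)
      ultimately have IH: "U \<inter> ?W' \<subseteq> B" using less.hyps X' by blast
      have "x \<in> B" if xU: "x \<in> U"
      proof (rule ccontr)
        assume xB: "x \<notin> B"
        have "B \<inter> K \<noteq> {}"
        proof
          \<comment> \<open>Then \<open>X'\<close> together with the remaining part of
            \<open>B\<close> would be independent and larger than \<open>B\<close>.\<close>
          assume e: "B \<inter> K = {}"
          have sub: "B \<subseteq> (B \<inter> closed_nbrs H X) \<union> (B \<inter> ?W')"
            using e BV unfolding verts_delete cl by blast
          have "card B \<le> card X + card (B \<inter> ?W')"
            using card_mono[OF _ sub] card_Un_le[of "B \<inter> closed_nbrs H X" "B \<inter> ?W'"]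
              finB less.prems(3) by simp
          moreover have "indep_set H (X' \<union> (B \<inter> ?W'))"
            using X'(2) B(1) by (intro indep_set_residual_Un[OF H(1)])
              (auto simp: indep_set_delete intro: indep_set_mono)
          moreover have "card (X' \<union> (B \<inter> ?W')) = card X' + card (B \<inter> ?W')"
            using finX finB by (intro card_Un_disjoint) (auto simp: X'_def cn)
          ultimately show False using B(2) finX xX by (fastforce simp: X'_def)
        qed
        then obtain b where b: "b \<in> B" "b \<in> K" by blast
        hence xb: "adj H x b" using xB by (auto simp: K_def cn)
        \<comment> \<open>A second neighbour of \<open>b\<close> in \<open>U\<close> lies neither in
          N[X] nor in \<open>K\<close>, since \<open>U\<close> has no neighbour in \<open>Q\<close>.
          So the induction hypothesis would place it in \<open>B\<close>, next to
          \<open>b\<close>.\<close>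
        have "u = x" if u: "u \<in> U" "adj H b u" for u
        proof (rule ccontr)
          assume ux: "u \<noteq> x"
          have nK: "u \<notin> K" using u(1) ux U(2)[OF xQ] by (auto simp: K_def cn)
          have "u \<notin> closed_nbrs H X"
            using u b less.prems(1) U(2)[of _ u] adj_sym[of u b H] by (auto simp: K_def cn)
          hence "u \<in> B" using IH u(1) U(1) nK unfolding verts_delete cl by blast
          thus False using u b B(1) by (auto simp: indep_set_def)
        qed
        thus False using U(3)[of b] xU xb adj_sym[of x b H] by metis
      qed
      moreover have "u = x" if "u \<in> U" "u \<in> ?W" "u \<notin> ?W'" for u
        using that U(2)[OF xQ] unfolding verts_delete cl by (auto simp: K_def cn)
      ultimately show ?thesis using IH by blast
    qed
  qed
  from this[of "{}"] show ?thesis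
    using U(1) by (auto simp: indep_set_empty closed_nbrs_empty)
qed

section \<open>Polarization\<close>

text \<open>The cover ideal of this graph is the polarization of the \<open>k\<close>-th symbolic power of the
  cover ideal of \<open>G\<close>: the vertex \<open>(v, p)\<close> stands for the \<open>p\<close>-th copy of the variable \<open>v\<close>.\<close>

definition polarization :: "'v graph \<Rightarrow> nat \<Rightarrow> ('v \<times> nat) graph" where
  "polarization G k = (verts G \<times> {1..k},
     {{(u, p), (v, q)} | u p v q. adj G u v \<and> 1 \<le> p \<and> 1 \<le> q \<and> p + q \<le> k + 1})"

lemma adj_polarization:
  "adj (polarization G k) (u, p) (v, q) \<longleftrightarrow> adj G u v \<and> 1 \<le> p \<and> 1 \<le> q \<and> p + q \<le> k + 1"
  unfolding polarization_def by (auto simp: doubleton_eq_iff insert_commute)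

lemma verts_polarization [simp]: "verts (polarization G k) = verts G \<times> {1..k}"
  by (simp add: polarization_def)

lemma simple_polarization:
  assumes "simple_graph G"
  shows "simple_graph (polarization G k)"
  unfolding simple_graph_def
proof (intro conjI ballI)
  show "finite (verts (polarization G k))" using simple_graph_finite[OF assms] by simp
  fix e assume "e \<in> edges (polarization G k)"
  then obtain u p v q where e: "e = {(u, p), (v, q)}" "adj G u v" "1 \<le> p" "1 \<le> q" "p + q \<le> k + 1"
    unfolding polarization_def by auto
  thus "\<exists>u\<in>verts (polarization G k). \<exists>v\<in>verts (polarization G k). u \<noteq> v \<and> e = {u, v}"
    using simple_graphD[OF assms e(2)]
    by (intro bexI[of _ "(u, p)"] bexI[of _ "(v, q)"]) auto
qed

lemma simplicial_residualI:
  assumes "simple_graph G" "x \<in> verts (residual G A)"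
    "\<And>u v. u \<in> verts (residual G A) \<Longrightarrow> v \<in> verts (residual G A) \<Longrightarrow> adj G x u \<Longrightarrow> adj G x v \<Longrightarrow>
       u \<noteq> v \<Longrightarrow> adj G u v"
  shows "simplicial (residual G A) x"
  unfolding simplicial_iff[OF simple_delete[OF assms(1)]]
proof (intro conjI allI impI)
  fix u v
  assume *: "adj (residual G A) x u" "adj (residual G A) x v" "u \<noteq> v"
  have "u \<in> verts (residual G A)" "v \<in> verts (residual G A)"
    using simple_graphD(2)[OF simple_delete[OF assms(1)]] *(1,2) by metis+
  thus "adj (residual G A) u v" using assms(3)[of u v] * by simp
qed (fact assms(2))

text \<open>Suppose that nothing simplicial survives the removal of N[C]. A copy on level
  \<open>k\<close> is adjacent to level one only, and over \<open>H\<close> level one retains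
  exactly \<open>U\<close>. Hence no vertex sees \<open>U\<close> exactly once, and \<open>Q\<close>
  has the closure property asked for by \<open>subset_maximum_indep_set\<close>. Now
  \<open>leaf_condition\<close> supplies a vertex \<open>u\<close> of \<open>U\<close> with at most
  one neighbour, whose highest surviving copy is simplicial after all. If \<open>U\<close> is empty,
  so are levels one and \<open>k\<close>, and induction applies to what is left.\<close>

lemma residually_simplicial_polarization:
  assumes "simple_graph G" "residually_simplicial G"
    and "\<And>A. indep_set G A \<Longrightarrow> leaf_condition (residual G A)"
  shows "residually_simplicial (polarization G k)"
  using assms
proof (induction k arbitrary: G rule: less_induct)
  case (less k)
  note G = less.prems
  let ?P = "polarization G k"
  note P = simple_polarization[OF G(1), of k]
  show ?case
    unfolding residually_simplicial_def
  proof (intro allI impI)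
    fix C assume C: "indep_set ?P C" "verts (residual ?P C) \<noteq> {}"
    define R where "R = verts (residual ?P C)"
    have CV: "v \<in> verts G \<and> 1 \<le> p \<and> p \<le> k" if "(v, p) \<in> C" for v p
      using C(1) that by (auto simp: indep_set_def)
    have R: "(v, p) \<in> R \<longleftrightarrow> v \<in> verts G \<and> 1 \<le> p \<and> p \<le> k \<and> (v, p) \<notin> C \<and>
        (\<forall>w q. (w, q) \<in> C \<longrightarrow> adj G w v \<longrightarrow> k + 1 < q + p)" for v p
      unfolding R_def using CV
      by (auto simp: in_closed_nbrs[OF P] adj_polarization) (metis not_le)
    have Cind: "k + 1 < p + q" if "(v, p) \<in> C" "(w, q) \<in> C" "adj G v w" for v p w q
      using C(1) that CV[OF that(1)] CV[OF that(2)]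
      unfolding indep_set_def by (fastforce simp: adj_polarization not_le)
    let ?simp = "\<exists>x. simplicial (residual ?P C) x"
    have simpI: ?simp
      if "(v, p) \<in> R" "\<And>w q w' q'. (w, q) \<in> R \<Longrightarrow> (w', q') \<in> R \<Longrightarrow> adj G v w \<Longrightarrow> adj G v w' \<Longrightarrow>
         p + q \<le> k + 1 \<Longrightarrow> p + q' \<le> k + 1 \<Longrightarrow> (w, q) \<noteq> (w', q') \<Longrightarrow> adj G w w' \<and> q + q' \<le> k + 1" for v p
    proof (intro exI[of _ "(v, p)"] simplicial_residualI[OF P])
      show "(v, p) \<in> verts (residual ?P C)" using that(1) by (simp add: R_def)
      fix a b
      assume ab: "a \<in> verts (residual ?P C)" "b \<in> verts (residual ?P C)"
        "adj ?P (v, p) a" "adj ?P (v, p) b" "a \<noteq> b"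
      obtain w q w' q' where e: "a = (w, q)" "b = (w', q')" by fastforce
      have "adj G w w' \<and> q + q' \<le> k + 1"
        by (rule that(2)) (use ab in \<open>simp_all add: e R_def[symmetric] adj_polarization del: verts_delete\<close>)
      moreover have "(w, q) \<in> R" "(w', q') \<in> R" using ab by (simp_all add: e R_def del: verts_delete)
      ultimately show "adj ?P a b" by (auto simp: e adj_polarization R)
    qed
    \<comment> \<open>A copy on level one is adjacent to all copies of its neighbours, so the effect
      of level one of \<open>C\<close> is that of an ordinary residual graph of
      \<open>G\<close>.\<close>
    define X0 where "X0 = {v. (v, 1) \<in> C}"
    define H where "H = residual G X0"
    have X0: "indep_set G X0"
      using Cind[of _ 1 _ 1] CV C(2) unfolding indep_set_def X0_def by fastforce
    have H: "simple_graph H" "residually_simplicial H"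
      unfolding H_def using simple_delete[OF G(1)] residually_simplicial_residual[OF G(1,2) X0] by auto
    have HG: "adj H u v \<longleftrightarrow> adj G u v" if "u \<in> verts H" "v \<in> verts H" for u v
      using that by (auto simp: H_def)
    have HV: "v \<in> verts H \<longleftrightarrow> v \<in> verts G \<and> (v, 1) \<notin> C \<and> (\<forall>w. (w, 1) \<in> C \<longrightarrow> \<not> adj G w v)" for v
      unfolding H_def by (auto simp: in_closed_nbrs[OF G(1)] X0_def)
    show ?simp
    proof (rule ccontr)
      assume neg: "\<not> ?thesis"
      have RH: "v \<in> verts H" if "(v, p) \<in> R" for v p
      proof -
        \<comment> \<open>Otherwise no copy of a neighbour of \<open>v\<close> survives, and
          \<open>(v, p)\<close> is isolated, hence simplicial.\<close>
        have "(v, 1) \<notin> C"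
        proof
          assume v1: "(v, 1) \<in> C"
          have "\<not> (w, q) \<in> R" if "adj G v w" for w q using R[of w q] v1 that by fastforce
          thus False using neg simpI[OF that] by blast
        qed
        thus ?thesis using that by (fastforce simp: HV R)
      qed
      have CH: "w \<in> verts H" "q \<noteq> 1" if "(w, q) \<in> C" "adj G w v" "v \<in> verts H" for w q v
      proof -
        have w1: "(w, 1) \<notin> C" using that HV by blast
        thus "q \<noteq> 1" using that by auto
        have "(u, 1) \<notin> C" if "adj G u w" for u
          using Cind[of u 1 w q] \<open>(w, q) \<in> C\<close> CV[of w q] that by auto
        thus "w \<in> verts H" using w1 CV[OF that(1)] by (auto simp: HV)
      qed
      \<comment> \<open>\<open>Q\<close> holds the vertices of \<open>H\<close> that
        \<open>C\<close> touches above level one; \<open>U\<close> will be those whose copy on level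
        one survives.\<close>
      define Q where "Q = {v \<in> verts H. \<exists>p. (v, p) \<in> C}"
      define U where "U = {u \<in> verts H. \<forall>q\<in>Q. \<not> adj H q u}"
      have k1: "1 \<le> k" using C(2) by (cases k) auto
      have UR: "(u, 1) \<in> R \<longleftrightarrow> u \<in> U" for u
      proof
        assume u: "(u, 1) \<in> R"
        hence uH: "u \<in> verts H" using RH by blast
        have "\<not> adj H q u" if "q \<in> Q" for q
          using that u uH CV unfolding Q_def R by (fastforce simp: HG)
        thus "u \<in> U" using uH by (simp add: U_def)
      next
        assume u: "u \<in> U"
        hence uH: "u \<in> verts H" by (simp add: U_def)
        have "\<not> adj G w u" if "(w, q) \<in> C" for w q
          using u that CH(1)[OF that _ uH] HG[OF _ uH] by (auto simp: U_def Q_def)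
        thus "(u, 1) \<in> R" using uH k1 by (auto simp: R HV)
      qed
      \<comment> \<open>A copy on level \<open>k\<close> disappears only through a neighbour on
        level one or by lying in \<open>C\<close> itself.\<close>
      have topR: "(v, k) \<in> R" if "v \<in> verts H" "v \<notin> Q" for v
      proof -
        have "k + 1 < q + k" if "(w, q) \<in> C" "adj G w v" for w q
          using CH(2)[OF that \<open>v \<in> verts H\<close>] CV[OF that(1)] by linarith
        thus ?thesis using that k1 by (auto simp: R HV Q_def)
      qed
      \<comment> \<open>For \<open>x\<close> outside \<open>Q\<close> the copy on level
        \<open>k\<close> survives, and its surviving neighbours are level-one copies of members of
        \<open>U\<close>. None of these members lies in N[X], because \<open>X\<close> is part of
        \<open>Q\<close>; so they form a clique, and the copy would be simplicial.\<close>
      have Qcl: "x \<in> Q" if X: "X \<subseteq> Q" "indep_set H X" "simplicial (residual H X) x" for X x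
      proof (rule ccontr)
        assume xQ: "x \<notin> Q"
        note HX = simple_delete[OF H(1), of "closed_nbrs H X"]
        have x: "x \<in> verts H" "x \<notin> closed_nbrs H X" using X(3) by (auto simp: simplicial_def)
        have nb: "q = 1 \<and> adj (residual H X) x w"
          if "(w, q) \<in> R" "adj G x w" "k + q \<le> k + 1" for w q
        proof -
          have q1: "q = 1" using that R[of w q] by simp
          have wU: "w \<in> U" using that q1 UR by blast
          have wH: "w \<in> verts H" using that RH by blast
          have xw: "adj H x w" using that HG x(1) wH by blast
          have "w \<notin> closed_nbrs H X"
            using wU X(1) x(2) xw adj_sym[of x w H] by (auto simp: in_closed_nbrs[OF H(1)] U_def)
          thus ?thesis using q1 xw x by simp
        qed
        have ?simp
        proof (rule simpI[OF topR[OF x(1) xQ]])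
          fix w q w' q'
          assume a: "(w, q) \<in> R" "(w', q') \<in> R" "adj G x w" "adj G x w'" "k + q \<le> k + 1"
            "k + q' \<le> k + 1" "(w, q) \<noteq> (w', q')"
          have "adj (residual H X) w w'"
            using X(3) nb[OF a(1,3,5)] nb[OF a(2,4,6)] a(7) unfolding simplicial_iff[OF HX] by auto
          thus "adj G w w' \<and> q + q' \<le> k + 1"
            using nb[OF a(1,3,5)] nb[OF a(2,4,6)] k1 RH a(1,2) HG by auto
        qed
        thus False using neg by blast
      qed
      show False
      proof (cases "U = {}")
        case True
        have R1: "p \<noteq> 1" if "(v, p) \<in> R" for v p using that UR True by auto
        have Rk: "p \<noteq> k" if "(v, p) \<in> R" for v p
        proof
          assume "p = k"
          \<comment> \<open>Level \<open>k\<close> is adjacent to level one only, which is empty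
            here.\<close>
          hence "\<not> (w, q) \<in> R" if "p + q \<le> k + 1" for w q
            using R1[of w q] R[of w q] that by auto
          thus False using neg simpI[OF that] by blast
        qed
        obtain v0 p0 where v0: "(v0, p0) \<in> R" using C(2) unfolding R_def by fast
        have k3: "3 \<le> k" using R1[OF v0] Rk[OF v0] R[of v0 p0] v0 by simp
        \<comment> \<open>Discarding levels one and \<open>k\<close> and lowering the others by one
          turns \<open>p + q \<le> k + 1\<close> into the same condition for
          \<open>k - 2\<close>.\<close>
        define k' where "k' = k - 2"
        have k': "k' < k" "k = k' + 2" "1 \<le> k'" using k3 by (auto simp: k'_def)
        let ?P' = "polarization H k'"
        note P' = simple_polarization[OF H(1), of k']
        define C' where "C' = {(v, p). v \<in> verts H \<and> 1 \<le> p \<and> p \<le> k' \<and> (v, Suc p) \<in> C}"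
        have lc: "leaf_condition (residual H A)" if "indep_set H A" for A
          using G(3)[of "X0 \<union> A"] indep_set_residual_Un[OF G(1) X0] that
            residual_residual[OF G(1), of A X0] unfolding H_def by metis
        have rs: "residually_simplicial ?P'" using less.IH[OF k'(1) H lc] by blast
        have C'i: "indep_set ?P' C'"
          unfolding indep_set_def
        proof (intro conjI ballI)
          show "C' \<subseteq> verts ?P'" by (auto simp: C'_def)
          fix a b assume ab: "a \<in> C'" "b \<in> C'"
          obtain v p w q where e: "a = (v, p)" "b = (w, q)" by fastforce
          thus "\<not> adj ?P' a b"
            using ab Cind[of v "Suc p" w "Suc q"] k' by (auto simp: adj_polarization C'_def HG)
        qed
        define R' where "R' = verts (residual ?P' C')"
        have R': "(v, p) \<in> R' \<longleftrightarrow> v \<in> verts H \<and> 1 \<le> p \<and> p \<le> k' \<and> (v, p) \<notin> C' \<and>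
          (\<forall>w q. (w, q) \<in> C' \<longrightarrow> adj H w v \<longrightarrow> k' + 1 < q + p)" for v p
          unfolding R'_def
          by (auto simp: in_closed_nbrs[OF P'] adj_polarization C'_def not_le[symmetric])
        have RR': "(v, Suc p) \<in> R \<longleftrightarrow> (v, p) \<in> R'" for v p
        proof
          assume a: "(v, Suc p) \<in> R"
          hence vH: "v \<in> verts H" using RH by blast
          have "p \<noteq> 0" "Suc p \<noteq> k" using R1[OF a] Rk[OF a] by auto
          hence p: "1 \<le> p" "p \<le> k'" using a k' by (auto simp: R)
          have "k' + 1 < q + p" if "(w, q) \<in> C'" "adj H w v" for w q
          proof -
            have "(w, Suc q) \<in> C" "adj G w v" using that vH HG by (auto simp: C'_def)
            thus ?thesis using a k' by (fastforce simp: R)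
          qed
          thus "(v, p) \<in> R'" using vH p a by (auto simp: R' R C'_def)
        next
          assume a: "(v, p) \<in> R'"
          hence vH: "v \<in> verts H" and p: "1 \<le> p" "p \<le> k'" by (auto simp: R')
          have "k + 1 < q + Suc p" if "(w, q) \<in> C" "adj G w v" for w q
          proof -
            have wH: "w \<in> verts H" "q \<noteq> 1" using CH[OF that vH] by auto
            have q: "1 \<le> q" "q \<le> k" using CV[OF that(1)] by auto
            \<comment> \<open>A member of \<open>C\<close> on level \<open>k\<close> affects level
              one only, which is why \<open>C'\<close> may forget it.\<close>
            show ?thesis
            proof (cases "q = k")
              case True thus ?thesis using p by simp
            next
              case False
              hence "(w, q - 1) \<in> C'" using that wH q k' by (auto simp: C'_def)
              moreover have "adj H w v" using that wH vH HG by blast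
              ultimately have "k' + 1 < q - 1 + p" using a by (auto simp: R')
              thus ?thesis using k' q by linarith
            qed
          qed
          thus "(v, Suc p) \<in> R" using a p vH k' by (auto simp: R HV R' C'_def)
        qed
        obtain p1 where "p0 = Suc p1" using v0 R by (cases p0) auto
        hence "R' \<noteq> {}" using v0 RR' by auto
        then obtain x where x: "simplicial (residual ?P' C') x"
          using rs C'i unfolding residually_simplicial_def R'_def by blast
        obtain v p where vp: "x = (v, p)" by fastforce
        have vR: "(v, p) \<in> R'" using x vp unfolding R'_def simplicial_def by simp
        have adjR: "adj (residual ?P' C') (w, q) (w', q') \<longleftrightarrow> adj ?P' (w, q) (w', q')"
          if "(w, q) \<in> R'" "(w', q') \<in> R'" for w q w' q'
          using that unfolding R'_def by simp
        have ?simp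
        proof (rule simpI[of v "Suc p"])
          show vRp: "(v, Suc p) \<in> R" using vR RR' by blast
          fix w q w' q'
          assume a: "(w, q) \<in> R" "(w', q') \<in> R" "adj G v w" "adj G v w'" "Suc p + q \<le> k + 1"
            "Suc p + q' \<le> k + 1" "(w, q) \<noteq> (w', q')"
          obtain q1 q1' where q: "q = Suc q1" "q' = Suc q1'" using a(1,2) R by (metis not_one_le_zero not0_implies_Suc)
          have r: "(w, q1) \<in> R'" "(w', q1') \<in> R'" using a(1,2) q RR' by auto
          have h: "v \<in> verts H" "w \<in> verts H" "w' \<in> verts H" using r vR by (auto simp: R')
          have "adj ?P' (v, p) (w, q1)" "adj ?P' (v, p) (w', q1')"
            using a q r vR k' h by (auto simp: adj_polarization HG R')
          hence "adj (residual ?P' C') (w, q1) (w', q1')"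
            using x a(7) q adjR r vR unfolding vp simplicial_iff[OF simple_delete[OF P']] by blast
          hence "adj ?P' (w, q1) (w', q1')" using adjR r by blast
          thus "adj G w w' \<and> q + q' \<le> k + 1" using h q k' by (auto simp: adj_polarization HG)
        qed
        thus False using neg by blast
      next
        case False
        \<comment> \<open>The copy of such a \<open>v\<close> on level \<open>k\<close> survives,
          since \<open>v\<close> is outside \<open>Q\<close>, and it would have a single
          neighbour.\<close>
        have no1: "\<not> (\<exists>!u. u \<in> U \<and> adj H v u)" for v
        proof
          assume ex: "\<exists>!u. u \<in> U \<and> adj H v u"
          then obtain u where u: "u \<in> U" "adj H v u" by blast
          have vH: "v \<in> verts H" using simple_graphD[OF H(1) u(2)] by simp
          have "v \<notin> Q" using u by (auto simp: U_def)
          have nb: "q = 1 \<and> w \<in> U \<and> adj H v w"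
            if "(w, q) \<in> R" "adj G v w" "k + q \<le> k + 1" for w q
          proof -
            have "q = 1" using that R[of w q] by simp
            thus ?thesis using that UR RH[OF that(1)] HG vH by blast
          qed
          have ?simp
            by (rule simpI[OF topR[OF vH \<open>v \<notin> Q\<close>]]) (use nb ex in blast)
          thus False using neg by blast
        qed
        obtain B where B: "indep_set H B" "\<And>S. indep_set H S \<Longrightarrow> card S \<le> card B"
          and BU: "\<And>U. U \<subseteq> B \<Longrightarrow> U \<noteq> {} \<Longrightarrow>
           (\<And>x. x \<in> verts H \<Longrightarrow> (\<forall>a. adj H x a \<longrightarrow> (\<exists>u\<in>U. adj H u a)) \<Longrightarrow> x \<in> U) \<Longrightarrow>
           (\<exists>v. \<exists>!u. u \<in> U \<and> adj H v u) \<or> (\<exists>u\<in>U. \<exists>a. \<forall>w. adj H u w \<longrightarrow> w = a)"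
          using G(3)[OF X0] unfolding H_def[symmetric] leaf_condition_def by auto
        have "U \<subseteq> B"
        proof (rule subset_maximum_indep_set[OF H B _ Qcl])
          show "Q \<subseteq> verts H" by (auto simp: Q_def)
          show "U \<subseteq> verts H" by (auto simp: U_def)
          show "\<not> adj H q u" if "q \<in> Q" "u \<in> U" for q u using that by (auto simp: U_def)
        qed (use no1 in auto)
        moreover have "x \<in> U" if x: "x \<in> verts H" "\<forall>a. adj H x a \<longrightarrow> (\<exists>u\<in>U. adj H u a)" for x
        proof -
          have "\<not> adj H q x" if "q \<in> Q" for q
            using x(2) that adj_sym[of x q H] adj_sym[of _ q H] by (auto simp: U_def)
          thus ?thesis using x(1) by (simp add: U_def)
        qed
        ultimately obtain u a where u: "u \<in> U" "\<And>w. adj H u w \<Longrightarrow> w = a"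
          using BU[of U] False no1 by blast
        have uH: "u \<in> verts H" using u by (simp add: U_def)
        \<comment> \<open>Higher copies have fewer neighbours, and all surviving neighbours are
          copies of \<open>a\<close>.\<close>
        define p where "p = Max {p. (u, p) \<in> R}"
        have fin: "finite {p. (u, p) \<in> R}"
          by (rule finite_subset[of _ "{..k}"]) (auto simp: R)
        have u1: "(u, 1) \<in> R" using u UR by blast
        have pR: "(u, p) \<in> R" using Max_in[OF fin] u1 unfolding p_def by blast
        have pmax: "p' \<le> p" if "(u, p') \<in> R" for p' using Max_ge[OF fin] that unfolding p_def by blast
        have na: "w = a" if "(w, q) \<in> R" "adj G u w" for w q
          using u(2) that RH[OF that(1)] HG[OF uH] by blast
        \<comment> \<open>Two surviving copies of \<open>a\<close> next to \<open>(u, p)\<close> are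
          impossible: the lower one, on level \<open>q\<close>, keeps \<open>(u, k + 1 - q)\<close>
          out of \<open>C\<close>, so this copy survives, and it lies above level
          \<open>p\<close>.\<close>
        have lev: False if q: "(a, q) \<in> R" "(a, q') \<in> R" "adj G u a" "q < q'" "p + q' \<le> k + 1" for q q'
        proof -
          define p' where "p' = k + 1 - q"
          have qk: "1 \<le> q" "q \<le> k" using q(1) R by auto
          have p': "1 \<le> p'" "p' \<le> k" "p < p'" using q qk by (auto simp: p'_def)
          have "(u, p') \<notin> C" using q(1,3) qk by (fastforce simp: R p'_def)
          moreover have "\<not> adj G w u" if "(w, r) \<in> C" for w r
            using u1 that CV[OF that] by (fastforce simp: R)
          ultimately have "(u, p') \<in> R" using p' uH by (auto simp: R HV)
          thus False using pmax p' by fastforce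
        qed
        have ?simp
        proof (rule simpI[OF pR])
          fix w q w' q'
          assume a: "(w, q) \<in> R" "(w', q') \<in> R" "adj G u w" "adj G u w'" "p + q \<le> k + 1"
            "p + q' \<le> k + 1" "(w, q) \<noteq> (w', q')"
          have "w = a" "w' = a" using na a by auto
          thus "adj G w w' \<and> q + q' \<le> k + 1"
            using lev[of q q'] lev[of q' q] a by (metis linorder_neqE_nat)
        qed
        thus False using neg by blast
      qed
    qed
  qed
qed

section \<open>Monomial ideals\<close>

abbreviation "lookup \<equiv> Poly_Mapping.lookup"
abbreviation "keys \<equiv> Poly_Mapping.keys"
abbreviation "single \<equiv> Poly_Mapping.single"

definition divides :: "'v monom \<Rightarrow> 'v monom \<Rightarrow> bool" where
  "divides u t \<longleftrightarrow> (\<forall>x. lookup u x \<le> lookup t x)"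

definition upset :: "'v monom set \<Rightarrow> 'v monom set" where
  "upset M = {t. \<exists>u\<in>M. divides u t}"

text \<open>For \<open>T\<close> closed under multiplication by monomials this is the ideal spanned
  by \<open>T\<close>. Membership is read off the support, which turns ideal arithmetic into
  statements on exponent vectors.\<close>

definition monom_ideal :: "'v set \<Rightarrow> 'v monom set \<Rightarrow> ('v, 'k::field) mpoly set" where
  "monom_ideal V T = {p \<in> carrier (poly_ring V). keys p \<subseteq> T}"

lemma poly_ring_simps [simp]:
  "p \<oplus>\<^bsub>poly_ring V\<^esub> q = p + q" "p \<otimes>\<^bsub>poly_ring V\<^esub> q = p * q"
  "\<zero>\<^bsub>poly_ring V\<^esub> = 0" "\<one>\<^bsub>poly_ring V\<^esub> = 1"
  by (simp_all add: poly_ring_def)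

lemma in_poly_ring: "p \<in> carrier (poly_ring V) \<longleftrightarrow> (\<forall>t\<in>keys p. keys t \<subseteq> V)"
  by (simp add: poly_ring_def)

lemma keys_monom_add: "keys (s + t :: 'v monom) = keys s \<union> keys t"
  by (auto simp: in_keys_iff lookup_add)

lemma divides_add: "divides u (u + s)"
  by (simp add: divides_def lookup_add)

lemma divides_refl: "divides u u"
  by (simp add: divides_def)

lemma divides_trans: "divides u t \<Longrightarrow> divides t s \<Longrightarrow> divides u s"
  unfolding divides_def using order_trans by blast

lemma divides_eq: "divides u t \<Longrightarrow> t = u + (t - u)"
  by (rule poly_mapping_eqI) (simp add: divides_def lookup_add lookup_minus)

lemma divides_antisym: "divides u t \<Longrightarrow> divides t u \<Longrightarrow> u = t"
  by (rule poly_mapping_eqI) (simp add: divides_def order_antisym)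

lemma keys_minus_monom: "keys (t - u :: 'v monom) \<subseteq> keys t"
  by (auto simp: in_keys_iff lookup_minus)

lemma divides_single: "divides (single x 1) t \<longleftrightarrow> x \<in> keys t"
  by (auto simp: divides_def in_keys_iff lookup_single when_def Suc_le_eq)

lemma mono_in_poly_ring: "mono t \<in> carrier (poly_ring V) \<longleftrightarrow> keys t \<subseteq> V"
  by (simp add: in_poly_ring mono_def)

lemma var_in_poly_ring: "var x \<in> carrier (poly_ring V) \<longleftrightarrow> x \<in> V"
  by (simp add: var_def mono_in_poly_ring)

lemma poly_as_sum: "p = (\<Sum>t\<in>keys p. single t (lookup p t))"
  by (rule poly_mapping_eqI) (simp add: lookup_sum lookup_single when_def in_keys_iff)

lemma times_single_as_sum:
  "p * single s c = (\<Sum>t\<in>keys p. single (t + s) (lookup p t * c))"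
  by (subst poly_as_sum) (simp add: sum_distrib_right mult_single)

lemma lookup_times_single:
  fixes p :: "('v, 'k::field) mpoly"
  shows "lookup (p * single s c) (t + s) = lookup p t * c"
proof -
  have "lookup (p * single s c) (t + s) = (\<Sum>t'\<in>keys p. if t' = t then lookup p t' * c else 0)"
    unfolding times_single_as_sum lookup_sum by (rule sum.cong) (auto simp: lookup_single when_def)
  thus ?thesis by (simp add: in_keys_iff)
qed

lemma lookup_times_mono: "lookup (p * mono s) (t + s) = lookup p t"
  by (simp add: mono_def lookup_times_single)

lemma keys_times: "t \<in> keys (p * q) \<Longrightarrow> \<exists>a\<in>keys p. \<exists>b\<in>keys q. t = a + b"
  using keys_mult[of p q] by blast

lemma ring_poly_ring: "ring (poly_ring V)"
  using cring_poly_ring[of V] by (rule cring.axioms)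

lemma poly_ring_uminus: "p \<in> carrier (poly_ring V) \<Longrightarrow> - p \<in> carrier (poly_ring V)"
  by (simp add: in_poly_ring)

lemma poly_ring_closed:
  fixes p q :: "('v, 'k::field) mpoly"
  assumes "p \<in> carrier (poly_ring V)" "q \<in> carrier (poly_ring V)"
  shows "p + q \<in> carrier (poly_ring V)" "p * q \<in> carrier (poly_ring V)"
    "p - q \<in> carrier (poly_ring V)"
proof -
  show "p + q \<in> carrier (poly_ring V)"
    using ring.ring_simprules(1)[OF ring_poly_ring assms] by simp
  show "p * q \<in> carrier (poly_ring V)"
    using ring.ring_simprules(5)[OF ring_poly_ring assms] by simp
  show "p - q \<in> carrier (poly_ring V)"
    using ring.ring_simprules(1)[OF ring_poly_ring assms(1) poly_ring_uminus[OF assms(2)]] by simp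
qed

lemma poly_ring_0_1 [simp]: "0 \<in> carrier (poly_ring V)" "1 \<in> carrier (poly_ring V)"
  by (simp_all add: in_poly_ring)

lemma poly_ring_sum:
  "(\<And>a. a \<in> A \<Longrightarrow> f a \<in> carrier (poly_ring V)) \<Longrightarrow> sum f A \<in> carrier (poly_ring V)"
  by (induction A rule: infinite_finite_induct) (auto intro: poly_ring_closed)

lemma ideal_poly_ringD:
  assumes "ideal I (poly_ring V)"
  shows "0 \<in> I" "p \<in> I \<Longrightarrow> q \<in> I \<Longrightarrow> p + q \<in> I"
    "p \<in> I \<Longrightarrow> r \<in> carrier (poly_ring V) \<Longrightarrow> r * p \<in> I"
    "p \<in> I \<Longrightarrow> p \<in> carrier (poly_ring V)"
proof -
  interpret ideal I "poly_ring V" by fact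
  show "0 \<in> I" using additive_subgroup.zero_closed[OF is_additive_subgroup] by simp
  show "p \<in> I \<Longrightarrow> q \<in> I \<Longrightarrow> p + q \<in> I"
    using additive_subgroup.a_closed[OF is_additive_subgroup, of p q] by simp
  show "p \<in> I \<Longrightarrow> r \<in> carrier (poly_ring V) \<Longrightarrow> r * p \<in> I" using I_l_closed[of p r] by simp
  show "p \<in> I \<Longrightarrow> p \<in> carrier (poly_ring V)" by (rule Icarr)
qed

lemma ideal_poly_ringI:
  fixes I :: "('v, 'k::field) mpoly set"
  assumes "I \<subseteq> carrier (poly_ring V)" "0 \<in> I"
    "\<And>p q. p \<in> I \<Longrightarrow> q \<in> I \<Longrightarrow> p + q \<in> I"
    "\<And>p r. p \<in> I \<Longrightarrow> r \<in> carrier (poly_ring V) \<Longrightarrow> r * p \<in> I"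
  shows "ideal I (poly_ring V)"
proof (rule idealI)
  let ?R = "poly_ring V :: ('v, 'k) mpoly ring"
  interpret cring ?R by (rule cring_poly_ring)
  show "ring ?R" by (rule ring_poly_ring)
  have neg: "\<ominus>\<^bsub>?R\<^esub> p = - p" if "p \<in> carrier ?R" for p
    by (rule minus_equality) (use that poly_ring_uminus[OF that] in auto)
  have mone: "- 1 \<in> carrier ?R"
    using poly_ring_uminus[of 1 V] by (simp add: in_poly_ring)
  show "subgroup I (add_monoid ?R)"
  proof (rule add.subgroupI)
    show "I \<noteq> {}" using assms(2) by blast
    fix p assume p: "p \<in> I"
    show "\<ominus>\<^bsub>?R\<^esub> p \<in> I" using assms(1) assms(4)[OF p mone] p neg[of p] by auto
  qed (use assms in auto)
  show "x \<otimes>\<^bsub>?R\<^esub> a \<in> I" "a \<otimes>\<^bsub>?R\<^esub> x \<in> I" if "a \<in> I" "x \<in> carrier ?R" for a x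
    using assms(4)[OF that] by (simp_all add: mult.commute)
qed

lemma ideal_sum:
  assumes "ideal I (poly_ring V)" "\<And>a. a \<in> A \<Longrightarrow> f a \<in> I"
  shows "sum f A \<in> I"
  using assms(2) by (induction A rule: infinite_finite_induct)
    (auto intro: ideal_poly_ringD[OF assms(1)])

lemma ideal_monom_ideal:
  fixes T :: "'v monom set"
  assumes "\<And>t s. t \<in> T \<Longrightarrow> keys s \<subseteq> V \<Longrightarrow> t + s \<in> T"
  shows "ideal (monom_ideal V T :: ('v, 'k::field) mpoly set) (poly_ring V)"
proof (rule ideal_poly_ringI)
  show "monom_ideal V T \<subseteq> carrier (poly_ring V)" by (auto simp: monom_ideal_def)
  show "0 \<in> monom_ideal V T" by (simp add: monom_ideal_def)
  fix p :: "('v, 'k) mpoly" assume p: "p \<in> monom_ideal V T"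
  show "p + q \<in> monom_ideal V T" if "q \<in> monom_ideal V T" for q
    using p that Poly_Mapping.keys_add[of p q] by (auto simp: monom_ideal_def poly_ring_closed)
  fix r :: "('v, 'k) mpoly" assume r: "r \<in> carrier (poly_ring V)"
  have "t \<in> T" if t: "t \<in> keys (r * p)" for t
  proof -
    obtain a b where "a \<in> keys r" "b \<in> keys p" "t = a + b" using keys_times[OF t] by blast
    thus ?thesis using p r assms[of b a] by (auto simp: monom_ideal_def in_poly_ring add.commute)
  qed
  thus "r * p \<in> monom_ideal V T" using p r by (auto simp: monom_ideal_def poly_ring_closed)
qed

lemma upset_self: "u \<in> M \<Longrightarrow> u \<in> upset M"
  unfolding upset_def using divides_refl by blast

lemma upset_closed: "t \<in> upset M \<Longrightarrow> t + s \<in> upset M"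
  unfolding upset_def using divides_trans divides_add by blast

lemma monom_ideal_subset:
  fixes I :: "('v, 'k::field) mpoly set"
  assumes I: "ideal I (poly_ring V)"
    and T: "\<And>t. t \<in> T \<Longrightarrow> keys t \<subseteq> V \<Longrightarrow> mono t \<in> I"
  shows "monom_ideal V T \<subseteq> I"
proof
  fix p :: "('v, 'k) mpoly" assume p: "p \<in> monom_ideal V T"
  have "(\<Sum>t\<in>keys p. single t (lookup p t)) \<in> I"
  proof (rule ideal_sum[OF I])
    fix t assume "t \<in> keys p"
    hence "mono t \<in> I" using T p by (auto simp: monom_ideal_def in_poly_ring)
    moreover have "single 0 (lookup p t) \<in> carrier (poly_ring V)"
      by (simp add: in_poly_ring)
    ultimately have "single 0 (lookup p t) * mono t \<in> I"
      using ideal_poly_ringD(3)[OF I] by blast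
    thus "single t (lookup p t) \<in> I" by (simp add: mono_def mult_single)
  qed
  thus "p \<in> I" by (simp add: poly_as_sum[symmetric])
qed

lemma mono_in_monom_ideal: "mono t \<in> monom_ideal V T \<longleftrightarrow> keys t \<subseteq> V \<and> t \<in> T"
  by (simp add: monom_ideal_def mono_in_poly_ring) (simp add: mono_def)

lemma genideal_mono:
  fixes M :: "'v monom set"
  assumes M: "\<And>u. u \<in> M \<Longrightarrow> keys u \<subseteq> V"
  shows "Idl\<^bsub>poly_ring V\<^esub> (mono ` M) = (monom_ideal V (upset M) :: ('v, 'k::field) mpoly set)"
proof
  let ?R = "poly_ring V :: ('v, 'k) mpoly ring"
  have sub: "mono ` M \<subseteq> carrier ?R" using M by (auto simp: mono_in_poly_ring)
  show "Idl\<^bsub>?R\<^esub> (mono ` M) \<subseteq> monom_ideal V (upset M)"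
  proof (rule ring.genideal_minimal[OF ring_poly_ring ideal_monom_ideal])
    show "mono ` M \<subseteq> monom_ideal V (upset M)"
      using M by (auto simp: mono_in_monom_ideal intro: upset_self)
  qed (rule upset_closed)
  have I: "ideal (Idl\<^bsub>?R\<^esub> (mono ` M)) ?R"
    by (rule ring.genideal_ideal[OF ring_poly_ring sub])
  show "monom_ideal V (upset M) \<subseteq> Idl\<^bsub>?R\<^esub> (mono ` M)"
  proof (rule monom_ideal_subset[OF I])
    fix t assume "t \<in> upset M" and t: "keys t \<subseteq> V"
    then obtain u where u: "u \<in> M" "divides u t" by (auto simp: upset_def)
    have "mono u \<in> Idl\<^bsub>?R\<^esub> (mono ` M)"
      using ring.genideal_self[OF ring_poly_ring sub] u by blast
    moreover have "mono (t - u) \<in> carrier ?R"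
      using t keys_minus_monom[of t u] by (auto simp: mono_in_poly_ring)
    ultimately have "mono (t - u) * mono u \<in> Idl\<^bsub>?R\<^esub> (mono ` M)"
      using ideal_poly_ringD(3)[OF I] by blast
    moreover have "mono (t - u) * mono u = (mono t :: ('v, 'k) mpoly)"
      using divides_eq[OF u(2)] by (simp add: mono_def mult_single add.commute)
    ultimately show "mono t \<in> Idl\<^bsub>?R\<^esub> (mono ` M)" by simp
  qed
qed

lemma genideal_var:
  assumes "X \<subseteq> V"
  shows "Idl\<^bsub>poly_ring V\<^esub> (var ` X) =
    (monom_ideal V {t. \<exists>x\<in>X. x \<in> keys t} :: ('v, 'k::field) mpoly set)"
proof -
  have eq: "(var ` X :: ('v, 'k) mpoly set) = mono ` ((\<lambda>x. single x 1) ` X)"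
    by (auto simp: var_def)
  have up: "upset ((\<lambda>x. single x 1) ` X) = {t. \<exists>x\<in>X. x \<in> keys t}"
    by (auto simp: upset_def divides_single simp del: One_nat_def)
  show ?thesis unfolding eq up[symmetric] by (rule genideal_mono) (use assms in auto)
qed

text \<open>Products add exponents; conversely a monomial of positive total degree in
  \<open>x\<close> and \<open>y\<close> can be divided by one of them, which lowers that degree by
  one.\<close>

lemma edge_ideal_power:
  assumes xy: "x \<in> V" "y \<in> V" "x \<noteq> y"
  shows "(Idl\<^bsub>poly_ring V\<^esub> (var ` {x, y})) [^]\<^bsub>ideals_set (poly_ring V)\<^esub> (k::nat) =
    (monom_ideal V {t. k \<le> lookup t x + lookup t y} :: ('v, 'k::field) mpoly set)"
proof (induction k)
  case 0
  show ?case by (simp add: nat_pow_def ideals_set_def monom_ideal_def)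
next
  case (Suc k)
  let ?R = "poly_ring V :: ('v, 'k) mpoly ring"
  let ?T = "\<lambda>k. {t. k \<le> lookup t x + lookup t y}"
  have idl: "ideal (monom_ideal V (?T k)) ?R" for k
    by (rule ideal_monom_ideal) (auto simp: lookup_add)
  have 1: "Idl\<^bsub>?R\<^esub> (var ` {x, y}) = monom_ideal V (?T 1)"
    using xy by (subst genideal_var) (auto simp: in_keys_iff intro!: arg_cong2[where f = monom_ideal])
  have step: "(Idl\<^bsub>?R\<^esub> (var ` {x, y})) [^]\<^bsub>ideals_set ?R\<^esub> (Suc k) =
    ideal_prod ?R (monom_ideal V (?T k)) (monom_ideal V (?T 1))"
    using Suc unfolding 1 by (simp add: nat_pow_def ideals_set_def)
  have "ideal_prod ?R (monom_ideal V (?T k)) (monom_ideal V (?T 1)) = monom_ideal V (?T (Suc k))"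
  proof
    show "ideal_prod ?R (monom_ideal V (?T k)) (monom_ideal V (?T 1)) \<subseteq> monom_ideal V (?T (Suc k))"
    proof
      fix p assume "p \<in> ideal_prod ?R (monom_ideal V (?T k)) (monom_ideal V (?T 1))"
      thus "p \<in> monom_ideal V (?T (Suc k))"
      proof induction
        case (prod i j)
        have "t \<in> ?T (Suc k)" if "t \<in> keys (i * j)" for t
          using keys_times[OF that] prod by (fastforce simp: monom_ideal_def lookup_add)
        thus ?case using prod by (auto simp: monom_ideal_def poly_ring_closed)
      next
        case (sum p q)
        thus ?case using ideal_poly_ringD(2)[OF idl] by simp
      qed
    qed
    show "monom_ideal V (?T (Suc k)) \<subseteq> ideal_prod ?R (monom_ideal V (?T k)) (monom_ideal V (?T 1))"
    proof (rule monom_ideal_subset[OF ring.ideal_prod_is_ideal[OF ring_poly_ring idl idl]])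
      fix t assume t: "t \<in> ?T (Suc k)" "keys t \<subseteq> V"
      hence "lookup t x \<noteq> 0 \<or> lookup t y \<noteq> 0" by auto
      then obtain z where z: "z \<in> {x, y}" "lookup t z \<noteq> 0" by blast
      let ?z = "single z 1 :: 'v monom"
      have "divides ?z t" using z by (simp only: divides_single in_keys_iff) simp
      hence "t = (t - ?z) + ?z" using divides_eq[of ?z t] by (simp add: add.commute)
      hence "mono t = mono (t - ?z) \<otimes>\<^bsub>?R\<^esub> mono ?z"
        by (metis mono_def mult_single mult_1 poly_ring_simps(2))
      moreover have a: "mono (t - ?z) \<in> monom_ideal V (?T k)"
        using t z xy(3) keys_minus_monom[of t ?z]
        by (auto simp: mono_in_monom_ideal lookup_minus lookup_single when_def)
      moreover have b: "mono ?z \<in> monom_ideal V (?T 1)"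
        using xy z by (auto simp: mono_in_monom_ideal lookup_single when_def)
      ultimately show "mono t \<in> ideal_prod ?R (monom_ideal V (?T k)) (monom_ideal V (?T 1))"
        using ideal_prod.prod[OF a b, of ?R] by metis
    qed
  qed
  thus ?case using step by simp
qed

section \<open>Symbolic powers of the cover ideal as sets of exponent vectors\<close>

definition fractional_covers :: "'v graph \<Rightarrow> nat \<Rightarrow> 'v monom set" where
  "fractional_covers G k = {t. \<forall>u v. adj G u v \<longrightarrow> k \<le> lookup t u + lookup t v}"

lemma cover_ideal_sympow_eq:
  assumes "simple_graph G"
  shows "cover_ideal_sympow G k = (monom_ideal (verts G) (fractional_covers G k) :: ('v, 'k::field) mpoly set)"
proof -
  have "(\<forall>e\<in>edges G. p \<in> (Idl\<^bsub>poly_ring (verts G)\<^esub> (var ` e)) [^]\<^bsub>ideals_set (poly_ring (verts G))\<^esub> k)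
      \<longleftrightarrow> keys p \<subseteq> fractional_covers G k" (is "?L \<longleftrightarrow> ?R")
    if p: "p \<in> carrier (poly_ring (verts G))" for p :: "('v, 'k) mpoly"
  proof -
    have "?L \<longleftrightarrow> (\<forall>u v. adj G u v \<longrightarrow>
      p \<in> (Idl\<^bsub>poly_ring (verts G)\<^esub> (var ` {u, v})) [^]\<^bsub>ideals_set (poly_ring (verts G))\<^esub> k)"
      using simple_graph_edgeE[OF assms] by metis
    also have "\<dots> \<longleftrightarrow> (\<forall>u v. adj G u v \<longrightarrow> p \<in> monom_ideal (verts G) {t. k \<le> lookup t u + lookup t v})"
    proof (intro iff_allI imp_cong refl)
      fix u v assume "adj G u v"
      thus "p \<in> (Idl\<^bsub>poly_ring (verts G)\<^esub> (var ` {u, v})) [^]\<^bsub>ideals_set (poly_ring (verts G))\<^esub> k \<longleftrightarrow>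
          p \<in> monom_ideal (verts G) {t. k \<le> lookup t u + lookup t v}"
        using simple_graphD[OF assms] by (subst edge_ideal_power) auto
    qed
    also have "\<dots> \<longleftrightarrow> ?R" using p by (auto simp: monom_ideal_def fractional_covers_def)
    finally show ?thesis .
  qed
  thus ?thesis by (auto simp: cover_ideal_sympow_def Let_def monom_ideal_def)
qed

section \<open>Linear quotients\<close>

text \<open>A monomial generator is redundant precisely when another one divides it.\<close>

lemma minimal_monomial_generators_iff:
  "minimal_monomial_generators V (I :: ('v, 'k::field) mpoly set) M \<longleftrightarrow>
    (\<forall>t\<in>M. keys t \<subseteq> V) \<and> I = monom_ideal V (upset M) \<and> (\<forall>u\<in>M. \<forall>w\<in>M. divides u w \<longrightarrow> u = w)"
  (is "?L \<longleftrightarrow> ?R")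
proof
  assume L: ?L
  hence M: "\<forall>t\<in>M. keys t \<subseteq> V" and I: "I = monom_ideal V (upset M)"
    using genideal_mono[of M V] by (auto simp: minimal_monomial_generators_def)
  have "u = w" if uw: "u \<in> M" "w \<in> M" "divides u w" for u w
  proof (rule ccontr)
    assume "u \<noteq> w"
    hence "upset (M - {w}) = upset M"
      using uw divides_trans by (fastforce simp: upset_def)
    hence "Idl\<^bsub>poly_ring V\<^esub> (mono ` (M - {w})) = I"
      using M I genideal_mono[of "M - {w}" V] by auto
    moreover have "M - {w} \<subset> M" using uw by blast
    ultimately show False using L unfolding minimal_monomial_generators_def by blast
  qed
  thus ?R using M I by blast
next
  assume R: ?R
  have "Idl\<^bsub>poly_ring V\<^esub> (mono ` N) \<noteq> I" if N: "N \<subset> M" for N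
  proof
    assume eq: "Idl\<^bsub>poly_ring V\<^esub> (mono ` N) = I"
    obtain w where w: "w \<in> M" "w \<notin> N" using N by blast
    have "mono w \<in> (monom_ideal V (upset M) :: ('v, 'k) mpoly set)"
      using R w by (auto simp: mono_in_monom_ideal upset_def intro: divides_refl)
    moreover have "Idl\<^bsub>poly_ring V\<^esub> (mono ` N) = (monom_ideal V (upset N) :: ('v, 'k) mpoly set)"
      by (rule genideal_mono) (use R N in auto)
    ultimately have "mono w \<in> (monom_ideal V (upset N) :: ('v, 'k) mpoly set)"
      using eq R by simp
    then obtain u where "u \<in> N" "divides u w" unfolding mono_in_monom_ideal upset_def by blast
    thus False using R w N by blast
  qed
  thus ?L using R genideal_mono[of M V] by (auto simp: minimal_monomial_generators_def)
qed

text \<open>The colon ideal of the predecessors of u_i by u_i is generated by the monomials u_j /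
  gcd(u_j, u_i) with j < i. It is generated by variables iff each of these monomials is divisible by
  a variable that lies in the colon ideal.\<close>

definition exponent_quotients :: "'v monom list \<Rightarrow> bool" where
  "exponent_quotients us \<longleftrightarrow> (\<forall>i<length us. \<forall>j<i. \<exists>x. lookup (us ! i) x < lookup (us ! j) x \<and>
     (\<exists>l<i. divides (us ! l) (us ! i + single x 1)))"

lemma linear_quotients_iff:
  "linear_quotients V (I :: ('v, 'k::field) mpoly set) \<longleftrightarrow>
    (\<exists>us. distinct us \<and> minimal_monomial_generators V I (set us) \<and> exponent_quotients us)"
proof -
  let ?R = "poly_ring V :: ('v, 'k) mpoly ring"
  have "(\<exists>X\<subseteq>V. ideal_colon ?R (Idl\<^bsub>?R\<^esub> (mono ` set (take i us))) (Idl\<^bsub>?R\<^esub> {mono (us ! i)}) =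
      (Idl\<^bsub>?R\<^esub> (var ` X))) \<longleftrightarrow>
    (\<forall>j<i. \<exists>x. lookup (us ! i) x < lookup (us ! j) x \<and>
     (\<exists>l<i. divides (us ! l) (us ! i + single x 1)))" (is "?P \<longleftrightarrow> ?Q")
    if us: "\<forall>u\<in>set us. keys u \<subseteq> V" and i: "i < length us" for us i
  proof -
    let ?u = "us ! i"
    let ?I = "monom_ideal V (upset (set (take i us))) :: ('v, 'k) mpoly set"
    let ?C = "ideal_colon ?R ?I (monom_ideal V (upset {?u}))"
    have kV: "keys (us ! j) \<subseteq> V" if "j \<le> i" for j using us i that by simp
    have take: "w \<in> upset (set (take i us)) \<longleftrightarrow> (\<exists>l<i. divides (us ! l) w)" for w
      using i by (auto simp: upset_def nth_image[symmetric] less_imp_le)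
    have e1: "Idl\<^bsub>?R\<^esub> (mono ` set (take i us)) = ?I"
      using us by (intro genideal_mono) (auto dest: in_set_takeD)
    have e2: "Idl\<^bsub>?R\<^esub> {mono ?u} = monom_ideal V (upset {?u})"
      using kV genideal_mono[of "{?u}" V] by auto
    \<comment> \<open>The ideal of \<open>?u\<close> is principal and monomial, so membership in the
      colon ideal is decided on \<open>?u\<close> alone, one monomial of \<open>r\<close> at a
      time.\<close>
    have C: "r \<in> ?C \<longleftrightarrow> r \<in> carrier ?R \<and> (\<forall>t\<in>keys r. \<exists>l<i. divides (us ! l) (t + ?u))" for r
    proof
      assume r: "r \<in> ?C"
      have "mono ?u \<in> (monom_ideal V (upset {?u}) :: ('v, 'k) mpoly set)"
        using kV by (auto simp: mono_in_monom_ideal upset_def intro: divides_refl)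
      hence rI: "r * mono ?u \<in> ?I" using r by (simp add: ideal_colon_def)
      have "t + ?u \<in> keys (r * mono ?u)" if "t \<in> keys r" for t
        using that by (simp add: in_keys_iff lookup_times_mono)
      thus "r \<in> carrier ?R \<and> (\<forall>t\<in>keys r. \<exists>l<i. divides (us ! l) (t + ?u))"
        using r rI take unfolding ideal_colon_def monom_ideal_def by blast
    next
      assume r: "r \<in> carrier ?R \<and> (\<forall>t\<in>keys r. \<exists>l<i. divides (us ! l) (t + ?u))"
      have "r * j \<in> ?I" if j: "j \<in> monom_ideal V (upset {?u})" for j
      proof -
        have "t \<in> upset (set (take i us))" if t: "t \<in> keys (r * j)" for t
        proof -
          obtain a b where ab: "a \<in> keys r" "b \<in> keys j" "t = a + b" using keys_times[OF t] by blast
          hence "divides ?u b" using j by (auto simp: monom_ideal_def upset_def)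
          hence "divides (a + ?u) t" using ab by (simp add: divides_def lookup_add)
          thus ?thesis using r ab take divides_trans by blast
        qed
        thus ?thesis using r j by (auto simp: monom_ideal_def poly_ring_closed)
      qed
      thus "r \<in> ?C" using r by (simp add: ideal_colon_def)
    qed
    show ?thesis
    proof
      assume ?P
      then obtain X where X1: "X \<subseteq> V" "?C = Idl\<^bsub>?R\<^esub> (var ` X)"
        unfolding e1 e2 by blast
      hence X: "X \<subseteq> V" "?C = monom_ideal V {t. \<exists>x\<in>X. x \<in> keys t}"
        by (simp_all add: genideal_var)
      show ?Q
      proof (intro allI impI)
        fix j assume j: "j < i"
        \<comment> \<open>Truncated subtraction: \<open>?d\<close> is \<open>us ! j\<close> divided
          by its greatest common divisor with \<open>?u\<close>, a monomial of the colon
          ideal.\<close>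
        let ?d = "us ! j - ?u"
        have "keys ?d \<subseteq> V" using kV[of j] j keys_minus_monom by fastforce
        moreover have "divides (us ! j) (?d + ?u)"
          by (auto simp: divides_def lookup_add lookup_minus)
        ultimately have "mono ?d \<in> ?C"
          unfolding C mono_in_poly_ring using j by (auto simp: mono_def)
        then obtain x where x: "x \<in> X" "x \<in> keys ?d"
          unfolding X(2) mono_in_monom_ideal by blast
        have "mono (single x 1) \<in> ?C"
          unfolding X(2) mono_in_monom_ideal using x X(1) by auto
        hence "\<exists>l<i. divides (us ! l) (?u + single x 1)"
          unfolding C by (auto simp: mono_def add.commute)
        moreover have "lookup ?u x < lookup (us ! j) x" using x by (simp add: in_keys_iff lookup_minus)
        ultimately show "\<exists>x. lookup ?u x < lookup (us ! j) x \<and>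
          (\<exists>l<i. divides (us ! l) (?u + single x 1))" by blast
      qed
    next
      assume Q: ?Q
      \<comment> \<open>All the variables that lie in the colon ideal.\<close>
      define X where "X = {x \<in> V. \<exists>l<i. divides (us ! l) (?u + single x 1)}"
      have "(\<exists>l<i. divides (us ! l) (t + ?u)) \<longleftrightarrow> (\<exists>x\<in>X. x \<in> keys t)" if t: "keys t \<subseteq> V" for t
      proof
        assume "\<exists>l<i. divides (us ! l) (t + ?u)"
        then obtain j where j: "j < i" "divides (us ! j) (t + ?u)" by blast
        then obtain x l where x: "lookup ?u x < lookup (us ! j) x" "l < i"
          "divides (us ! l) (?u + single x 1)" using Q by blast
        have "lookup (us ! j) x \<le> lookup t x + lookup ?u x"
          using j(2) by (simp add: divides_def lookup_add)
        hence "x \<in> keys t" using x(1) by (auto simp: in_keys_iff)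
        thus "\<exists>x\<in>X. x \<in> keys t" using x t by (auto simp: X_def)
      next
        assume "\<exists>x\<in>X. x \<in> keys t"
        then obtain x l where x: "x \<in> keys t" "l < i" "divides (us ! l) (?u + single x 1)"
          by (auto simp: X_def)
        have "divides (?u + single x 1) (t + ?u)"
          using x(1) by (auto simp: divides_def lookup_add lookup_single when_def in_keys_iff)
        thus "\<exists>l<i. divides (us ! l) (t + ?u)" using x divides_trans by blast
      qed
      hence "r \<in> ?C \<longleftrightarrow> r \<in> monom_ideal V {t. \<exists>x\<in>X. x \<in> keys t}" for r
        unfolding C by (auto simp: monom_ideal_def in_poly_ring)
      hence "?C = monom_ideal V {t. \<exists>x\<in>X. x \<in> keys t}" by blast
      moreover have XV: "X \<subseteq> V" by (auto simp: X_def)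
      ultimately have "?C = Idl\<^bsub>?R\<^esub> (var ` X)" by (simp add: genideal_var)
      thus ?P unfolding e1 e2 using XV by blast
    qed
  qed
  note * = this
  have "(\<forall>i. 1 \<le> i \<and> i < length us \<longrightarrow>
      (\<exists>X\<subseteq>V. ideal_colon ?R (Idl\<^bsub>?R\<^esub> (mono ` set (take i us))) (Idl\<^bsub>?R\<^esub> {mono (us ! i)}) =
      (Idl\<^bsub>?R\<^esub> (var ` X)))) \<longleftrightarrow> exponent_quotients us"
    if "minimal_monomial_generators V I (set us)" for us
  proof -
    have us: "\<forall>u\<in>set us. keys u \<subseteq> V" using that by (simp add: minimal_monomial_generators_def)
    show ?thesis unfolding exponent_quotients_def
    proof (intro iffI allI impI, goal_cases)
      case (1 i j)
      hence "1 \<le> i \<and> i < length us" by simp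
      thus ?case using 1 *[OF us, of i] by blast
    next
      case (2 i)
      thus ?case using *[OF us, of i] by blast
    qed
  qed
  thus ?thesis unfolding linear_quotients_def by blast
qed

section \<open>From a shelling of the polarization to an order of the minimal k-covers\<close>

lemma downset_nat_eq:
  assumes "finite D" "\<And>p q. q \<in> D \<Longrightarrow> 1 \<le> p \<Longrightarrow> p \<le> q \<Longrightarrow> p \<in> D" "0 \<notin> D"
  shows "D = {1..card D}"
proof (cases "D = {}")
  case False
  have "D = {1..Max D}"
    using assms Max_in[OF assms(1) False] Max_ge[OF assms(1)]
    by (auto simp: Suc_le_eq) (metis gr0I)
  thus ?thesis by (metis card_atLeastAtMost diff_Suc_1)
qed simp

definition monom_of :: "'v set \<Rightarrow> ('v \<Rightarrow> nat) \<Rightarrow> 'v monom" where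
  "monom_of V f = Abs_poly_mapping (\<lambda>v. if v \<in> V then f v else 0)"

lemma lookup_monom_of: "finite V \<Longrightarrow> lookup (monom_of V f) v = (if v \<in> V then f v else 0)"
  unfolding monom_of_def by (subst lookup_Abs_poly_mapping) (auto intro: finite_subset)

lemma keys_monom_of: "finite V \<Longrightarrow> keys (monom_of V f) \<subseteq> V"
  by (auto simp: in_keys_iff lookup_monom_of split: if_splits)

text \<open>The complement of a facet is a minimal vertex cover of the polarization. Over each
  vertex of \<open>G\<close> it is an initial segment of the copies, and the lengths of these
  segments form the exponent vector \<open>T F\<close> of a minimal k-cover. Dropping one vertex of
  a facet raises one exponent by one, which matches shellings with linear quotients.\<close>

lemma shelled_polarization_imp_linear_quotients:
  assumes G: "simple_graph G" and sh: "shelled (polarization G k)"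
  shows "linear_quotients (verts G) (cover_ideal_sympow G k :: ('v, 'k::field) mpoly set)"
proof -
  let ?P = "polarization G k" and ?V = "verts G"
  note P = simple_polarization[OF G, of k]
  obtain Fs where Fs: "distinct Fs" "set Fs = {F. maximal_indep_set ?P F}"
    "\<And>i j. i<length Fs \<Longrightarrow> j<i \<Longrightarrow> \<exists>y\<in>Fs ! i - Fs ! j. \<exists>l<i. Fs ! i - Fs ! l = {y}"
    using sh unfolding shelled_def by blast
  define D where "D = (\<lambda>(F :: ('v \<times> nat) set) v. {p \<in> {1..k}. (v, p) \<notin> F})"
  define T where "T F = monom_of ?V (\<lambda>v. card (D F v))" for F
  have T: "lookup (T F) v = (if v \<in> ?V then card (D F v) else 0)" for F v
    unfolding T_def using simple_graph_finite[OF G] by (rule lookup_monom_of)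
  have finD: "finite (D F v)" for F v by (simp add: D_def)
  have DT: "(v, p) \<in> F \<longleftrightarrow> v \<in> ?V \<and> p \<le> k \<and> lookup (T F) v < p" if F: "maximal_indep_set ?P F" for F v p
  proof -
    have Fi: "indep_set ?P F" using F by (simp add: maximal_indep_set_def)
    have FV: "v \<in> ?V \<and> 1 \<le> p \<and> p \<le> k" if "(v, p) \<in> F" for v p
      using Fi that by (auto simp: indep_set_def)
    show ?thesis
    proof (cases "v \<in> ?V")
      case True
      \<comment> \<open>Lower copies have more neighbours: whatever keeps \<open>(v, q)\<close> out
        of a facet also keeps out \<open>(v, p)\<close> for \<open>p \<le> q\<close>.\<close>
      have "D F v = {1..card (D F v)}"
      proof (rule downset_nat_eq)
        fix p q assume q: "q \<in> D F v" "1 \<le> p" "p \<le> q"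
        hence "(v, q) \<in> verts ?P" "(v, q) \<notin> F" using True by (auto simp: D_def)
        then obtain w r where "(w, r) \<in> F" "adj ?P (v, q) (w, r)"
          using maximal_indep_setD[OF P F] by fastforce
        hence "(w, r) \<in> F" "adj ?P (v, p) (w, r)" using q by (auto simp: adj_polarization)
        hence "(v, p) \<notin> F" using Fi by (auto simp: indep_set_def)
        thus "p \<in> D F v" using q by (auto simp: D_def)
      qed (auto simp: D_def)
      hence "p \<in> D F v \<longleftrightarrow> 1 \<le> p \<and> p \<le> card (D F v)" by (metis atLeastAtMost_iff)
      thus ?thesis using FV[of v p] True by (auto simp: T D_def Suc_le_eq)
    next
      case False thus ?thesis using FV by blast
    qed
  qed
  have anti: "F = F'" if F: "maximal_indep_set ?P F" "maximal_indep_set ?P F'"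
    and d: "divides (T F) (T F')" for F F'
  proof -
    have "F' \<subseteq> F"
    proof
      fix y assume y: "y \<in> F'"
      obtain v p where "y = (v, p)" by fastforce
      thus "y \<in> F" using y d DT[OF F(1)] DT[OF F(2)] unfolding divides_def
        by (metis le_less_trans)
    qed
    thus ?thesis using F unfolding maximal_indep_set_def by blast
  qed
  have keysT: "keys (T F) \<subseteq> ?V" for F
    unfolding T_def using simple_graph_finite[OF G] by (rule keys_monom_of)
  define us where "us = map T Fs"
  have setus: "set us = T ` {F. maximal_indep_set ?P F}" by (simp add: us_def Fs(2))
  have up: "t \<in> fractional_covers G k \<longleftrightarrow> t \<in> upset (set us)" if t: "keys t \<subseteq> ?V" for t
  proof
    assume tc: "t \<in> fractional_covers G k"
    \<comment> \<open>Over the ends of an edge the levels in \<open>S\<close> sum to at least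
      \<open>k + 2\<close>, as \<open>t\<close> is a cover. So \<open>S\<close> is independent, and
      a facet containing it gives a cover that divides \<open>t\<close>.\<close>
    define S where "S = {(v, p). v \<in> ?V \<and> p \<le> k \<and> lookup t v < p}"
    have "indep_set ?P S"
      unfolding indep_set_def
    proof (intro conjI ballI)
      show "S \<subseteq> verts ?P" by (auto simp: S_def)
      fix a b assume ab: "a \<in> S" "b \<in> S"
      obtain v p w q where e: "a = (v, p)" "b = (w, q)" by fastforce
      have "k \<le> lookup t v + lookup t w" if "adj G v w"
        using tc that by (auto simp: fractional_covers_def)
      thus "\<not> adj ?P a b" using ab by (auto simp: e adj_polarization S_def)
    qed
    then obtain F where F: "maximal_indep_set ?P F" "S \<subseteq> F" using indep_set_extend[OF P] by blast
    have "lookup (T F) v \<le> lookup t v" for v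
    proof (rule ccontr)
      assume n: "\<not> ?thesis"
      hence v: "v \<in> ?V" by (auto simp: T split: if_splits)
      have "card (D F v) \<le> card {1..k}" by (rule card_mono) (auto simp: D_def)
      hence "lookup (T F) v \<le> k" using v by (simp add: T)
      hence "(v, lookup (T F) v) \<in> S" using n v by (simp add: S_def)
      thus False using F DT[OF F(1)] by blast
    qed
    hence "divides (T F) t" by (simp add: divides_def)
    thus "t \<in> upset (set us)" using F setus by (auto simp: upset_def)
  next
    assume "t \<in> upset (set us)"
    then obtain F where F: "maximal_indep_set ?P F" "divides (T F) t" by (auto simp: upset_def setus)
    have "k \<le> lookup t u + lookup t v" if uv: "adj G u v" for u v
    proof (rule ccontr)
      let ?p = "Suc (lookup (T F) u)" and ?q = "Suc (lookup (T F) v)"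
      assume "\<not> ?thesis"
      hence lt: "lookup (T F) u + lookup (T F) v < k"
        using F(2) unfolding divides_def by (metis add_mono_thms_linordered_semiring(1) le_less_trans not_le)
      have "(u, ?p) \<in> F" "(v, ?q) \<in> F" using DT[OF F(1)] lt simple_graphD[OF G uv] by auto
      moreover have "adj ?P (u, ?p) (v, ?q)" using uv lt by (simp add: adj_polarization)
      ultimately show False using F(1) by (auto simp: maximal_indep_set_def indep_set_def)
    qed
    thus "t \<in> fractional_covers G k" by (simp add: fractional_covers_def)
  qed
  have "exponent_quotients us"
    unfolding exponent_quotients_def
  proof (intro allI impI)
    fix i j assume i: "i < length us" and j: "j < i"
    hence i': "i < length Fs" by (simp add: us_def)
    have mx: "maximal_indep_set ?P (Fs ! l)" if "l \<le> i" for l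
      using that i' Fs(2) nth_mem[of l Fs] by auto
    have usT: "us ! l = T (Fs ! l)" if "l \<le> i" for l using that i' by (simp add: us_def)
    obtain y l where yl: "y \<in> Fs ! i - Fs ! j" "l < i" "Fs ! i - Fs ! l = {y}"
      using Fs(3)[OF i' j] by blast
    obtain v p where y: "y = (v, p)" by fastforce
    have "lookup (us ! i) v < lookup (us ! j) v"
      using yl(1) DT[OF mx[of i]] DT[OF mx[of j]] j by (auto simp: y usT)
    moreover have "divides (us ! l) (us ! i + single v 1)"
      unfolding divides_def
    proof
      fix w
      \<comment> \<open>The copies missing from \<open>Fs ! l\<close> are at most those missing from
        \<open>Fs ! i\<close> and the single copy \<open>y\<close>.\<close>
      have "D (Fs ! l) w \<subseteq> D (Fs ! i) w \<union> (if w = v then {p} else {})"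
        using yl(3) by (auto simp: D_def y)
      hence "card (D (Fs ! l) w) \<le> card (D (Fs ! i) w \<union> (if w = v then {p} else {}))"
        by (intro card_mono) (auto simp: finD)
      also have "\<dots> \<le> card (D (Fs ! i) w) + card (if w = v then {p} else {})" by (rule card_Un_le)
      finally show "lookup (us ! l) w \<le> lookup (us ! i + single v 1) w"
        using yl(1,2) DT[OF mx[of i]] by (auto simp: usT T lookup_add lookup_single when_def y split: if_splits)
    qed
    ultimately show "\<exists>x. lookup (us ! i) x < lookup (us ! j) x \<and>
      (\<exists>l<i. divides (us ! l) (us ! i + single x 1))" using yl(2) by blast
  qed
  moreover have "distinct us"
    unfolding us_def distinct_map Fs(2)
    using Fs(1) anti divides_refl by (metis (mono_tags, lifting) inj_onI mem_Collect_eq)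
  moreover have "minimal_monomial_generators ?V (cover_ideal_sympow G k :: ('v, 'k) mpoly set) (set us)"
    unfolding minimal_monomial_generators_iff cover_ideal_sympow_eq[OF G]
    using keysT anti up by (auto simp: setus monom_ideal_def in_poly_ring subset_iff)
  ultimately show ?thesis unfolding linear_quotients_iff by blast
qed

section \<open>Monomials of a fixed degree\<close>

lemma mdeg_eq_sum: "finite V \<Longrightarrow> keys t \<subseteq> V \<Longrightarrow> mdeg t = (\<Sum>v\<in>V. lookup t v)"
  unfolding mdeg_def by (rule sum.mono_neutral_left) (auto simp: in_keys_iff)

lemma mdeg_add: "mdeg (s + t) = mdeg s + mdeg t"
proof -
  let ?V = "keys s \<union> keys t"
  have "mdeg (s + t) = (\<Sum>v\<in>?V. lookup (s + t) v)"
    by (rule mdeg_eq_sum) (auto simp: keys_monom_add)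
  moreover have "mdeg s = (\<Sum>v\<in>?V. lookup s v)" "mdeg t = (\<Sum>v\<in>?V. lookup t v)"
    by (rule mdeg_eq_sum; simp)+
  ultimately show ?thesis by (simp add: lookup_add sum.distrib)
qed

lemma mdeg_single [simp]: "mdeg (single x n) = n"
  by (simp add: mdeg_def)

lemma mdeg_0 [simp]: "mdeg 0 = 0"
  by (simp add: mdeg_def)

lemma mdeg_eq_0: "mdeg t = 0 \<Longrightarrow> t = 0"
  unfolding mdeg_def by (auto simp: in_keys_iff intro!: poly_mapping_eqI)

lemma finite_monoms_of_degree:
  assumes "finite V"
  shows "finite {t. keys t \<subseteq> V \<and> mdeg t = d}"
proof -
  let ?S = "{t. keys t \<subseteq> V \<and> mdeg t = d}"
  have "lookup ` ?S \<subseteq> {f. \<forall>x. (x \<in> V \<longrightarrow> f x \<in> {..d}) \<and> (x \<notin> V \<longrightarrow> f x = 0)}"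
  proof clarsimp
    fix t x assume t: "keys t \<subseteq> V" "d = mdeg t"
    have "lookup t x \<le> mdeg t" if "x \<in> V"
      unfolding mdeg_eq_sum[OF assms t(1)] using assms that by (intro member_le_sum) auto
    thus "(x \<in> V \<longrightarrow> lookup t x \<le> mdeg t) \<and> (x \<notin> V \<longrightarrow> lookup t x = 0)"
      using t by (auto simp: in_keys_iff)
  qed
  hence "finite (lookup ` ?S)"
    by (rule finite_subset) (rule finite_set_of_finite_funs[OF assms finite_atMost])
  thus ?thesis
    by (rule finite_imageD) (meson inj_onI poly_mapping_eq_iff)
qed

text \<open>The weights are powers of \<open>D + 1\<close>, so the weighted sum has the values of
  \<open>f\<close> as its digits. They serve to break ties between monomials of one degree.\<close>

lemma positional_weights:
  assumes "finite V"
  shows "\<exists>c::'v \<Rightarrow> nat. \<forall>f g. (\<forall>v\<in>V. f v \<le> D \<and> g v \<le> D) \<longrightarrow>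
     (\<Sum>v\<in>V. f v * c v) = (\<Sum>v\<in>V. g v * c v) \<longrightarrow> (\<forall>v\<in>V. f v = g v)"
  using assms
proof induction
  case (insert x V)
  then obtain c :: "'v \<Rightarrow> nat" where c: "\<And>f g. (\<forall>v\<in>V. f v \<le> D \<and> g v \<le> D) \<Longrightarrow>
     (\<Sum>v\<in>V. f v * c v) = (\<Sum>v\<in>V. g v * c v) \<Longrightarrow> (\<forall>v\<in>V. f v = g v)" by blast
  define c' where "c' v = (if v = x then 1 else (D + 1) * c v)" for v
  have s: "(\<Sum>v\<in>insert x V. f v * c' v) = (D + 1) * (\<Sum>v\<in>V. f v * c v) + f x" for f
  proof -
    have "(\<Sum>v\<in>V. f v * c' v) = (D + 1) * (\<Sum>v\<in>V. f v * c v)"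
      unfolding sum_distrib_left using insert.hyps by (intro sum.cong) (auto simp: c'_def algebra_simps)
    thus ?thesis using insert.hyps by (simp add: c'_def)
  qed
  have "\<forall>v\<in>insert x V. f v = g v"
    if "\<forall>v\<in>insert x V. f v \<le> D \<and> g v \<le> D"
      "(\<Sum>v\<in>insert x V. f v * c' v) = (\<Sum>v\<in>insert x V. g v * c' v)" for f g
  proof -
    have e: "(D + 1) * (\<Sum>v\<in>V. f v * c v) + f x = (D + 1) * (\<Sum>v\<in>V. g v * c v) + g x"
      using that(2) unfolding s .
    have "((D + 1) * (\<Sum>v\<in>V. f v * c v) + f x) mod (D + 1) = f x"
      "((D + 1) * (\<Sum>v\<in>V. g v * c v) + g x) mod (D + 1) = g x"
      using that(1) unfolding mod_mult_self4 by simp_all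
    hence fg: "f x = g x" using e by metis
    hence "(D + 1) * (\<Sum>v\<in>V. f v * c v) = (D + 1) * (\<Sum>v\<in>V. g v * c v)" using e by linarith
    hence "(\<Sum>v\<in>V. f v * c v) = (\<Sum>v\<in>V. g v * c v)" by (simp only: mult_cancel1) simp
    thus ?thesis using c[of f g] that(1) fg by blast
  qed
  thus ?case by blast
qed simp

text \<open>Otherwise no coordinate growing from \<open>f\<close> to \<open>g\<close> weighs more
  than a shrinking one. With \<open>C\<close> the largest weight of a growing coordinate,
  \<open>(g v - f v) * (c v - C)\<close> is never positive; but since \<open>f\<close> and
  \<open>g\<close> have equal sums, these products add up to the weight difference, which is
  positive.\<close>

lemma weighted_exchange:
  fixes f g c :: "'v \<Rightarrow> nat"
  assumes V: "finite V" and eq: "sum f V = sum g V"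
    and lt: "(\<Sum>v\<in>V. f v * c v) < (\<Sum>v\<in>V. g v * c v)"
  shows "\<exists>y\<in>V. \<exists>z\<in>V. f y < g y \<and> g z < f z \<and> c z < c y"
proof (rule ccontr)
  assume "\<not> ?thesis"
  hence le: "c y \<le> c z" if "y \<in> V" "z \<in> V" "f y < g y" "g z < f z" for y z
    using that not_less by blast
  define P where "P = {y \<in> V. f y < g y}"
  have "P \<noteq> {}"
  proof
    assume "P = {}"
    hence "(\<Sum>v\<in>V. g v * c v) \<le> (\<Sum>v\<in>V. f v * c v)"
      by (intro sum_mono mult_right_mono) (auto simp: P_def not_less)
    thus False using lt by simp
  qed
  define C where "C = Max (c ` P)"
  have fP: "finite P" using V by (simp add: P_def)
  have C1: "c y \<le> C" if "y \<in> P" for y using fP that by (simp add: C_def)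
  obtain y0 where y0: "y0 \<in> P" "C = c y0"
    using Max_in[of "c ` P"] fP \<open>P \<noteq> {}\<close> unfolding C_def by blast
  have C2: "C \<le> c z" if "z \<in> V" "g z < f z" for z
    using le[of y0 z] y0 that by (simp add: P_def)
  have "(\<Sum>v\<in>V. (int (g v) - int (f v)) * (int (c v) - int C)) \<le> 0"
  proof (rule sum_nonpos)
    fix v assume v: "v \<in> V"
    consider "f v < g v" | "g v < f v" | "f v = g v" by linarith
    thus "(int (g v) - int (f v)) * (int (c v) - int C) \<le> 0"
    proof cases
      case 1
      hence "c v \<le> C" using C1 v by (simp add: P_def)
      thus ?thesis using 1 by (intro mult_nonneg_nonpos) auto
    next
      case 2
      hence "C \<le> c v" using C2 v by simp
      thus ?thesis using 2 by (intro mult_nonpos_nonneg) auto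
    qed simp
  qed
  moreover have "(\<Sum>v\<in>V. (int (g v) - int (f v)) * (int (c v) - int C)) =
    (int (\<Sum>v\<in>V. g v * c v) - int (\<Sum>v\<in>V. f v * c v)) - (int (sum g V) - int (sum f V)) * int C"
    by (simp add: algebra_simps sum_subtractf sum.distrib sum_distrib_left)
  moreover have "int (\<Sum>v\<in>V. f v * c v) < int (\<Sum>v\<in>V. g v * c v)" using lt by linarith
  ultimately show False unfolding eq diff_self mult_zero_left by linarith
qed

lemma finite_list_by_key:
  fixes key :: "'a \<Rightarrow> nat"
  assumes "finite W" "inj_on key W"
  shows "\<exists>ws. set ws = W \<and> distinct ws \<and> (\<forall>a b. a < b \<longrightarrow> b < length ws \<longrightarrow> key (ws ! a) < key (ws ! b))"
proof -
  let ?ks = "sorted_list_of_set (key ` W)"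
  define ws where "ws = map (inv_into W key) ?ks"
  have ks: "set ?ks = key ` W" using assms(1) by simp
  have k: "key (inv_into W key k) = k" if "k \<in> set ?ks" for k
    using that ks by (metis f_inv_into_f)
  have "set ws = W" using assms(2) by (auto simp: ws_def ks inv_into_f_f)
  moreover have "distinct ws"
    unfolding ws_def distinct_map using k by (metis distinct_sorted_list_of_set inj_on_inverseI)
  moreover have "key (ws ! a) < key (ws ! b)" if "a < b" "b < length ws" for a b
  proof -
    have "key (ws ! a) = ?ks ! a" "key (ws ! b) = ?ks ! b"
      using that k[OF nth_mem[of a ?ks]] k[OF nth_mem[of b ?ks]] by (simp_all add: ws_def)
    thus ?thesis
      using that sorted_wrt_nth_less[OF strict_sorted_list_of_set, of a b "key ` W"] by (simp add: ws_def)
  qed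
  ultimately show ?thesis by blast
qed

text \<open>The counterpart of \<open>exponent_quotients\<close> for monomials of one degree: there
  a monomial divides another one times a variable \<open>x\<close> only if the quotient is again a
  variable \<open>z\<close>.\<close>

definition linear_steps :: "'v set \<Rightarrow> 'v monom list \<Rightarrow> bool" where
  "linear_steps V ws \<longleftrightarrow> (\<forall>b<length ws. \<forall>a<b. \<exists>x. lookup (ws ! b) x < lookup (ws ! a) x \<and>
     (\<exists>l<b. \<exists>z\<in>V. ws ! l + single z 1 = ws ! b + single x 1))"

text \<open>Monomials are ordered by the first generator dividing them and then by a generic weight.\<close>

lemma degree_component_order:
  fixes d :: nat
  assumes V: "finite V" and us: "distinct us" "\<forall>u\<in>set us. keys u \<subseteq> V"
    "\<forall>u\<in>set us. \<forall>w\<in>set us. divides u w \<longrightarrow> u = w" "exponent_quotients us"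
  defines "W \<equiv> {w. keys w \<subseteq> V \<and> mdeg w = d \<and> w \<in> upset (set us)}"
  shows "\<exists>ws. set ws = W \<and> distinct ws \<and> linear_steps V ws"
proof -
  obtain c :: "'a \<Rightarrow> nat" where c: "\<And>f g. (\<forall>v\<in>V. f v \<le> d \<and> g v \<le> d) \<Longrightarrow>
     (\<Sum>v\<in>V. f v * c v) = (\<Sum>v\<in>V. g v * c v) \<Longrightarrow> (\<forall>v\<in>V. f v = g v)"
    using positional_weights[OF V] by blast
  define \<rho> where "\<rho> w = (\<Sum>v\<in>V. lookup w v * c v)" for w
  define M where "M = (\<Sum>v\<in>V. d * c v)"
  define ix where "ix w = (LEAST i. i < length us \<and> divides (us ! i) w)" for w
  \<comment> \<open>A lexicographic order in one number: a smaller index comes first and, for equal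
    index, a larger weight. The weights stay below \<open>M + 1\<close>, so the two parts do not
    interfere.\<close>
  define key where "key w = ix w * (M + 1) + (M - \<rho> w)" for w
  have finW: "finite W"
    by (rule finite_subset[OF _ finite_monoms_of_degree[OF V, of d]]) (auto simp: W_def)
  have Wd: "lookup w v \<le> d" if "w \<in> W" "v \<in> V" for w v
  proof -
    have "lookup w v \<le> (\<Sum>v\<in>V. lookup w v)" using V that by (intro member_le_sum) auto
    thus ?thesis using that mdeg_eq_sum[OF V, of w] by (simp add: W_def)
  qed
  have \<rho>M: "\<rho> w \<le> M" if "w \<in> W" for w
    unfolding \<rho>_def M_def using Wd[OF that] by (intro sum_mono mult_right_mono) auto
  have ixP: "ix w < length us \<and> divides (us ! ix w) w" if w: "w \<in> W" for w
  proof -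
    obtain u where "u \<in> set us" "divides u w" using w by (auto simp: W_def upset_def)
    then obtain i where "i < length us \<and> divides (us ! i) w" by (metis in_set_conv_nth)
    thus ?thesis unfolding ix_def by (rule LeastI)
  qed
  have ix_le: "ix w \<le> i" if "i < length us" "divides (us ! i) w" for w i
    unfolding ix_def using that by (intro Least_le) simp
  have key_ix: "ix w \<le> ix w'" if "key w \<le> key w'" "w \<in> W" "w' \<in> W" for w w'
  proof (rule ccontr)
    assume "\<not> ?thesis"
    hence "(ix w' + 1) * (M + 1) \<le> ix w * (M + 1)" by (intro mult_right_mono) auto
    thus False using that(1) unfolding key_def by (simp add: algebra_simps)
  qed
  have key_lt: "key w < key w'" if "ix w < ix w'" "w \<in> W" "w' \<in> W" for w w'
    using key_ix[of w' w] that by linarith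
  have key_lt': "key w < key w'" if "ix w = ix w'" "\<rho> w' < \<rho> w" "w \<in> W" for w w'
    using that \<rho>M[of w] by (simp add: key_def)
  have "inj_on key W"
  proof (rule inj_onI)
    fix w w' assume w: "w \<in> W" "w' \<in> W" "key w = key w'"
    have "ix w = ix w'" using key_ix[of w w'] key_ix[of w' w] w by simp
    hence "\<rho> w = \<rho> w'" using key_lt'[of w w'] key_lt'[of w' w] w by (metis less_irrefl linorder_neqE_nat)
    hence "\<forall>v\<in>V. lookup w v = lookup w' v" using c Wd w unfolding \<rho>_def by blast
    moreover have "lookup w v = lookup w' v" if "v \<notin> V" for v
    proof -
      have "v \<notin> keys w" "v \<notin> keys w'" using that w by (auto simp: W_def)
      thus ?thesis by (simp add: in_keys_iff)
    qed
    ultimately show "w = w'" by (intro poly_mapping_eqI) blast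
  qed
  then obtain ws where ws: "set ws = W" "distinct ws"
    "\<And>a b. a < b \<Longrightarrow> b < length ws \<Longrightarrow> key (ws ! a) < key (ws ! b)"
    using finite_list_by_key[OF finW] by blast
  have move: "\<exists>x. lookup w x < lookup w'' x \<and> (\<exists>w'\<in>W. key w' < key w \<and>
      (\<exists>z\<in>V. w' + single z 1 = w + single x 1))"
    if w: "w'' \<in> W" "w \<in> W" "key w'' < key w" for w'' w
  proof -
    let ?i = "ix w"
    have wV: "keys w \<subseteq> V" "mdeg w = d" "keys w'' \<subseteq> V" "mdeg w'' = d" using w by (auto simp: W_def)
    have i: "?i < length us" "divides (us ! ?i) w" using ixP w by auto
    have repl: "\<exists>w'. w' + single z 1 = w + single x 1 \<and>
        keys w' \<subseteq> V \<and> mdeg w' = d" if "z \<in> keys w" "x \<in> V" for x z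
    proof -
      let ?t = "w + single x 1"
      have "divides (single z 1) ?t"
        unfolding divides_single using that by (simp add: keys_monom_add)
      hence e: "?t = single z 1 + (?t - single z 1)" by (rule divides_eq)
      hence "mdeg ?t = mdeg (single z (1::nat)) + mdeg (?t - single z 1)"
        by (metis mdeg_add)
      moreover have "keys (?t - single z 1) \<subseteq> V"
        using keys_minus_monom[of ?t] wV that by (fastforce simp: keys_monom_add)
      ultimately show ?thesis
        using e wV by (intro exI[of _ "?t - single z 1"]) (simp add: mdeg_add add.commute)
    qed
    have "ix w'' \<le> ?i" using key_ix[of w'' w] w by simp
    then consider "ix w'' < ?i" | "ix w'' = ?i" by linarith
    thus ?thesis
    proof cases
      case 1
      let ?j = "ix w''"
      obtain x l where x: "lookup (us ! ?i) x < lookup (us ! ?j) x" "l < ?i"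
        "divides (us ! l) (us ! ?i + single x 1)"
        using us(4) i 1 unfolding exponent_quotients_def by blast
      have nl: "\<not> divides (us ! l) w" using ix_le[of l w] x(2) i(1) by linarith
      \<comment> \<open>If \<open>w\<close> had a larger exponent at \<open>x\<close>, then
        \<open>us ! l\<close> would divide \<open>w\<close>, against the minimality of the
        index.\<close>
      have wx: "lookup w x = lookup (us ! ?i) x"
      proof (rule ccontr)
        assume "\<not> ?thesis"
        hence "divides (us ! ?i + single x 1) w"
          using i(2) by (auto simp: divides_def lookup_add lookup_single when_def)
            (metis Suc_leI le_neq_implies_less)
        thus False using x(3) nl divides_trans by blast
      qed
      have w''x: "lookup (us ! ?j) x \<le> lookup w'' x" using ixP[OF w(1)] by (simp add: divides_def)
      hence lt: "lookup w x < lookup w'' x" using x wx by simp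
      hence xV: "x \<in> V" using wV by (auto simp: in_keys_iff subset_iff)
      let ?t = "w + single x 1"
      have lt': "divides (us ! l) ?t"
        using x(3) i(2) unfolding divides_def lookup_add by (meson add_le_mono1 le_trans)
      \<comment> \<open>The divisor has to be proper, so that some \<open>z\<close> can be cancelled
        from \<open>?t\<close> with \<open>us ! l\<close> still dividing the quotient, which thereby
        gets a smaller index.\<close>
      have "us ! l \<noteq> ?t"
      proof
        assume "us ! l = ?t"
        hence "divides (us ! ?i) (us ! l)" using i(2) divides_add divides_trans by metis
        hence "us ! ?i = us ! l" using us(3) i x(2) by auto
        thus False using us(1) i x(2) by (simp add: nth_eq_iff_index_eq)
      qed
      then obtain z where z: "lookup (us ! l) z < lookup ?t z"
        using lt' divides_antisym unfolding divides_def by (metis le_neq_implies_less poly_mapping_eqI)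
      have "z \<noteq> x"
      proof
        assume zx: "z = x"
        have "lookup (us ! l) y \<le> lookup w y" for y
          using lt' z zx by (cases "y = x") (auto simp: divides_def lookup_add lookup_single when_def dest: spec[of _ y])
        thus False using nl by (simp add: divides_def)
      qed
      hence zw: "z \<in> keys w" using z by (simp add: in_keys_iff lookup_add lookup_single)
      obtain w' where w': "w' + single z 1 = ?t" "keys w' \<subseteq> V" "mdeg w' = d"
        using repl[OF zw xV] by blast
      have "divides (us ! l) w'"
        unfolding divides_def
      proof
        fix y
        have "lookup w' y + lookup (single z (1::nat)) y = lookup ?t y"
          by (metis w'(1) lookup_add)
        moreover have "lookup (us ! l) y \<le> lookup ?t y" using lt' by (simp add: divides_def)
        ultimately show "lookup (us ! l) y \<le> lookup w' y"
          using z by (cases "y = z") (auto simp: lookup_single)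
      qed
      hence "w' \<in> W" "ix w' \<le> l" using w' ix_le[of l w'] x(2) i(1)
        by (auto simp: W_def upset_def)
      hence "key w' < key w" using key_lt[of w' w] w(2) x(2) by simp
      thus ?thesis using lt w'(1) \<open>w' \<in> W\<close> zw wV(1) by blast
    next
      case 2
      \<comment> \<open>An exchange towards \<open>w''\<close> that raises the weight keeps
        divisibility by \<open>us ! ?i\<close>, because the exponent lowered at \<open>z\<close>
        does not fall below that of \<open>w''\<close>.\<close>
      hence "\<rho> w < \<rho> w''" using w by (simp add: key_def)
      moreover have "sum (lookup w) V = sum (lookup w'') V"
        using wV mdeg_eq_sum[OF V] by metis
      ultimately obtain y z where yz: "y \<in> V" "z \<in> V" "lookup w y < lookup w'' y"
        "lookup w'' z < lookup w z" "c z < c y"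
        using weighted_exchange[OF V, of "lookup w" "lookup w''" c] unfolding \<rho>_def by blast
      have zw: "z \<in> keys w" using yz by (simp add: in_keys_iff)
      obtain w' where w': "w' + single z 1 = w + single y 1"
        "keys w' \<subseteq> V" "mdeg w' = d" using repl[OF zw yz(1)] by blast
      have lw': "lookup w' v + lookup (single z (1::nat)) v =
        lookup w v + lookup (single y 1) v" for v
        using w'(1) by (metis lookup_add)
      have "divides (us ! ?i) w'"
        unfolding divides_def
      proof
        fix v
        have "lookup (us ! ?i) v \<le> lookup w v" "lookup (us ! ?i) v \<le> lookup w'' v"
          using i(2) ixP[OF w(1)] 2 by (auto simp: divides_def)
        thus "lookup (us ! ?i) v \<le> lookup w' v"
          using lw'[of v] yz by (cases "v = z") (auto simp: lookup_single when_def split: if_splits)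
      qed
      hence w'W: "w' \<in> W" "ix w' \<le> ?i" using w' ix_le[of ?i w'] i(1)
        by (auto simp: W_def upset_def)
      have "\<rho> w' + c z = \<rho> w + c y"
      proof -
        have "(\<Sum>v\<in>V. (lookup w' v + lookup (single z (1::nat)) v) * c v) =
          (\<Sum>v\<in>V. (lookup w v + lookup (single y 1) v) * c v)" using lw' by simp
        moreover have "(\<Sum>v\<in>V. lookup (single y (1::nat)) v * c v) = c y" if "y \<in> V" for y
        proof -
          have "(\<Sum>v\<in>V. lookup (single y (1::nat)) v * c v) = (\<Sum>v\<in>V. if v = y then c v else 0)"
            by (rule sum.cong) (auto simp: lookup_single when_def)
          thus ?thesis using V that by simp
        qed
        ultimately show ?thesis using yz by (simp add: \<rho>_def add_mult_distrib sum.distrib)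
      qed
      hence "\<rho> w < \<rho> w'" using yz by simp
      hence "key w' < key w"
        using key_lt'[of w' w] key_lt[of w' w] w'W w(2) by (metis le_neq_implies_less)
      thus ?thesis using yz w'(1) w'W(1) by blast
    qed
  qed
  have "\<exists>x. lookup (ws ! b) x < lookup (ws ! a) x \<and>
     (\<exists>l<b. \<exists>z\<in>V. ws ! l + single z 1 = ws ! b + single x 1)"
    if b: "b < length ws" and a: "a < b" for a b
  proof -
    have "ws ! a \<in> W" "ws ! b \<in> W" using a b ws(1) by auto
    then obtain x w' z where x: "lookup (ws ! b) x < lookup (ws ! a) x" "w' \<in> W" "key w' < key (ws ! b)"
      "z \<in> V" "w' + single z 1 = ws ! b + single x 1"
      using move ws(3)[OF a b] by blast
    obtain l where l: "l < length ws" "w' = ws ! l" using x(2) ws(1) by (metis in_set_conv_nth)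
    have "l < b" using x(3) l ws(3)[of b l] by (metis less_asym' linorder_neqE_nat)
    thus ?thesis using x l by blast
  qed
  thus ?thesis using ws unfolding linear_steps_def by blast
qed

section \<open>Linear resolutions from linear quotients\<close>

text \<open>Elements of free modules are represented as finitely supported functions from \<open>nat\<close>. The
  predicate says that each vector of the list has, modulo its predecessors, an annihilator
  generated by variables. This property is inherited by a suitable generating list of the
  syzygies, which are linear, so iterating gives a linear resolution.\<close>

inductive module_quotients :: "'v set \<Rightarrow> nat \<Rightarrow> (nat \<Rightarrow> ('v, 'k::field) mpoly) list \<Rightarrow> bool"
  for V :: "'v set" and e :: nat where
  Nil: "module_quotients V e []"
| Snoc: "\<lbrakk>module_quotients V e gs;
    \<And>p. g p \<in> carrier (poly_ring V) \<and> homogeneous e (g p);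
    X \<subseteq> V; finite X;
    \<And>x. x \<in> X \<Longrightarrow> \<exists>c. (\<forall>l. c l \<in> carrier (poly_ring V)) \<and>
      (\<forall>p. var x * g p = (\<Sum>l<length gs. c l * (gs ! l) p));
    \<And>f c. f \<in> carrier (poly_ring V) \<Longrightarrow> (\<forall>l. c l \<in> carrier (poly_ring V)) \<Longrightarrow>
      (\<forall>p. f * g p = (\<Sum>l<length gs. c l * (gs ! l) p)) \<Longrightarrow> (\<forall>t\<in>keys f. keys t \<inter> X \<noteq> {})\<rbrakk>
   \<Longrightarrow> module_quotients V e (gs @ [g])"

section \<open>Homogeneous components and linear syzygies\<close>

definition hom_part :: "nat \<Rightarrow> ('v, 'k::field) mpoly \<Rightarrow> ('v, 'k) mpoly" where
  "hom_part d p = (\<Sum>t\<in>{t\<in>keys p. mdeg t = d}. single t (lookup p t))"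

lemma lookup_hom_part: "lookup (hom_part d p) t = (if mdeg t = d then lookup p t else 0)"
proof -
  have "lookup (hom_part d p) t = (\<Sum>s\<in>{s\<in>keys p. mdeg s = d}. if s = t then lookup p s else 0)"
    unfolding hom_part_def lookup_sum by (rule sum.cong) (auto simp: lookup_single when_def)
  thus ?thesis by (auto simp: in_keys_iff)
qed

lemma keys_hom_part: "keys (hom_part d p) = {t \<in> keys p. mdeg t = d}"
  by (auto simp: in_keys_iff lookup_hom_part split: if_splits)

lemma hom_part_closed:
  "p \<in> carrier (poly_ring V) \<Longrightarrow> hom_part d p \<in> carrier (poly_ring V)"
  "homogeneous d (hom_part d p)"
  by (auto simp: in_poly_ring keys_hom_part homogeneous_def)

lemma hom_part_sum: "hom_part d (sum f A) = (\<Sum>a\<in>A. hom_part d (f a))"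
  by (rule poly_mapping_eqI) (simp add: lookup_hom_part lookup_sum)

lemma hom_part_homogeneous: "homogeneous d p \<Longrightarrow> hom_part d p = p"
  by (rule poly_mapping_eqI) (auto simp: lookup_hom_part homogeneous_def in_keys_iff)

lemma hom_part_mult:
  assumes q: "homogeneous e q"
  shows "hom_part (d + e) (p * q) = hom_part d p * q"
proof (rule poly_mapping_eqI)
  fix t
  define r where "r = p - hom_part d p"
  have pr: "p * q = hom_part d p * q + r * q" by (simp add: r_def algebra_simps)
  have r: "mdeg s \<noteq> d" if "s \<in> keys r" for s
    using that by (auto simp: r_def in_keys_iff lookup_minus lookup_hom_part)
  have h: "mdeg t = d + e" if "t \<in> keys (hom_part d p * q)"
    using keys_times[OF that] q by (auto simp: keys_hom_part homogeneous_def mdeg_add)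
  have h': "mdeg t \<noteq> d + e" if "t \<in> keys (r * q)"
    using keys_times[OF that] q r by (auto simp: homogeneous_def mdeg_add)
  show "lookup (hom_part (d + e) (p * q)) t = lookup (hom_part d p * q) t"
    using h h' unfolding lookup_hom_part pr lookup_add by (auto simp: in_keys_iff)
qed

lemma homogeneous_var: "homogeneous 1 (var x)"
  by (simp add: homogeneous_def var_def mono_def)

lemma homogeneous_mult: "homogeneous d p \<Longrightarrow> homogeneous e q \<Longrightarrow> homogeneous (d + e) (p * q)"
  unfolding homogeneous_def using keys_times mdeg_add by metis

lemma homogeneous_uminus: "homogeneous d p \<Longrightarrow> homogeneous d (- p)"
  by (simp add: homogeneous_def)

lemma module_quotients_homogeneous:
  "module_quotients V e gs \<Longrightarrow> g \<in> set gs \<Longrightarrow> g p \<in> carrier (poly_ring V) \<and> homogeneous e (g p)"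
  by (induction rule: module_quotients.induct) auto

lemma sum_append:
  "(\<Sum>j<length (xs @ ys). c j * ((xs @ ys) ! j) p) =
   (\<Sum>j<length xs. c j * (xs ! j) p) + (\<Sum>i<length ys. c (length xs + i) * (ys ! i) (p :: nat))"
  for c :: "nat \<Rightarrow> 'r::comm_ring_1"
proof -
  have "(\<Sum>j<length (xs @ ys). c j * ((xs @ ys) ! j) p) =
    (\<Sum>j<length xs. c j * ((xs @ ys) ! j) p) + (\<Sum>j=length xs..<length xs + length ys. c j * ((xs @ ys) ! j) p)"
    by (simp add: lessThan_atLeast0 sum.atLeastLessThan_concat)
  also have "(\<Sum>j=length xs..<length xs + length ys. c j * ((xs @ ys) ! j) p) =
      (\<Sum>i<length ys. c (length xs + i) * (ys ! i) p)"
    using sum.shift_bounds_nat_ivl[of "\<lambda>j. c j * ((xs @ ys) ! j) p" 0 "length xs" "length ys"]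
    by (simp add: lessThan_atLeast0 add.commute[of "length xs"] nth_append)
  finally show ?thesis by (simp add: nth_append)
qed

lemma var_combination:
  fixes f :: "('v, 'k::field) mpoly"
  assumes f: "f \<in> carrier (poly_ring V)" and X: "\<forall>t\<in>keys f. keys t \<inter> set xs \<noteq> {}"
  shows "\<exists>h. (\<forall>i. h i \<in> carrier (poly_ring V)) \<and> f = (\<Sum>i<length xs. h i * var (xs ! i))"
proof -
  have "\<exists>i<length xs. xs ! i \<in> keys t" if "t \<in> keys f" for t
    using X that by (metis disjoint_iff in_set_conv_nth)
  then obtain \<iota> where \<iota>: "\<And>t. t \<in> keys f \<Longrightarrow> \<iota> t < length xs \<and> xs ! \<iota> t \<in> keys t" by metis
  define h where "h i = (\<Sum>t\<in>{t\<in>keys f. \<iota> t = i}.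
    single (t - single (xs ! i) 1) (lookup f t))" for i
  have "h i \<in> carrier (poly_ring V)" for i
    unfolding h_def
  proof (rule poly_ring_sum)
    fix t assume "t \<in> {t\<in>keys f. \<iota> t = i}"
    hence "keys t \<subseteq> V" using f by (simp add: in_poly_ring)
    thus "single (t - single (xs ! i) 1) (lookup f t) \<in> carrier (poly_ring V)"
      using keys_minus_monom[of t "single (xs ! i) 1"] by (auto simp: in_poly_ring)
  qed
  moreover have "f = (\<Sum>i<length xs. h i * var (xs ! i))"
  proof -
    have "(\<Sum>i<length xs. h i * var (xs ! i)) =
      (\<Sum>i<length xs. \<Sum>t\<in>{t\<in>keys f. \<iota> t = i}. single t (lookup f t))"
    proof (rule sum.cong[OF refl])
      fix i
      show "h i * var (xs ! i) = (\<Sum>t\<in>{t\<in>keys f. \<iota> t = i}. single t (lookup f t))"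
        unfolding h_def sum_distrib_right
      proof (rule sum.cong[OF refl])
        fix t assume t: "t \<in> {t\<in>keys f. \<iota> t = i}"
        hence "divides (single (xs ! i) 1) t" unfolding divides_single using \<iota> by auto
        hence "t - single (xs ! i) 1 + single (xs ! i) 1 = t"
          using divides_eq by (metis add.commute)
        thus "single (t - single (xs ! i) 1) (lookup f t) * var (xs ! i) =
            single t (lookup f t)"
          by (simp add: var_def mono_def mult_single)
      qed
    qed
    also have "\<dots> = (\<Sum>t\<in>keys f. single t (lookup f t))"
      using \<iota> by (intro sum.group) auto
    finally show ?thesis by (simp add: poly_as_sum[symmetric])
  qed
  ultimately show ?thesis by blast
qed

text \<open>To the syzygies of \<open>gs\<close>, padded by zero, add for each \<open>x\<close> in
  \<open>X\<close> the syzygy \<open>S x\<close> that expresses \<open>x\<close> times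
  \<open>g\<close> through \<open>gs\<close>. Modulo its predecessors, \<open>S x\<close> has an
  annihilator generated by the earlier variables: they annihilate it by Koszul relations, and the
  coordinate of \<open>g\<close> shows that there is nothing else.\<close>

lemma syzygies_module_quotients:
  fixes gs :: "(nat \<Rightarrow> ('v, 'k::field) mpoly) list"
  assumes "module_quotients V e gs"
  shows "\<exists>ss :: (nat \<Rightarrow> ('v, 'k) mpoly) list. module_quotients V 1 ss \<and>
    (\<forall>s\<in>set ss. \<forall>l\<ge>length gs. s l = 0) \<and>
    (\<forall>s\<in>set ss. \<forall>p. (\<Sum>l<length gs. s l * (gs ! l) p) = 0) \<and>
    (\<forall>v. (\<forall>l. v l \<in> carrier (poly_ring V)) \<longrightarrow> (\<forall>p. (\<Sum>l<length gs. v l * (gs ! l) p) = 0) \<longrightarrow>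
      (\<exists>c. (\<forall>j. c j \<in> carrier (poly_ring V)) \<and> (\<forall>l<length gs. v l = (\<Sum>j<length ss. c j * (ss ! j) l))))"
  using assms
proof induction
  case Nil
  show ?case by (rule exI[of _ "[]"]) (auto intro: module_quotients.Nil exI[of _ "\<lambda>_. 0"])
next
  case (Snoc gs g X)
  let ?R = "carrier (poly_ring V) :: ('v, 'k) mpoly set"
  define N where "N = length gs"
  obtain ss :: "(nat \<Rightarrow> ('v, 'k) mpoly) list" where ss0: "module_quotients V 1 ss \<and>
    (\<forall>s\<in>set ss. \<forall>l\<ge>N. s l = 0) \<and>
    (\<forall>s\<in>set ss. \<forall>p. (\<Sum>l<N. s l * (gs ! l) p) = 0) \<and>
    (\<forall>v. (\<forall>l. v l \<in> ?R) \<longrightarrow> (\<forall>p. (\<Sum>l<N. v l * (gs ! l) p) = 0) \<longrightarrow>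
      (\<exists>c. (\<forall>j. c j \<in> ?R) \<and> (\<forall>l<N. v l = (\<Sum>j<length ss. c j * (ss ! j) l))))"
    using Snoc.IH unfolding N_def by (rule exE)
  hence ss: "module_quotients V 1 ss"
    "\<And>s l. s \<in> set ss \<Longrightarrow> N \<le> l \<Longrightarrow> s l = 0"
    "\<And>s p. s \<in> set ss \<Longrightarrow> (\<Sum>l<N. s l * (gs ! l) p) = 0"
    "\<And>v. (\<forall>l. v l \<in> ?R) \<Longrightarrow> (\<forall>p. (\<Sum>l<N. v l * (gs ! l) p) = 0) \<Longrightarrow>
      \<exists>c. (\<forall>j. c j \<in> ?R) \<and> (\<forall>l<N. v l = (\<Sum>j<length ss. c j * (ss ! j) l))"
    by simp_all
  have gsh: "homogeneous e ((gs ! l) p)" if "l < N" for l p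
    using module_quotients_homogeneous[OF Snoc.hyps(1), of "gs ! l" p] that by (simp add: N_def)
  have "\<exists>c. (\<forall>l. c l \<in> ?R \<and> homogeneous 1 (c l)) \<and> (\<forall>p. var x * g p = (\<Sum>l<N. c l * (gs ! l) p))"
    if x: "x \<in> X" for x
  proof -
    obtain c where c: "\<forall>l. c l \<in> ?R" "\<And>p. var x * g p = (\<Sum>l<N. c l * (gs ! l) p)"
      using Snoc.hyps(5)[OF x] unfolding N_def by blast
    \<comment> \<open>All vectors have degree \<open>e\<close>, so the coefficients may be replaced
      by their linear parts.\<close>
    have "var x * g p = (\<Sum>l<N. hom_part 1 (c l) * (gs ! l) p)" for p
    proof -
      have "homogeneous (1 + e) (var x * g p)"
        by (rule homogeneous_mult[OF homogeneous_var]) (simp add: Snoc.hyps(2))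
      hence "var x * g p = hom_part (1 + e) (\<Sum>l<N. c l * (gs ! l) p)"
        using hom_part_homogeneous c(2) by metis
      also have "\<dots> = (\<Sum>l<N. hom_part 1 (c l) * (gs ! l) p)"
        unfolding hom_part_sum using gsh by (intro sum.cong hom_part_mult) auto
      finally show ?thesis .
    qed
    thus ?thesis using hom_part_closed c(1) by (intro exI[of _ "\<lambda>l. hom_part 1 (c l)"]) blast
  qed
  hence "\<forall>x\<in>X. \<exists>c. (\<forall>l. c l \<in> ?R \<and> homogeneous 1 (c l)) \<and>
    (\<forall>p. var x * g p = (\<Sum>l<N. c l * (gs ! l) p))" by blast
  from bchoice[OF this] obtain C where C0: "\<forall>x\<in>X. (\<forall>l. C x l \<in> ?R \<and> homogeneous 1 (C x l)) \<and>
    (\<forall>p. var x * g p = (\<Sum>l<N. C x l * (gs ! l) p))" by blast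
  hence C: "\<And>x l. x \<in> X \<Longrightarrow> C x l \<in> ?R" "\<And>x l. x \<in> X \<Longrightarrow> homogeneous 1 (C x l)"
    "\<And>x p. x \<in> X \<Longrightarrow> var x * g p = (\<Sum>l<N. C x l * (gs ! l) p)" by simp_all
  define S where "S x l = (if l < N then - C x l else if l = N then var x else 0)" for x l
  have SN: "S x N = var x" for x by (simp add: S_def)
  have SR: "S x l \<in> ?R" "homogeneous 1 (S x l)" if "x \<in> X" for x l
    using that C(1,2) Snoc.hyps(3) homogeneous_var[of x]
    by (auto simp: S_def var_in_poly_ring poly_ring_uminus homogeneous_uminus) (simp add: homogeneous_def)
  have Sker: "(\<Sum>l<N. S x l * (gs ! l) p) + S x N * g p = 0" if "x \<in> X" for x p
    using C(3)[OF that, of p] by (simp add: S_def sum_negf)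
  obtain xs where xs: "set xs = X" "distinct xs" using finite_distinct_list[OF Snoc.hyps(4)] by blast
  have mq: "module_quotients V 1 (ss @ map S (take k xs))" if "k \<le> length xs" for k
    using that
  proof (induction k)
    case 0 thus ?case using ss(1) by simp
  next
    case (Suc k)
    let ?x = "xs ! k" and ?ys = "take k xs"
    let ?zs = "map S ?ys"
    have x: "?x \<in> X" using Suc.prems xs(1) nth_mem[of k xs] by auto
    have len: "length ?zs = k" using Suc.prems by simp
    have x_notin: "?x \<notin> set ?ys"
      using xs(2) Suc.prems by (auto simp: in_set_conv_nth nth_eq_iff_index_eq)
    have sN: "(\<Sum>j<length ss. c j * (ss ! j) l) = 0" if "N \<le> l" for c :: "nat \<Rightarrow> ('v, 'k) mpoly" and l
      using that by (intro sum.neutral) (simp add: ss(2)[OF nth_mem])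
    have "module_quotients V 1 ((ss @ ?zs) @ [S ?x])"
    proof (rule module_quotients.Snoc)
      show "module_quotients V 1 (ss @ ?zs)" using Suc by simp
      show "S ?x p \<in> ?R \<and> homogeneous 1 (S ?x p)" for p using SR[OF x] by blast
      show "set ?ys \<subseteq> V" using Snoc.hyps(3) xs(1) by (auto dest: in_set_takeD)
      show "finite (set ?ys)" by simp
      show "\<exists>c. (\<forall>l. c l \<in> ?R) \<and> (\<forall>p. var y * S ?x p = (\<Sum>l<length (ss @ ?zs). c l * ((ss @ ?zs) ! l) p))"
        if y: "y \<in> set ?ys" for y
      proof -
        obtain i where i: "i < k" "y = xs ! i" using y Suc.prems by (auto simp: in_set_conv_nth)
        have yX: "y \<in> X" using y xs(1) by (auto dest: in_set_takeD)
        have vR: "var ?x \<in> ?R" "var y \<in> ?R" using x yX Snoc.hyps(3) by (auto simp: var_in_poly_ring)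
        \<comment> \<open>The Koszul relation: its coordinate \<open>N\<close> cancels, so it is a
          syzygy of \<open>gs\<close> alone and hence a combination of \<open>ss\<close>.\<close>
        define v where "v l = var y * S ?x l - var ?x * S y l" for l
        have "v l \<in> ?R" for l using SR[OF x] SR[OF yX] vR by (simp add: v_def poly_ring_closed)
        moreover have "(\<Sum>l<N. v l * (gs ! l) p) = 0" for p
        proof -
          have "(\<Sum>l<N. v l * (gs ! l) p) =
            var y * (\<Sum>l<N. S ?x l * (gs ! l) p) - var ?x * (\<Sum>l<N. S y l * (gs ! l) p)"
            by (simp add: v_def algebra_simps sum_subtractf sum_distrib_left)
          also have "(\<Sum>l<N. S ?x l * (gs ! l) p) = - (var ?x * g p)"
            using Sker[OF x, of p] by (simp add: SN eq_neg_iff_add_eq_0)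
          also have "(\<Sum>l<N. S y l * (gs ! l) p) = - (var y * g p)"
            using Sker[OF yX, of p] by (simp add: SN eq_neg_iff_add_eq_0)
          finally show ?thesis by (simp add: algebra_simps)
        qed
        ultimately obtain c where c: "\<forall>j. c j \<in> ?R" "\<forall>l<N. v l = (\<Sum>j<length ss. c j * (ss ! j) l)"
          using ss(4)[of v] by blast
        define c' where "c' j = (if j < length ss then c j else if j = length ss + i then var ?x else 0)" for j
        have "var y * S ?x p = (\<Sum>l<length (ss @ ?zs). c' l * ((ss @ ?zs) ! l) p)" for p
        proof -
          have "(\<Sum>j<length ?zs. c' (length ss + j) * (?zs ! j) p) = (\<Sum>j<k. if j = i then var ?x * S y p else 0)"
            using len i by (intro sum.cong) (auto simp: c'_def)
          hence "(\<Sum>l<length (ss @ ?zs). c' l * ((ss @ ?zs) ! l) p) =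
            (\<Sum>j<length ss. c j * (ss ! j) p) + var ?x * S y p"
            unfolding sum_append using i(1) by (simp add: c'_def)
          moreover have "(\<Sum>j<length ss. c j * (ss ! j) p) = v p"
          proof (cases "p < N")
            case True thus ?thesis using c(2) by simp
          next
            case False
            hence "v p = 0" by (simp add: v_def S_def mult.commute)
            thus ?thesis using sN[of p c] False by simp
          qed
          ultimately show ?thesis by (simp add: v_def)
        qed
        moreover have "c' j \<in> ?R" for j using c(1) vR by (simp add: c'_def)
        ultimately show ?thesis by blast
      qed
      show "\<forall>t\<in>keys f. keys t \<inter> set ?ys \<noteq> {}"
        if f: "f \<in> ?R" "\<forall>l. c l \<in> ?R" "\<forall>p. f * S ?x p = (\<Sum>l<length (ss @ ?zs). c l * ((ss @ ?zs) ! l) p)"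
        for f c
      proof
        fix t assume t: "t \<in> keys f"
        \<comment> \<open>In coordinate \<open>N\<close> the vectors of \<open>ss\<close> vanish and
          each \<open>S y\<close> is the variable \<open>y\<close>. So \<open>f\<close> times
          \<open>?x\<close> lies in the ideal of the earlier variables, of which \<open>?x\<close>
          is none.\<close>
        have "f * var ?x = (\<Sum>l<length (ss @ ?zs). c l * ((ss @ ?zs) ! l) N)"
          using f(3) SN by metis
        also have "\<dots> = (\<Sum>i<k. c (length ss + i) * var (xs ! i))"
          unfolding sum_append sN[OF order_refl] using len by (simp add: SN)
        finally have eq: "f * var ?x = (\<Sum>i<k. c (length ss + i) * var (xs ! i))" .
        let ?t = "t + single ?x 1"
        have "?t \<in> keys (f * var ?x)"
          using t by (simp add: var_def in_keys_iff lookup_times_mono del: One_nat_def)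
        hence "?t \<in> (\<Union>i\<in>{..<k}. keys (c (length ss + i) * var (xs ! i)))"
          unfolding eq using keys_sum[of "\<lambda>i. c (length ss + i) * var (xs ! i)" "{..<k}"] by auto
        then obtain i where i: "i < k" "?t \<in> keys (c (length ss + i) * var (xs ! i))" by blast
        then obtain a where "?t = a + single (xs ! i) 1"
          using keys_times[OF i(2)] by (auto simp: var_def mono_def)
        hence "xs ! i \<in> keys ?t" by (simp add: keys_monom_add)
        moreover have "xs ! i \<in> set ?ys" using i(1) Suc.prems by (auto simp: in_set_conv_nth intro!: exI[of _ i])
        ultimately show "keys t \<inter> set ?ys \<noteq> {}"
          using x_notin by (auto simp: keys_monom_add)
      qed
    qed
    thus ?case using Suc.prems by (simp add: take_Suc_conv_app_nth)
  qed
  define zs where "zs = ss @ map S xs"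
  have lenG: "length (gs @ [g]) = Suc N" by (simp add: N_def)
  have sumG: "(\<Sum>l<length (gs @ [g]). v l * ((gs @ [g]) ! l) p) = (\<Sum>l<N. v l * (gs ! l) p) + v N * g p"
    for v :: "nat \<Rightarrow> ('v, 'k) mpoly" and p
    by (simp add: lenG N_def nth_append)
  have "module_quotients V 1 zs" using mq[of "length xs"] by (simp add: zs_def)
  moreover have "s l = 0" if "s \<in> set zs" "length (gs @ [g]) \<le> l" for s l
    using that ss(2) lenG by (auto simp: zs_def S_def)
  moreover have "(\<Sum>l<length (gs @ [g]). s l * ((gs @ [g]) ! l) p) = 0" if "s \<in> set zs" for s p
    using that ss(2)[of s N] ss(3)[of s p] Sker xs(1) unfolding sumG by (auto simp: zs_def)
  moreover have "\<exists>c. (\<forall>j. c j \<in> ?R) \<and> (\<forall>l<length (gs @ [g]). v l = (\<Sum>j<length zs. c j * (zs ! j) l))"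
    if v: "\<forall>l. v l \<in> ?R" "\<forall>p. (\<Sum>l<length (gs @ [g]). v l * ((gs @ [g]) ! l) p) = 0" for v
  proof -
    have "v N * g p = (\<Sum>l<N. (- v l) * (gs ! l) p)" for p
      using v(2)[rule_format, of p] unfolding sumG by (simp add: sum_negf eq_neg_iff_add_eq_0 add.commute)
    \<comment> \<open>The coefficient of \<open>g\<close> in a syzygy lies in the colon ideal, hence
      is a combination of the variables in \<open>X\<close>. Subtracting the same combination of the
      \<open>S x\<close> leaves a syzygy of \<open>gs\<close>.\<close>
    hence "\<forall>t\<in>keys (v N). keys t \<inter> set xs \<noteq> {}"
      using Snoc.hyps(6)[of "v N" "\<lambda>l. - v l"] v(1) xs(1) by (simp add: N_def poly_ring_uminus)
    then obtain h where h: "\<forall>i. h i \<in> ?R" "v N = (\<Sum>i<length xs. h i * var (xs ! i))"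
      using var_combination[of "v N" V xs] v(1) by blast
    define w where "w l = v l - (\<Sum>i<length xs. h i * S (xs ! i) l)" for l
    have xX: "xs ! i \<in> X" if "i < length xs" for i using that xs(1) by auto
    have wR: "w l \<in> ?R" for l
      unfolding w_def using v(1) h(1) SR xX
      by (intro poly_ring_closed poly_ring_sum) (auto intro: poly_ring_closed)
    have "(\<Sum>l<N. w l * (gs ! l) p) = 0" for p
    proof -
      have wN: "w N = 0" by (simp add: w_def SN h(2))
      have "(\<Sum>l<N. w l * (gs ! l) p) + w N * g p =
        ((\<Sum>l<N. v l * (gs ! l) p) + v N * g p) -
        (\<Sum>i<length xs. h i * ((\<Sum>l<N. S (xs ! i) l * (gs ! l) p) + S (xs ! i) N * g p))"
      proof -
        have "(\<Sum>l<N. (\<Sum>i<length xs. h i * S (xs ! i) l) * (gs ! l) p) =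
          (\<Sum>i<length xs. h i * (\<Sum>l<N. S (xs ! i) l * (gs ! l) p))"
          unfolding sum_distrib_left sum_distrib_right by (subst sum.swap) (simp add: mult.assoc)
        thus ?thesis
          by (simp add: w_def left_diff_distrib sum_subtractf distrib_left sum.distrib sum_distrib_right mult.assoc)
      qed
      also have "\<dots> = 0" using v(2) Sker[OF xX] unfolding sumG by simp
      finally show ?thesis using wN by simp
    qed
    then obtain c where c: "\<forall>j. c j \<in> ?R" "\<forall>l<N. w l = (\<Sum>j<length ss. c j * (ss ! j) l)"
      using ss(4)[of w] wR by blast
    define c' where "c' j = (if j < length ss then c j else h (j - length ss))" for j
    have "v l = (\<Sum>j<length zs. c' j * (zs ! j) l)" if l: "l < length (gs @ [g])" for l
    proof -
      have "(\<Sum>j<length zs. c' j * (zs ! j) l) =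
        (\<Sum>j<length ss. c j * (ss ! j) l) + (\<Sum>i<length xs. h i * S (xs ! i) l)"
        unfolding zs_def sum_append by (simp add: c'_def)
      also have "(\<Sum>j<length ss. c j * (ss ! j) l) = w l"
      proof (cases "l < N")
        case False
        hence "l = N" using l lenG by simp
        moreover have "(\<Sum>j<length ss. c j * (ss ! j) N) = 0"
          by (intro sum.neutral) (simp add: ss(2)[OF nth_mem])
        ultimately show ?thesis by (simp add: w_def SN h(2))
      qed (use c in simp)
      finally show ?thesis by (simp add: w_def)
    qed
    thus ?thesis using c(1) h(1) by (intro exI[of _ c']) (auto simp: c'_def)
  qed
  ultimately show ?case by (intro exI[of _ zs]) blast
qed

text \<open>Each list of the iterated syzygies supplies the columns of one matrix. Beyond the
  augmentation all entries are homogeneous of degree one, which gives the shifts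
  \<open>d + i\<close> and minimality at once.\<close>

lemma linear_resolution_of_module_quotients:
  fixes gs :: "(nat \<Rightarrow> ('v, 'k::field) mpoly) list"
  assumes gs: "module_quotients V d gs" "\<forall>g\<in>set gs. \<forall>p>0. g p = 0"
    and I: "I = {(\<Sum>q<length gs. c q * (gs ! q) 0) | c. \<forall>q. c q \<in> carrier (poly_ring V)}"
  shows "has_linear_resolution V I"
proof -
  let ?R = "carrier (poly_ring V) :: ('v, 'k) mpoly set"
  define P where "P ss hs \<longleftrightarrow> module_quotients V 1 hs \<and>
    (\<forall>s\<in>set hs. \<forall>l\<ge>length ss. s l = 0) \<and>
    (\<forall>s\<in>set hs. \<forall>p. (\<Sum>l<length ss. s l * (ss ! l) p) = 0) \<and>
    (\<forall>v. (\<forall>l. v l \<in> ?R) \<longrightarrow> (\<forall>p. (\<Sum>l<length ss. v l * (ss ! l) p) = 0) \<longrightarrow>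
      (\<exists>c. (\<forall>j. c j \<in> ?R) \<and> (\<forall>l<length ss. v l = (\<Sum>j<length hs. c j * (hs ! j) l))))"
    for ss hs :: "(nat \<Rightarrow> ('v, 'k) mpoly) list"
  have ex: "\<exists>hs. P ss hs" if "module_quotients V e ss" for ss e
    unfolding P_def using syzygies_module_quotients[OF that] .
  define F where "F n = rec_nat gs (\<lambda>_ ss. SOME hs. P ss hs) n" for n
  have F0: "F 0 = gs" by (simp add: F_def)
  have mqP: "(\<exists>e. module_quotients V e (F n)) \<and> P (F n) (F (Suc n))" for n
  proof (induction n)
    case 0
    have "P (F 0) (F (Suc 0))" using someI_ex[OF ex[OF gs(1)]] by (simp add: F_def)
    thus ?case using gs(1) F0 by auto
  next
    case (Suc n)
    hence m: "module_quotients V 1 (F (Suc n))" by (simp add: P_def)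
    hence "P (F (Suc n)) (F (Suc (Suc n)))" using someI_ex[OF ex[OF m]] by (simp add: F_def)
    thus ?case using m by blast
  qed
  define b where "b n = length (F n)" for n
  define \<phi> where "\<phi> n = (case n of 0 \<Rightarrow> mat 1 (b 0) (\<lambda>(p, q). (F 0 ! q) p)
    | Suc m \<Rightarrow> mat (b m) (b (Suc m)) (\<lambda>(p, q). (F (Suc m) ! q) p))" for n
  \<comment> \<open>The number of rows: one for the augmentation, since the vectors of
    \<open>gs\<close> are supported in coordinate zero.\<close>
  define r where "r n = (case n of 0 \<Rightarrow> 1 | Suc m \<Rightarrow> b m)" for n
  have \<phi>: "\<phi> n = mat (r n) (b n) (\<lambda>(p, q). (F n ! q) p)" for n
    by (simp add: \<phi>_def r_def split: nat.split)
  have ent: "(F n ! q) p \<in> ?R" "homogeneous (if n = 0 then d else 1) ((F n ! q) p)" if "q < b n" for n q p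
  proof -
    have mq: "module_quotients V (if n = 0 then d else 1) (F n)"
      using gs(1) mqP[of "n - 1"] F0 by (cases n) (auto simp: P_def)
    show "(F n ! q) p \<in> ?R" "homogeneous (if n = 0 then d else 1) ((F n ! q) p)"
      using module_quotients_homogeneous[OF mq, of "F n ! q" p] that by (simp_all add: b_def)
  qed
  have supp: "(F n ! q) p = 0" if "q < b n" "r n \<le> p" for n q p
    using that gs(2) F0 mqP[of "n - 1"] by (cases n) (auto simp: P_def r_def b_def)
  define e where "e i q = int d + int i" for i q :: nat
  have mult: "\<phi> n *\<^sub>v v = vec (r n) (\<lambda>p. \<Sum>q<b n. v $ q * (F n ! q) p)" if "v \<in> carrier_vec (b n)" for n v
    unfolding \<phi> using that
    by (intro eq_vecI) (auto simp: scalar_prod_def lessThan_atLeast0 mult.commute intro!: sum.cong)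
  have dim: "dim_col (\<phi> n) = b n" "dim_row (\<phi> n) = r n" for n by (simp_all add: \<phi>)
  have elem: "\<exists>p q. q < b n \<and> a = (F n ! q) p" if "a \<in> elements_mat (\<phi> n)" for a n
    using that elements_matD[of a "\<phi> n"] dim by (fastforce simp: \<phi>)
  have exact: "mat_image V (\<phi> (Suc i)) = mat_ker V (\<phi> i)" for i
  proof
    show "mat_image V (\<phi> (Suc i)) \<subseteq> mat_ker V (\<phi> i)"
    proof
      fix w assume "w \<in> mat_image V (\<phi> (Suc i))"
      then obtain v where v: "v \<in> free_module V (b (Suc i))" "w = \<phi> (Suc i) *\<^sub>v v"
        by (auto simp: mat_image_def dim)
      have vR: "v \<in> carrier_vec (b (Suc i))" "\<And>q. q < b (Suc i) \<Longrightarrow> v $ q \<in> ?R"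
        using v by (auto simp: free_module_def)
      have w: "w = vec (b i) (\<lambda>p. \<Sum>q<b (Suc i). v $ q * (F (Suc i) ! q) p)"
        unfolding v(2) mult[OF vR(1)] by (simp add: r_def)
      have wc: "w \<in> carrier_vec (b i)" by (simp add: w)
      have "w \<in> free_module V (b i)"
        unfolding free_module_def using vR ent
        by (auto simp: w intro!: poly_ring_sum poly_ring_closed)
      moreover have "(\<Sum>l<b i. w $ l * (F i ! l) p) = 0" for p
      proof -
        have "(\<Sum>l<b i. w $ l * (F i ! l) p) =
          (\<Sum>l<b i. (\<Sum>q<b (Suc i). v $ q * (F (Suc i) ! q) l) * (F i ! l) p)"
          by (simp add: w)
        also have "\<dots> = (\<Sum>q<b (Suc i). v $ q * (\<Sum>l<b i. (F (Suc i) ! q) l * (F i ! l) p))"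
          unfolding sum_distrib_left sum_distrib_right by (subst sum.swap) (simp add: mult.assoc)
        also have "\<dots> = 0"
          using mqP[of i] by (auto simp: P_def b_def intro!: sum.neutral)
        finally show ?thesis .
      qed
      hence "\<phi> i *\<^sub>v w = 0\<^sub>v (r i)" unfolding mult[OF wc] by auto
      ultimately show "w \<in> mat_ker V (\<phi> i)" by (simp add: mat_ker_def dim)
    qed
    show "mat_ker V (\<phi> i) \<subseteq> mat_image V (\<phi> (Suc i))"
    proof
      fix w assume w: "w \<in> mat_ker V (\<phi> i)"
      hence wc: "w \<in> carrier_vec (b i)" "\<And>q. q < b i \<Longrightarrow> w $ q \<in> ?R"
        and w0: "\<phi> i *\<^sub>v w = 0\<^sub>v (r i)"
        by (auto simp: mat_ker_def dim free_module_def)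
      define v where "v l = (if l < b i then w $ l else 0)" for l
      have "v l \<in> ?R" for l using wc by (simp add: v_def)
      \<comment> \<open>\<open>P\<close> asks for the relation in every coordinate, whereas the
        matrix sees only those below \<open>r i\<close>; in the others all vectors of
        \<open>F i\<close> vanish.\<close>
      moreover have "(\<Sum>l<length (F i). v l * (F i ! l) p) = 0" for p
      proof (cases "p < r i")
        case True
        have "(\<Sum>q<b i. w $ q * (F i ! q) p) = 0"
          using arg_cong[OF w0[unfolded mult[OF wc(1)]], of "\<lambda>x. x $ p"] True by simp
        thus ?thesis by (simp add: v_def b_def)
      next
        case False
        thus ?thesis using supp[of _ i p] by (auto simp: b_def intro!: sum.neutral)
      qed
      ultimately obtain c where c: "\<forall>j. c j \<in> ?R"
        "\<forall>l<b i. v l = (\<Sum>j<b (Suc i). c j * (F (Suc i) ! j) l)"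
        using mqP[of i] unfolding P_def b_def by blast
      let ?c = "vec (b (Suc i)) c"
      have "?c \<in> free_module V (b (Suc i))" using c(1) by (simp add: free_module_def)
      moreover have "w = \<phi> (Suc i) *\<^sub>v ?c"
        using wc(1) c(2) by (subst mult) (auto simp: r_def v_def intro!: eq_vecI)
      ultimately show "w \<in> mat_image V (\<phi> (Suc i))" by (auto simp: mat_image_def dim)
    qed
  qed
  have im: "(\<lambda>v. v $ 0) ` mat_image V (\<phi> 0) = I"
  proof
    show "(\<lambda>v. v $ 0) ` mat_image V (\<phi> 0) \<subseteq> I"
    proof
      fix f assume "f \<in> (\<lambda>v. v $ 0) ` mat_image V (\<phi> 0)"
      then obtain v where v: "v \<in> free_module V (b 0)" "f = (\<phi> 0 *\<^sub>v v) $ 0"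
        by (auto simp: mat_image_def dim)
      hence vc: "v \<in> carrier_vec (b 0)" by (simp add: free_module_def)
      have "f = (\<Sum>q<b 0. v $ q * (F 0 ! q) 0)" unfolding v(2) mult[OF vc] by (simp add: r_def)
      hence "f = (\<Sum>q<length gs. (if q < b 0 then v $ q else 0) * (gs ! q) 0)"
        by (simp add: b_def F0)
      moreover have "\<forall>q. (if q < b 0 then v $ q else 0) \<in> ?R" using v by (simp add: free_module_def)
      ultimately show "f \<in> I"
        unfolding I by (intro CollectI exI[of _ "\<lambda>q. if q < b 0 then v $ q else 0"] conjI)
    qed
    show "I \<subseteq> (\<lambda>v. v $ 0) ` mat_image V (\<phi> 0)"
    proof
      fix f assume "f \<in> I"
      then obtain c where c: "\<forall>q. c q \<in> ?R" "f = (\<Sum>q<b 0. c q * (F 0 ! q) 0)"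
        unfolding I b_def F0 by blast
      have "vec (b 0) c \<in> free_module V (b 0)" using c by (simp add: free_module_def)
      moreover have "f = (\<phi> 0 *\<^sub>v vec (b 0) c) $ 0" using c(2) by (subst mult) (auto simp: r_def)
      ultimately show "f \<in> (\<lambda>v. v $ 0) ` mat_image V (\<phi> 0)" by (auto simp: mat_image_def dim)
    qed
  qed
  have "graded_free_resolution V I b e \<phi>"
    unfolding graded_free_resolution_def
  proof (intro conjI allI impI ballI)
    show "\<phi> 0 \<in> carrier_mat 1 (b 0)" by (simp add: \<phi> r_def)
    show "\<phi> (Suc i) \<in> carrier_mat (b i) (b (Suc i))" for i by (simp add: \<phi> r_def)
    show "elements_mat (\<phi> i) \<subseteq> ?R" for i using elem ent by blast
    show "int (mdeg t) = e 0 q" if "q < b 0" "t \<in> keys (\<phi> 0 $$ (0, q))" for q t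
      using that ent(2)[of q 0 0] by (simp add: \<phi> r_def e_def homogeneous_def)
    show "int (mdeg t) + e i p = e (Suc i) q"
      if "p < b i" "q < b (Suc i)" "t \<in> keys (\<phi> (Suc i) $$ (p, q))" for i p q t
      using that ent(2)[of q "Suc i" p] by (simp add: \<phi> r_def e_def homogeneous_def)
  qed (use im exact in auto)
  moreover have "elements_mat (\<phi> (Suc i)) \<subseteq> Idl\<^bsub>poly_ring V\<^esub> (var ` V)" for i
  proof
    fix a assume "a \<in> elements_mat (\<phi> (Suc i))"
    then obtain p q where q: "q < b (Suc i)" "a = (F (Suc i) ! q) p" using elem by blast
    have "\<exists>x\<in>V. x \<in> keys t" if "t \<in> keys a" for t
    proof -
      have "mdeg t = 1" "keys t \<subseteq> V" using ent[OF q(1), of p] that q(2)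
        by (auto simp: homogeneous_def in_poly_ring)
      moreover have "keys t \<noteq> {}" using \<open>mdeg t = 1\<close> unfolding mdeg_def by force
      ultimately show ?thesis by blast
    qed
    thus "a \<in> Idl\<^bsub>poly_ring V\<^esub> (var ` V)"
      unfolding genideal_var[OF order_refl] using ent[OF q(1), of p] q(2) by (auto simp: monom_ideal_def)
  qed
  ultimately have "minimal_graded_free_resolution V I b e \<phi>"
    by (simp add: minimal_graded_free_resolution_def)
  thus ?thesis unfolding has_linear_resolution_def e_def by blast
qed

text \<open>The variables supplied by the linear steps generate the colon ideal: if \<open>t\<close>
  times \<open>ws ! b\<close> is a multiple of an earlier \<open>ws ! a\<close>, then
  \<open>t\<close> has to make up for each exponent in which \<open>ws ! a\<close> exceeds
  \<open>ws ! b\<close>.\<close>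

lemma module_quotients_monomials:
  assumes ws: "\<forall>w\<in>set ws. keys w \<subseteq> V \<and> mdeg w = d" and V: "finite V"
    and q: "linear_steps V ws"
  defines "vec_of \<equiv> (\<lambda>w p. if p = 0 then mono w else 0 :: ('v, 'k::field) mpoly)"
  shows "module_quotients V d (map vec_of ws)"
proof -
  let ?R = "carrier (poly_ring V) :: ('v, 'k) mpoly set"
  have "module_quotients V d (map vec_of (take b ws))" if "b \<le> length ws" for b
    using that
  proof (induction b)
    case 0 thus ?case by (simp add: module_quotients.Nil)
  next
    case (Suc b)
    let ?ws = "take b ws" and ?w = "ws ! b"
    have b: "b < length ws" using Suc.prems by simp
    have w: "keys ?w \<subseteq> V" "mdeg ?w = d" using ws b by auto
    define X where "X = {x \<in> V. \<exists>l<b. \<exists>z\<in>V. ws ! l + single z 1 = ?w + single x 1}"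
    have len: "length (map vec_of ?ws) = b" using b by simp
    have nth: "map vec_of ?ws ! l = vec_of (ws ! l)" if "l < b" for l using that b by simp
    have "module_quotients V d (map vec_of ?ws @ [vec_of ?w])"
    proof (rule module_quotients.Snoc)
      show "module_quotients V d (map vec_of ?ws)" using Suc by simp
      show "vec_of ?w p \<in> ?R \<and> homogeneous d (vec_of ?w p)" for p
        using w by (simp add: vec_of_def mono_in_poly_ring) (simp add: homogeneous_def mono_def)
      show "X \<subseteq> V" "finite X" using V by (auto simp: X_def)
      show "\<exists>c. (\<forall>l. c l \<in> ?R) \<and> (\<forall>p. var x * vec_of ?w p =
          (\<Sum>l<length (map vec_of ?ws). c l * (map vec_of ?ws ! l) p))" if "x \<in> X" for x
      proof -
        obtain l z where l: "l < b" "z \<in> V" "ws ! l + single z 1 = ?w + single x 1"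
          using \<open>x \<in> X\<close> by (auto simp: X_def)
        define c where "c j = (if j = l then var z else 0 :: ('v, 'k) mpoly)" for j
        have "var x * vec_of ?w p = (\<Sum>j<length (map vec_of ?ws). c j * (map vec_of ?ws ! j) p)" for p
        proof -
          have "(\<Sum>j<length (map vec_of ?ws). c j * (map vec_of ?ws ! j) p) =
            (\<Sum>j<b. if j = l then var z * vec_of (ws ! l) p else 0)"
            unfolding len by (rule sum.cong) (auto simp: c_def nth simp del: nth_map)
          also have "\<dots> = var z * vec_of (ws ! l) p" using l(1) by simp
          also have "\<dots> = var x * vec_of ?w p"
            using l(3) by (simp add: vec_of_def var_def mono_def mult_single add.commute)
          finally show ?thesis by simp
        qed
        moreover have "c j \<in> ?R" for j using l by (simp add: c_def var_in_poly_ring)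
        ultimately show ?thesis by blast
      qed
      show "\<forall>t\<in>keys f. keys t \<inter> X \<noteq> {}"
        if f: "f \<in> ?R" "\<forall>l. c l \<in> ?R"
          "\<forall>p. f * vec_of ?w p = (\<Sum>l<length (map vec_of ?ws). c l * (map vec_of ?ws ! l) p)" for f c
      proof
        fix t assume t: "t \<in> keys f"
        have "f * vec_of ?w 0 = (\<Sum>l<b. c l * vec_of (ws ! l) 0)"
          using f(3) unfolding len by (simp add: nth del: nth_map)
        hence eq: "f * mono ?w = (\<Sum>l<b. c l * mono (ws ! l))" by (simp add: vec_of_def)
        have "t + ?w \<in> keys (f * mono ?w)" using t by (simp add: in_keys_iff lookup_times_mono)
        then obtain a where a: "a < b" "t + ?w \<in> keys (c a * mono (ws ! a))"
          unfolding eq using keys_sum[of "\<lambda>l. c l * mono (ws ! l)" "{..<b}"] by auto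
        then obtain s where s: "t + ?w = s + ws ! a" using keys_times[OF a(2)] by (auto simp: mono_def)
        obtain x l z where x: "lookup ?w x < lookup (ws ! a) x" "l < b" "z \<in> V"
          "ws ! l + single z 1 = ?w + single x 1" using q b a(1) unfolding linear_steps_def by blast
        have "lookup t x + lookup ?w x = lookup s x + lookup (ws ! a) x" using s by (metis lookup_add)
        hence "x \<in> keys t" using x(1) by (auto simp: in_keys_iff)
        moreover have "x \<in> V" using \<open>x \<in> keys t\<close> t f(1) by (auto simp: in_poly_ring)
        ultimately show "keys t \<inter> X \<noteq> {}" using x by (auto simp: X_def)
      qed
    qed
    thus ?case using b by (simp add: take_Suc_conv_app_nth)
  qed
  from this[of "length ws"] show ?thesis by simp
qed

lemma mono_homogeneous: "homogeneous (mdeg t) (mono t)"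
  by (simp add: homogeneous_def mono_def)

lemma homogeneous_ideal_monom_ideal:
  fixes T :: "'v monom set"
  assumes "\<And>t s. t \<in> T \<Longrightarrow> keys s \<subseteq> V \<Longrightarrow> t + s \<in> T"
  shows "homogeneous_ideal V (monom_ideal V T :: ('v, 'k::field) mpoly set)"
proof -
  let ?I = "monom_ideal V T :: ('v, 'k) mpoly set"
  let ?R = "poly_ring V :: ('v, 'k) mpoly ring"
  let ?S = "{p \<in> ?I. \<exists>d. homogeneous d p}"
  have I: "ideal ?I ?R" using assms by (rule ideal_monom_ideal)
  have S: "?S \<subseteq> carrier ?R" by (auto simp: monom_ideal_def)
  have "?I \<subseteq> Idl\<^bsub>?R\<^esub> ?S"
  proof (rule monom_ideal_subset[OF ring.genideal_ideal[OF ring_poly_ring S]])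
    fix t assume "t \<in> T" "keys t \<subseteq> V"
    hence "mono t \<in> ?S" using mono_homogeneous by (auto simp: mono_in_monom_ideal)
    thus "mono t \<in> Idl\<^bsub>?R\<^esub> ?S" using ring.genideal_self[OF ring_poly_ring S] by blast
  qed
  moreover have "Idl\<^bsub>?R\<^esub> ?S \<subseteq> ?I" by (rule ring.genideal_minimal[OF ring_poly_ring I]) auto
  ultimately show ?thesis using I by (auto simp: homogeneous_ideal_def)
qed

lemma genideal_degree_component:
  fixes T :: "'v monom set"
  shows "Idl\<^bsub>poly_ring V\<^esub> {p \<in> monom_ideal V T. homogeneous d p} =
    (monom_ideal V (upset {w \<in> T. keys w \<subseteq> V \<and> mdeg w = d}) :: ('v, 'k::field) mpoly set)"
proof
  let ?R = "poly_ring V :: ('v, 'k) mpoly ring"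
  let ?S = "{p \<in> monom_ideal V T. homogeneous d p} :: ('v, 'k) mpoly set"
  let ?W = "{w \<in> T. keys w \<subseteq> V \<and> mdeg w = d}"
  have S: "?S \<subseteq> carrier ?R" by (auto simp: monom_ideal_def)
  show "Idl\<^bsub>?R\<^esub> ?S \<subseteq> monom_ideal V (upset ?W)"
  proof (rule ring.genideal_minimal[OF ring_poly_ring ideal_monom_ideal])
    show "?S \<subseteq> monom_ideal V (upset ?W)"
    proof
      fix p assume p: "p \<in> ?S"
      have "t \<in> upset ?W" if "t \<in> keys p" for t
        using p that by (intro upset_self) (auto simp: monom_ideal_def homogeneous_def in_poly_ring)
      thus "p \<in> monom_ideal V (upset ?W)" using p by (auto simp: monom_ideal_def)
    qed
  qed (rule upset_closed)
  have "(mono ` ?W :: ('v, 'k) mpoly set) \<subseteq> ?S"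
    using mono_homogeneous by (auto simp: mono_in_monom_ideal)
  hence "Idl\<^bsub>?R\<^esub> (mono ` ?W) \<subseteq> Idl\<^bsub>?R\<^esub> ?S"
    using ring.genideal_self[OF ring_poly_ring S] ring.genideal_ideal[OF ring_poly_ring S]
    by (intro ring.genideal_minimal[OF ring_poly_ring]) auto
  moreover have "Idl\<^bsub>?R\<^esub> (mono ` ?W) = monom_ideal V (upset ?W)" by (rule genideal_mono) auto
  ultimately show "monom_ideal V (upset ?W) \<subseteq> Idl\<^bsub>?R\<^esub> ?S" by simp
qed

text \<open>The component of degree \<open>d\<close> is generated by all monomials of degree
  \<open>d\<close> in the ideal; listed with linear steps they start a linear resolution. Where
  there are none, the list is empty and resolves the zero ideal.\<close>

lemma linear_quotients_imp_componentwise_linear: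
  fixes I :: "('v, 'k::field) mpoly set"
  assumes V: "finite V" and lq: "linear_quotients V I"
  shows "componentwise_linear V I"
proof -
  obtain us where us: "distinct us" "minimal_monomial_generators V I (set us)" "exponent_quotients us"
    using lq unfolding linear_quotients_iff by blast
  hence keys: "\<forall>u\<in>set us. keys u \<subseteq> V" and I: "I = monom_ideal V (upset (set us))"
    and anti: "\<forall>u\<in>set us. \<forall>w\<in>set us. divides u w \<longrightarrow> u = w"
    unfolding minimal_monomial_generators_iff by blast+
  have "has_linear_resolution V (Idl\<^bsub>poly_ring V\<^esub> {p \<in> I. homogeneous d p})" for d
  proof -
    let ?W = "{w. keys w \<subseteq> V \<and> mdeg w = d \<and> w \<in> upset (set us)}"
    obtain ws where ws: "set ws = ?W" "distinct ws"
      "linear_steps V ws"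
      using degree_component_order[OF V us(1) keys anti us(3), of d] by blast
    define gs :: "(nat \<Rightarrow> ('v, 'k) mpoly) list" where "gs = map (\<lambda>w p. if p = 0 then mono w else 0) ws"
    have mq: "module_quotients V d gs"
      unfolding gs_def by (rule module_quotients_monomials[OF _ V ws(3)]) (use ws(1) in auto)
    have "Idl\<^bsub>poly_ring V\<^esub> {p \<in> I. homogeneous d p} = monom_ideal V (upset (set ws))"
      unfolding I genideal_degree_component ws(1) by (intro arg_cong2[where f = monom_ideal] arg_cong[where f = upset]) auto
    also have "\<dots> = {(\<Sum>q<length gs. c q * (gs ! q) 0) | c. \<forall>q. c q \<in> carrier (poly_ring V)}" (is "_ = ?L")
    proof
      have e: "(\<Sum>q<length gs. c q * (gs ! q) 0) = (\<Sum>q<length ws. c q * mono (ws ! q))" for c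
        by (simp add: gs_def)
      have wsI: "mono (ws ! q) \<in> (monom_ideal V (upset (set ws)) :: ('v, 'k) mpoly set)" if "q < length ws" for q
        using ws(1) nth_mem[OF that] by (auto simp: mono_in_monom_ideal intro: upset_self)
      have idl: "ideal (monom_ideal V (upset (set ws)) :: ('v, 'k) mpoly set) (poly_ring V)"
        by (rule ideal_monom_ideal) (rule upset_closed)
      show sub: "?L \<subseteq> monom_ideal V (upset (set ws))"
        unfolding e using wsI by (auto intro!: ideal_sum[OF idl] ideal_poly_ringD(3)[OF idl])
      have "ideal ?L (poly_ring V)"
      proof (rule ideal_poly_ringI)
        show "?L \<subseteq> carrier (poly_ring V)" using sub ideal_poly_ringD(4)[OF idl] by blast
        show "0 \<in> ?L" by (auto intro!: exI[of _ "\<lambda>_. 0"])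
        fix p r assume p: "p \<in> ?L"
        then obtain c where c: "\<forall>q. c q \<in> carrier (poly_ring V)" "p = (\<Sum>q<length gs. c q * (gs ! q) 0)"
          by blast
        show "p + p' \<in> ?L" if p': "p' \<in> ?L" for p'
        proof -
          obtain c' where c': "\<forall>q. c' q \<in> carrier (poly_ring V)" "p' = (\<Sum>q<length gs. c' q * (gs ! q) 0)"
            using p' by blast
          show ?thesis using c c'
            by (auto simp: poly_ring_closed distrib_right sum.distrib intro!: exI[of _ "\<lambda>q. c q + c' q"])
        qed
        show "r * p \<in> ?L" if "r \<in> carrier (poly_ring V)"
          using c that
          by (auto simp: poly_ring_closed sum_distrib_left mult.assoc intro!: exI[of _ "\<lambda>q. r * c q"])
      qed
      thus "monom_ideal V (upset (set ws)) \<subseteq> ?L"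
      proof (rule monom_ideal_subset)
        fix t assume t: "t \<in> upset (set ws)" "keys t \<subseteq> V"
        then obtain w where "w \<in> set ws" "divides w t" by (auto simp: upset_def)
        then obtain l where l: "l < length ws" "divides (ws ! l) t" by (metis in_set_conv_nth)
        define c where "c q = (if q = l then mono (t - ws ! l) else 0 :: ('v, 'k) mpoly)" for q
        have "mono t = mono (t - ws ! l) * (mono (ws ! l) :: ('v, 'k) mpoly)"
          using divides_eq[OF l(2)] by (simp add: mono_def mult_single add.commute)
        also have "\<dots> = (\<Sum>q<length ws. if q = l then mono (t - ws ! l) * mono (ws ! l) else 0)"
          using l(1) by simp
        also have "\<dots> = (\<Sum>q<length ws. c q * mono (ws ! q))"
          by (rule sum.cong) (auto simp: c_def)
        finally have "mono t = (\<Sum>q<length gs. c q * (gs ! q) 0)" unfolding e .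
        moreover have "c q \<in> carrier (poly_ring V)" for q
          using t(2) keys_minus_monom[of t "ws ! l"] by (auto simp: c_def mono_in_poly_ring)
        ultimately show "mono t \<in> ?L" by blast
      qed
    qed
    finally have eq: "Idl\<^bsub>poly_ring V\<^esub> {p \<in> I. homogeneous d p} = ?L" .
    show ?thesis
      by (rule linear_resolution_of_module_quotients[OF mq _ eq]) (auto simp: gs_def)
  qed
  moreover have "homogeneous_ideal V I" unfolding I by (rule homogeneous_ideal_monom_ideal) (rule upset_closed)
  ultimately show ?thesis by (simp add: componentwise_linear_def)
qed

section \<open>An exchange property of componentwise linear monomial ideals\<close>

text \<open>A monomial of degree one is a variable, so the coefficient of \<open>t\<close> collects
  the ways of splitting a variable off \<open>t\<close>.\<close>

lemma lookup_linear_mult: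
  fixes l :: "('v, 'k::field) mpoly"
  assumes "homogeneous 1 l"
  shows "lookup (l * w) t = (\<Sum>x\<in>keys t. lookup l (single x 1) * lookup w (t - single x 1))"
proof -
  have key: "\<exists>x. s = single x 1" if "s \<in> keys l" for s
  proof -
    have m: "mdeg s = 1" using assms that by (simp add: homogeneous_def)
    hence "keys s \<noteq> {}" unfolding mdeg_def by force
    then obtain x where "x \<in> keys s" by blast
    hence "divides (single x 1) s" unfolding divides_single .
    hence e: "s = single x 1 + (s - single x 1)" by (rule divides_eq)
    hence "mdeg s = 1 + mdeg (s - single x 1)" by (metis mdeg_add mdeg_single)
    hence "s - single x 1 = 0" using m by (intro mdeg_eq_0) simp
    thus ?thesis using e by auto
  qed
  have one: "lookup (single s c * w) t =
    (if divides s t then c * lookup w (t - s) else 0)" for s c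
  proof (cases "divides s t")
    case True
    hence "lookup (w * single s c) ((t - s) + s) = lookup w (t - s) * c"
      by (intro lookup_times_single)
    thus ?thesis using True divides_eq[OF True] by (simp add: mult.commute add.commute)
  next
    case False
    have "t \<notin> keys (single s c * w)"
    proof
      assume "t \<in> keys (single s c * w)"
      then obtain a b where "a \<in> keys (single s c)" "t = a + b" using keys_times by blast
      thus False using False divides_add by (auto split: if_splits)
    qed
    thus ?thesis using False by (simp add: in_keys_iff)
  qed
  have "lookup (l * w) t = (\<Sum>s\<in>keys l. if divides s t then lookup l s * lookup w (t - s) else 0)"
  proof -
    have "l * w = (\<Sum>s\<in>keys l. single s (lookup l s) * w)"
      by (subst poly_as_sum[of l]) (rule sum_distrib_right)
    thus ?thesis by (simp add: lookup_sum one)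
  qed
  also have "\<dots> = (\<Sum>s\<in>{s\<in>keys l. divides s t}. lookup l s * lookup w (t - s))"
    by (simp add: sum.inter_filter)
  also have "\<dots> = (\<Sum>s\<in>(\<lambda>x. single x 1) ` keys t. lookup l s * lookup w (t - s))"
  proof (rule sum.mono_neutral_left)
    show "{s \<in> keys l. divides s t} \<subseteq> (\<lambda>x. single x 1) ` keys t"
    proof
      fix s assume s: "s \<in> {s \<in> keys l. divides s t}"
      then obtain x where x: "s = single x 1" using key by blast
      hence "x \<in> keys t" using s divides_single by (metis (mono_tags) mem_Collect_eq)
      thus "s \<in> (\<lambda>x. single x 1) ` keys t" using x by blast
    qed
    have "divides (single x 1) t" if "x \<in> keys t" for x
      using that unfolding divides_single .
    thus "\<forall>s\<in>(\<lambda>x. single x 1) ` keys t - {s \<in> keys l. divides s t}.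
      lookup l s * lookup w (t - s) = 0" by (auto simp: in_keys_iff)
  qed simp
  also have "\<dots> = (\<Sum>x\<in>keys t. lookup l (single x 1) * lookup w (t - single x 1))"
  proof (rule sum.reindex_cong[OF _ refl refl])
    show "inj_on (\<lambda>x. single x (1::nat)) (keys t)"
      by (rule inj_onI) (metis keys_single one_neq_zero singleton_inject)
  qed
  finally show ?thesis .
qed

text \<open>Compare the generators \<open>u\<close> and \<open>v\<close> through the syzygy given by their least common multiple
  \<open>L\<close>. If no linear step leads away from \<open>u\<close> inside \<open>L\<close>, then the coefficient functional
  \<open>\<lambda>w. \<Sum>q. [L - u] w\<^sub>q \<cdot> [u] f\<^sub>q\<close> vanishes on all multiples of linear syzygies but not on
  this one.\<close>

lemma linear_resolution_exchange:
  fixes I :: "('v, 'k::field) mpoly set" and u v :: "'v monom"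
  assumes T: "\<And>t s. t \<in> T \<Longrightarrow> keys s \<subseteq> V \<Longrightarrow> t + s \<in> T"
    and I: "I = monom_ideal V T"
    and res: "has_linear_resolution V (Idl\<^bsub>poly_ring V\<^esub> {p \<in> I. homogeneous d p})"
    and u: "u \<in> T" "keys u \<subseteq> V" "mdeg u = d" and v: "v \<in> T" "keys v \<subseteq> V" "mdeg v = d"
    and uv: "u \<noteq> v"
  shows "\<exists>x y w. x \<noteq> y \<and> lookup u y < lookup v y \<and> 0 < lookup u x \<and> w \<in> T \<and>
    w + single x 1 = u + single y 1"
proof (rule ccontr)
  assume neg: "\<not> ?thesis"
  let ?R = "carrier (poly_ring V) :: ('v, 'k) mpoly set"
  let ?I = "Idl\<^bsub>poly_ring V\<^esub> {p \<in> I. homogeneous d p}"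
  obtain b e \<phi> d' where g: "graded_free_resolution V ?I b e \<phi>"
    and lin: "\<And>i q. q < b i \<Longrightarrow> e i q = d' + int i"
    using res unfolding has_linear_resolution_def minimal_graded_free_resolution_def by blast
  have \<phi>0: "\<phi> 0 \<in> carrier_mat 1 (b 0)" and \<phi>1: "\<phi> (Suc 0) \<in> carrier_mat (b 0) (b (Suc 0))"
    and el: "\<And>i. elements_mat (\<phi> i) \<subseteq> ?R"
    and d0: "\<And>q t. q < b 0 \<Longrightarrow> t \<in> keys (\<phi> 0 $$ (0, q)) \<Longrightarrow> int (mdeg t) = e 0 q"
    and d1: "\<And>p q t. p < b 0 \<Longrightarrow> q < b (Suc 0) \<Longrightarrow> t \<in> keys (\<phi> (Suc 0) $$ (p, q)) \<Longrightarrow>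
        int (mdeg t) + e 0 p = e (Suc 0) q"
    and im: "(\<lambda>v. v $ 0) ` mat_image V (\<phi> 0) = ?I"
    and ex: "mat_image V (\<phi> (Suc 0)) = mat_ker V (\<phi> 0)"
    using g by (simp_all add: graded_free_resolution_def)
  define f where "f q = \<phi> 0 $$ (0, q)" for q
  define l where "l q c = \<phi> (Suc 0) $$ (q, c)" for q c
  have fR: "f q \<in> ?R" if "q < b 0" for q
    using el[of 0] elements_matI[OF \<phi>0, of 0 q] that by (auto simp: f_def)
  have lR: "l q c \<in> ?R" if "q < b 0" "c < b (Suc 0)" for q c
    using el[of "Suc 0"] elements_matI[OF \<phi>1, of q c] that by (auto simp: l_def)
  have lh: "homogeneous 1 (l q c)" if "q < b 0" "c < b (Suc 0)" for q c
    using d1[OF that] lin[OF that(1)] lin[OF that(2)] by (auto simp: homogeneous_def l_def)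
  have mult0: "\<phi> 0 *\<^sub>v w = vec 1 (\<lambda>_. \<Sum>q<b 0. f q * w $ q)" if "w \<in> carrier_vec (b 0)" for w
    using \<phi>0 that
    by (intro eq_vecI) (auto simp: scalar_prod_def lessThan_atLeast0 f_def intro!: sum.cong)
  have mult1: "\<phi> (Suc 0) *\<^sub>v w = vec (b 0) (\<lambda>q. \<Sum>c<b (Suc 0). l q c * w $ c)"
    if "w \<in> carrier_vec (b (Suc 0))" for w
    using \<phi>1 that
    by (intro eq_vecI) (auto simp: scalar_prod_def lessThan_atLeast0 l_def intro!: sum.cong)
  have dim: "dim_col (\<phi> 0) = b 0" "dim_row (\<phi> 0) = 1" "dim_col (\<phi> (Suc 0)) = b (Suc 0)"
    using \<phi>0 \<phi>1 by auto
  have Ieq: "?I = monom_ideal V (upset {w \<in> T. keys w \<subseteq> V \<and> mdeg w = d})"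
    unfolding I by (rule genideal_degree_component)
  have repr: "\<exists>a. (\<forall>q. a q \<in> ?R) \<and> (\<Sum>q<b 0. f q * a q) = mono t"
    if t: "t \<in> T" "keys t \<subseteq> V" "mdeg t = d" for t
  proof -
    have "mono t \<in> ?I" unfolding Ieq using t by (auto simp: mono_in_monom_ideal intro: upset_self)
    then obtain w where w: "w \<in> free_module V (b 0)" "mono t = (\<phi> 0 *\<^sub>v w) $ 0"
      unfolding im[symmetric] by (auto simp: mat_image_def dim)
    hence "w \<in> carrier_vec (b 0)" by (simp add: free_module_def)
    hence "mono t = (\<Sum>q<b 0. f q * w $ q)" using w(2) mult0 by simp
    hence "(\<Sum>q<b 0. f q * (if q < b 0 then w $ q else 0)) = mono t" by simp
    thus ?thesis
      using w(1) by (intro exI[of _ "\<lambda>q. if q < b 0 then w $ q else 0"]) (auto simp: free_module_def)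
  qed
  have fI: "f q \<in> ?I" if q: "q < b 0" for q
  proof -
    let ?e = "vec (b 0) (\<lambda>i. if i = q then 1 else 0 :: ('v, 'k) mpoly)"
    have "?e \<in> free_module V (b 0)" by (simp add: free_module_def)
    moreover have "f q = (\<phi> 0 *\<^sub>v ?e) $ 0"
    proof -
      have "(\<phi> 0 *\<^sub>v ?e) $ 0 = (\<Sum>i<b 0. if i = q then f i else 0)"
        by (subst mult0) (simp_all add: if_distrib cong: if_cong)
      thus ?thesis using q by simp
    qed
    ultimately show ?thesis
      unfolding im[symmetric] by (intro image_eqI[of _ _ "\<phi> 0 *\<^sub>v ?e"]) (simp_all add: mat_image_def dim)
  qed
  obtain a where a: "\<And>q. a q \<in> ?R" "(\<Sum>q<b 0. f q * a q) = mono u" using repr[OF u] by blast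
  obtain a' where a': "\<And>q. a' q \<in> ?R" "(\<Sum>q<b 0. f q * a' q) = mono v" using repr[OF v] by blast
  \<comment> \<open>The common degree \<open>d'\<close> of the \<open>f q\<close> is at most
    \<open>d\<close>, because \<open>u\<close> is a combination of them, and at least
    \<open>d\<close>, because they lie in an ideal generated in degree \<open>d\<close>.\<close>
  have fdeg: "mdeg t = d" if qt: "q < b 0" "t \<in> keys (f q)" for q t
  proof -
    have "u \<in> keys (\<Sum>q<b 0. f q * a q)" by (simp add: a(2) mono_def)
    then obtain q0 where q0: "q0 < b 0" "u \<in> keys (f q0 * a q0)"
      using keys_sum[of "\<lambda>q. f q * a q" "{..<b 0}"] by auto
    then obtain s s' where s: "s \<in> keys (f q0)" "u = s + s'" using keys_times by blast
    have "int (mdeg s) = d'" using d0[OF q0(1)] s lin[OF q0(1)] by (simp add: f_def)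
    hence le: "d' \<le> int d" using s(2) u(3) by (simp add: mdeg_add)
    obtain w where "divides w t" "mdeg w = d"
      using fI[OF qt(1)] qt(2) unfolding Ieq by (auto simp: monom_ideal_def upset_def)
    hence "d \<le> mdeg t" using divides_eq by (metis le_add1 mdeg_add)
    moreover have "int (mdeg t) = d'" using d0[OF that(1)] lin[OF that(1)] that(2) by (simp add: f_def)
    ultimately show ?thesis using le by linarith
  qed
  have fT: "t \<in> T" if qt: "q < b 0" "t \<in> keys (f q)" for q t
  proof -
    have kt: "keys t \<subseteq> V" using fR[OF that(1)] that(2) by (simp add: in_poly_ring)
    obtain w where w: "divides w t" "w \<in> T"
      using fI[OF qt(1)] qt(2) unfolding Ieq by (auto simp: monom_ideal_def upset_def)
    have "keys (t - w) \<subseteq> V" using kt keys_minus_monom[of t w] by blast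
    hence "w + (t - w) \<in> T" using T w(2) by blast
    thus ?thesis using divides_eq[OF w(1)] by simp
  qed
  \<comment> \<open>The cofactors of \<open>u\<close> and \<open>v\<close> in their least common
    multiple, by truncated subtraction. They have the same degree and are different.\<close>
  define mu where "mu = v - u"
  define mv where "mv = u - v"
  have lcm: "u + mu = v + mv"
    by (rule poly_mapping_eqI) (simp add: lookup_add lookup_minus mu_def mv_def)
  have "mdeg mu = mdeg mv" using arg_cong[OF lcm, of mdeg] u v by (simp add: mdeg_add)
  have mv_neq: "mu \<noteq> mv" using lcm uv by auto
  define \<Lambda> where "\<Lambda> w = (\<Sum>q<b 0. lookup (w q) mu * lookup (f q) u)" for w
  \<comment> \<open>Every \<open>f q\<close> has the degree of \<open>u\<close>, so only the
    constant terms of the coefficients contribute to the monomial \<open>u\<close>.\<close>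
  have coef: "lookup (\<Sum>q<b 0. f q * w q) u = (\<Sum>q<b 0. lookup (w q) 0 * lookup (f q) u)" for w
  proof -
    have "lookup (f q * w q) u = lookup (w q) 0 * lookup (f q) u" if q: "q < b 0" for q
    proof -
      have *: "lookup (hom_part 0 (w q) * f q) u = lookup (w q * f q) u"
      proof -
        have "homogeneous d (f q)" using fdeg[OF q] by (simp add: homogeneous_def)
        hence "hom_part (0 + d) (w q * f q) = hom_part 0 (w q) * f q" by (rule hom_part_mult)
        thus ?thesis using lookup_hom_part[of d "w q * f q" u] u(3) by simp
      qed
      have "hom_part 0 (w q) = single 0 (lookup (w q) 0)"
        by (rule poly_mapping_eqI) (auto simp: lookup_hom_part lookup_single when_def dest: mdeg_eq_0)
      hence "lookup (hom_part 0 (w q) * f q) u = lookup (f q) u * lookup (w q) 0"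
        using lookup_times_single[of "f q" 0 "lookup (w q) 0" u] by (simp add: mult.commute)
      thus ?thesis using * by (simp add: mult.commute)
    qed
    thus ?thesis by (simp add: lookup_sum)
  qed
  \<comment> \<open>The least common multiple is written as a combination of the \<open>f q\<close>
    in two ways; the difference is a syzygy.\<close>
  define w where "w q = a q * mono mu - a' q * mono mv" for q
  have muV: "keys mu \<subseteq> V" "keys mv \<subseteq> V"
    using u(2) v(2) keys_minus_monom[of v u] keys_minus_monom[of u v] unfolding mu_def mv_def by blast+
  have wR: "w q \<in> ?R" for q
    unfolding w_def using a a' muV by (intro poly_ring_closed) (simp_all add: mono_in_poly_ring)
  have "(\<Sum>q<b 0. f q * w q) = (\<Sum>q<b 0. f q * a q) * mono mu - (\<Sum>q<b 0. f q * a' q) * mono mv"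
    by (simp add: w_def right_diff_distrib sum_subtractf sum_distrib_right mult.assoc)
  also have "\<dots> = 0" unfolding a(2) a'(2) using lcm by (simp add: mono_def mult_single)
  finally have "vec (b 0) w \<in> mat_ker V (\<phi> 0)"
    using wR by (auto simp: mat_ker_def dim free_module_def mult0)
  then obtain z where z: "z \<in> free_module V (b (Suc 0))" "vec (b 0) w = \<phi> (Suc 0) *\<^sub>v z"
    unfolding ex[symmetric] by (auto simp: mat_image_def dim)
  have wz: "w q = (\<Sum>c<b (Suc 0). l q c * z $ c)" if "q < b 0" for q
  proof -
    have "z \<in> carrier_vec (b (Suc 0))" using z(1) by (simp add: free_module_def)
    hence "vec (b 0) w $ q = (vec (b 0) (\<lambda>q. \<Sum>c<b (Suc 0). l q c * z $ c)) $ q"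
      using z(2) mult1 by simp
    thus ?thesis using that by simp
  qed
  have syz: "(\<Sum>q<b 0. f q * l q c) = 0" if c: "c < b (Suc 0)" for c
  proof -
    let ?e = "vec (b (Suc 0)) (\<lambda>i. if i = c then 1 else 0 :: ('v, 'k) mpoly)"
    have "?e \<in> free_module V (b (Suc 0))" by (simp add: free_module_def)
    hence k: "\<phi> (Suc 0) *\<^sub>v ?e \<in> mat_ker V (\<phi> 0)"
      unfolding ex[symmetric] by (auto simp: mat_image_def dim)
    have "\<phi> (Suc 0) *\<^sub>v ?e = vec (b 0) (\<lambda>q. \<Sum>i<b (Suc 0). if i = c then l q i else 0)"
      by (subst mult1) (auto intro!: eq_vecI simp: if_distrib cong: if_cong)
    hence e: "\<phi> (Suc 0) *\<^sub>v ?e = vec (b 0) (\<lambda>q. l q c)" using c by simp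
    hence "\<phi> 0 *\<^sub>v vec (b 0) (\<lambda>q. l q c) = 0\<^sub>v 1" using k by (simp add: mat_ker_def dim)
    hence "vec 1 (\<lambda>_. \<Sum>q<b 0. f q * vec (b 0) (\<lambda>q. l q c) $ q) $ 0 = (0\<^sub>v 1 :: ('v, 'k) mpoly vec) $ 0"
      by (simp add: mult0)
    thus ?thesis by simp
  qed
  \<comment> \<open>Compare the coefficients of \<open>u\<close> times \<open>y\<close> in a linear
    syzygy. By \<open>neg\<close>, dividing this monomial by a variable other than \<open>y\<close>
    leads outside \<open>T\<close>, hence to no monomial of an \<open>f q\<close>; only the
    coefficients of \<open>u\<close> in the \<open>f q\<close> remain.\<close>
  have van: "(\<Sum>q<b 0. lookup (l q c) (single y 1) * lookup (f q) u) = 0"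
    if c: "c < b (Suc 0)" and y: "y \<in> keys mu" for c y
  proof -
    let ?M = "u + single y 1"
    have uy: "lookup u y < lookup v y" using y by (simp add: mu_def in_keys_iff lookup_minus)
    have "lookup (l q c * f q) ?M = lookup (l q c) (single y 1) * lookup (f q) u"
      if q: "q < b 0" for q
    proof -
      have "lookup (f q) (?M - single x 1) = 0" if x: "x \<in> keys ?M" "x \<noteq> y" for x
      proof (rule ccontr)
        assume "\<not> ?thesis"
        hence "?M - single x 1 \<in> T" using fT[OF q] by (simp add: in_keys_iff)
        moreover have "?M - single x 1 + single x 1 = ?M"
          using divides_eq[of "single x 1" ?M] x(1)
          unfolding divides_single by (simp add: add.commute)
        moreover have "0 < lookup u x" using x by (auto simp: in_keys_iff lookup_add lookup_single)
        ultimately show False using neg uy x(2) by blast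
      qed
      hence "lookup (l q c * f q) ?M =
        (\<Sum>x\<in>keys ?M. if x = y then lookup (l q c) (single y 1) * lookup (f q) u else 0)"
        unfolding lookup_linear_mult[OF lh[OF q c]] by (intro sum.cong) auto
      moreover have "y \<in> keys ?M" by (simp add: in_keys_iff lookup_add)
      ultimately show ?thesis by simp
    qed
    hence "(\<Sum>q<b 0. lookup (l q c) (single y 1) * lookup (f q) u) =
      lookup (\<Sum>q<b 0. f q * l q c) ?M" by (simp add: lookup_sum mult.commute)
    thus ?thesis by (simp add: syz[OF c])
  qed
  have "\<Lambda> w = (\<Sum>q<b 0. (\<Sum>c<b (Suc 0). lookup (l q c * z $ c) mu) * lookup (f q) u)"
    unfolding \<Lambda>_def by (intro sum.cong) (auto simp: wz lookup_sum)
  also have "\<dots> = (\<Sum>q<b 0. \<Sum>c<b (Suc 0). \<Sum>y\<in>keys mu. lookup (z $ c) (mu - single y 1) *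
      (lookup (l q c) (single y 1) * lookup (f q) u))"
    unfolding sum_distrib_right
  proof (intro sum.cong refl)
    fix q c assume "q \<in> {..<b 0}" "c \<in> {..<b (Suc 0)}"
    hence "homogeneous 1 (l q c)" using lh by simp
    from lookup_linear_mult[OF this, of "z $ c" mu]
    show "lookup (l q c * z $ c) mu * lookup (f q) u =
      (\<Sum>y\<in>keys mu. lookup (z $ c) (mu - single y 1) *
        (lookup (l q c) (single y 1) * lookup (f q) u))"
      by (simp only: sum_distrib_right) (simp only: ac_simps)
  qed
  also have "\<dots> = (\<Sum>c<b (Suc 0). \<Sum>y\<in>keys mu. \<Sum>q<b 0. lookup (z $ c) (mu - single y 1) *
      (lookup (l q c) (single y 1) * lookup (f q) u))"
    by (subst sum.swap) (rule sum.cong[OF refl], rule sum.swap)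
  also have "\<dots> = 0"
    unfolding sum_distrib_left[symmetric] using van by (intro sum.neutral ballI) simp
  finally have "\<Lambda> w = 0" .
  moreover have "\<Lambda> w = 1"
  proof -
    have "lookup (a q * mono mu) mu = lookup (a q) 0" for q
      using lookup_times_mono[of "a q" mu 0] by simp
    \<comment> \<open>\<open>mv\<close> has the degree of \<open>mu\<close> but differs from it, so
      it does not divide \<open>mu\<close>. What remains of the functional is the coefficient of
      \<open>u\<close> in \<open>u\<close> itself.\<close>
    moreover have "lookup (a' q * mono mv) mu = 0" for q
    proof (rule ccontr)
      assume "\<not> ?thesis"
      hence "mu \<in> keys (a' q * mono mv)" by (simp add: in_keys_iff)
      then obtain s where s: "mu = s + mv" using keys_times[of mu "a' q" "mono mv"] by (auto simp: mono_def)
      hence "mdeg s = 0" using \<open>mdeg mu = mdeg mv\<close> by (metis mdeg_add add_cancel_left_left)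
      thus False using s mv_neq mdeg_eq_0 by auto
    qed
    ultimately have "\<Lambda> w = (\<Sum>q<b 0. lookup (a q) 0 * lookup (f q) u)"
      by (simp add: \<Lambda>_def w_def lookup_minus)
    thus ?thesis using coef[of a] a(2) by (simp add: mono_def)
  qed
  ultimately show False by simp
qed

section \<open>Vertex decomposability from componentwise linearity\<close>

lemma fractional_covers_add: "t \<in> fractional_covers G k \<Longrightarrow> t + s \<in> fractional_covers G k"
  by (fastforce simp: fractional_covers_def lookup_add)

text \<open>A linear step from \<open>u\<close> towards \<open>v\<close> raises one vertex
  \<open>y\<close> of the side \<open>Y\<close> by one and pays by lowering some \<open>x\<close>.
  Whichever vertex \<open>x\<close> of positive value is lowered, some edge at \<open>x\<close>
  becomes too light: one raised vertex cannot serve all edges at \<open>x\<close> if degrees are at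
  least two.\<close>

lemma componentwise_linear_imp_shed_bip:
  assumes G: "simple_graph G" and k: "k \<ge> 2"
    and cl: "componentwise_linear (verts G) (cover_ideal_sympow G k :: ('v, 'k::field) mpoly set)"
    and A: "indep_set G A" and as: "shedding_order (residual G A) as"
  shows "vertex_decomposable (shed_bip (residual G A) as)"
proof (rule residually_simplicial_imp_vertex_decomposable)
  let ?V = "verts G" and ?T = "fractional_covers G k"
  define H where "H = residual G A"
  define D where "D = shed_bip H as"
  define B where "B = verts H - set as"
  have H: "simple_graph H" unfolding H_def by (rule simple_delete[OF G])
  have as: "shedding_order H as" using as by (simp add: H_def)
  have D: "simple_graph D" unfolding D_def by (rule simple_shed_bip[OF H])
  thus "simple_graph (shed_bip (residual G A) as)" by (simp add: D_def H_def)
  have adjD: "adj D u v \<longleftrightarrow> adj H u v \<and> (u \<in> set as \<longleftrightarrow> v \<notin> set as)" for u v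
    unfolding D_def by (rule adj_shed_bip[OF H])
  have VD: "verts D = verts H" by (simp add: D_def)
  have asH: "set as \<subseteq> verts H" by (rule shedding_order_subset[OF as])
  have HG: "adj H u v \<longleftrightarrow> adj G u v \<and> u \<in> verts H \<and> v \<in> verts H" for u v
    using simple_graphD[OF G, of u v] by (auto simp: H_def)
  have VH: "v \<in> verts H \<longleftrightarrow> v \<in> ?V \<and> v \<notin> A \<and> (\<forall>a\<in>A. \<not> adj G a v)" for v
    by (auto simp: H_def in_closed_nbrs[OF G])
  have fV: "finite ?V" and fH: "finite (verts H)" using G H by (auto simp: simple_graph_def)
  have Bi: "indep_set H B" unfolding B_def by (rule shedding_order_indep[OF as])
  \<comment> \<open>\<open>B\<close> has maximum size, so no a_j can be added to it.\<close>
  have Bnb: "\<exists>b\<in>B. adj H a b" if a: "a \<in> set as" for a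
  proof (rule ccontr)
    assume "\<not> ?thesis"
    hence "indep_set H (insert a B)" using Bi a asH by (auto simp: indep_set_insert[OF H])
    hence "card (insert a B) \<le> card B" using shedding_order_max_indep[OF H as] by (simp add: B_def)
    moreover have "finite B" "a \<notin> B" using fH a by (auto simp: B_def)
    ultimately show False by simp
  qed
  have exch: "\<exists>x y w. x \<noteq> y \<and> lookup u y < lookup v y \<and> 0 < lookup u x \<and> w \<in> ?T \<and>
    w + single x 1 = u + single y 1"
    if "u \<in> ?T" "keys u \<subseteq> ?V" "v \<in> ?T" "keys v \<subseteq> ?V" "mdeg u = mdeg v" "u \<noteq> v" for u v
  proof (rule linear_resolution_exchange[OF fractional_covers_add cover_ideal_sympow_eq[OF G]])
    show "has_linear_resolution ?V (Idl\<^bsub>poly_ring ?V\<^esub>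
      {p \<in> cover_ideal_sympow G k :: ('v, 'k) mpoly set. homogeneous (mdeg v) p})"
      using cl by (simp add: componentwise_linear_def)
  qed (use that in auto)
  have "residually_simplicial D"
    unfolding residually_simplicial_def
  proof (intro allI impI, rule ccontr)
    fix S assume S: "indep_set D S" "verts (residual D S) \<noteq> {}"
      and neg: "\<not> (\<exists>x. simplicial (residual D S) x)"
    define W where "W = verts (residual D S)"
    define N where "N = nbrs D S"
    have inW: "v \<in> W \<longleftrightarrow> v \<in> verts H \<and> v \<notin> S \<and> v \<notin> N" for v
      unfolding W_def N_def by (auto simp: VD closed_nbrs_def)
    have inN: "v \<in> N \<longleftrightarrow> (\<exists>s\<in>S. adj D s v)" for v by (simp add: N_def in_nbrs[OF D])
    have NH: "N \<subseteq> verts H" using nbrs_subset[of D S] VD by (simp add: N_def)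
    have SN: "s \<notin> N" if "s \<in> S" for s using S(1) that by (auto simp: inN indep_set_def)
    have nb: "\<exists>w\<in>W. adj D x w \<and> w \<noteq> a" if x: "x \<in> W" for x a
    proof (rule ccontr)
      assume "\<not> ?thesis"
      hence "simplicial (residual D S) x"
        using x unfolding W_def by (intro simplicial_residualI[OF D]) blast+
      thus False using neg by blast
    qed
    define V1 where "V1 = W \<inter> B"
    define V2 where "V2 = W \<inter> set as"
    have WV: "W = V1 \<union> V2" "V1 \<inter> V2 = {}" by (auto simp: V1_def V2_def B_def inW)
    obtain x0 where x0: "x0 \<in> W" using S(2) unfolding W_def by blast
    obtain x1 where x1: "x1 \<in> W" "adj D x0 x1" using nb[OF x0] by blast
    have ne: "V1 \<noteq> {}" "V2 \<noteq> {}" using x0 x1 by (auto simp: V1_def V2_def adjD B_def inW)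
    \<comment> \<open>Outside \<open>H\<close> the values are dictated by \<open>A\<close>: zero on
      \<open>A\<close> forces \<open>k\<close> on its neighbours. On an edge of \<open>D\<close>
      with exactly one end in \<open>P\<close> the values sum to \<open>k\<close>.\<close>
    define val where "val P v = (if v \<in> A then 0 else if v \<in> B then if v \<in> P then 1 else 0
      else if v \<in> set as then k - 1 + (if v \<in> P then 1 else 0) else k)" for P v
    define m where "m P = monom_of ?V (val P)" for P
    have m: "lookup (m P) v = (if v \<in> ?V then val P v else 0)" "keys (m P) \<subseteq> ?V" for P v
      unfolding m_def by (rule lookup_monom_of[OF fV], rule keys_monom_of[OF fV])
    have HV: "v \<in> ?V" "v \<notin> A" if "v \<in> verts H" for v using that by (auto simp: VH)
    have valH: "val P v = (if v \<in> set as then k - 1 + (if v \<in> P then 1 else 0) else if v \<in> P then 1 else 0)"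
      if "v \<in> verts H" for P v using that HV[OF that] by (auto simp: val_def B_def)
    have cover: "m P \<in> ?T" if P: "\<And>a b. adj D a b \<Longrightarrow> a \<in> P \<or> b \<in> P" for P
      unfolding fractional_covers_def
    proof (intro CollectI allI impI)
      fix u v assume uv: "adj G u v"
      have uvV: "u \<in> ?V" "v \<in> ?V" using simple_graphD[OF G uv] by auto
      have big: "val P z = k" if "z \<in> ?V" "z \<notin> A" "z \<notin> verts H" for z
        using that asH by (auto simp: val_def B_def)
      consider "u \<in> verts H" "v \<in> verts H" | "u \<notin> verts H" "u \<notin> A" | "v \<notin> verts H" "v \<notin> A"
        | "u \<in> A" "v \<in> A" | "u \<in> A" "v \<in> verts H" | "u \<in> verts H" "v \<in> A" by blast
      thus "k \<le> lookup (m P) u + lookup (m P) v"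
      proof cases
        case 1
        hence "adj H u v" using uv HG by blast
        hence "\<not> (u \<in> B \<and> v \<in> B)" using Bi by (auto simp: indep_set_def)
        moreover have "u \<in> P \<or> v \<in> P" if "(u \<in> set as \<longleftrightarrow> v \<notin> set as)"
          using P \<open>adj H u v\<close> that by (auto simp: adjD)
        \<comment> \<open>Two adjacent vertices of \<open>as\<close> together have value at least
          \<open>2 * (k - 1)\<close>, which reaches \<open>k\<close> because
          \<open>2 \<le> k\<close>.\<close>
        ultimately show ?thesis using 1 uvV k by (auto simp: m valH B_def)
      next
        case 2 thus ?thesis using big uvV by (simp add: m)
      next
        case 3 thus ?thesis using big uvV by (simp add: m)
      next
        case 4 thus ?thesis using A uv by (auto simp: indep_set_def)
      next
        case 5 thus ?thesis using uv by (auto simp: VH)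
      next
        case 6 thus ?thesis using uv adj_sym[of u v G] by (auto simp: VH)
      qed
    qed
    have deg: "mdeg (m P) = mdeg (m {}) + card P" if P: "P \<subseteq> verts H" for P
    proof -
      have "(\<Sum>v\<in>?V. lookup (m P) v) = (\<Sum>v\<in>?V. lookup (m {}) v + (if v \<in> P then 1 else 0))"
        using P HV asH by (intro sum.cong) (auto simp: m val_def B_def)
      also have "\<dots> = (\<Sum>v\<in>?V. lookup (m {}) v) + card (?V \<inter> P)"
        using fV by (simp add: sum.distrib sum.If_cases)
      also have "?V \<inter> P = P" using P HV by blast
      finally show ?thesis using m(2) by (simp add: mdeg_eq_sum[OF fV])
    qed
    have contra: False if XY: "(X = V1 \<and> Y = V2) \<or> (X = V2 \<and> Y = V1)" "card Y \<le> card X" for X Y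
    proof -
      \<comment> \<open>Each side of the residual graph becomes a vertex cover of \<open>D\<close>
        when the neighbours of \<open>S\<close> are added to it; \<open>X\<close> is the side that
        is not smaller.\<close>
      define P where "P = X \<union> N"
      define Q where "Q = Y \<union> N"
      have WXY: "W = X \<union> Y" "X \<inter> Y = {}" "X \<noteq> {}" "Y \<noteq> {}" using XY WV ne by auto
      have XYN: "X \<inter> N = {}" "Y \<inter> N = {}" using WXY inW by blast+
      have side: "x \<in> X \<longleftrightarrow> y \<in> Y" if "x \<in> W" "y \<in> W" "adj D x y" for x y
        using that XY by (auto simp: V1_def V2_def B_def adjD inW)
      have sub: "P \<subseteq> verts H" "Q \<subseteq> verts H" using WXY NH inW by (auto simp: P_def Q_def)
      have DH: "a \<in> verts H" "b \<in> verts H" if "adj D a b" for a b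
        using simple_graphD[OF D that] VD by auto
      have cov: "a \<in> Z \<union> N \<or> b \<in> Z \<union> N" if ab: "adj D a b" and Z: "Z = X \<or> Z = Y" for a b Z
      proof (rule ccontr)
        assume n: "\<not> ?thesis"
        hence "a \<notin> S" "b \<notin> S" using ab inN adj_sym[of a b D] by blast+
        hence "a \<in> W" "b \<in> W" using n DH[OF ab] inW by auto
        thus False using side[of a b] ab n Z WXY(1) by blast
      qed
      obtain y0 where y0: "y0 \<in> Y" using WXY by blast
      obtain z0 where z0: "z0 \<in> X" using WXY by blast
      define u where "u = m P"
      \<comment> \<open>The padding makes the degrees equal; as it sits at a vertex of
        \<open>Y\<close>, it does not let \<open>v\<close> exceed \<open>u\<close> outside
        \<open>Y\<close>.\<close>
      define v where "v = m Q + single y0 (card X - card Y)"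
      have YW: "y \<in> W" "y \<in> verts H" "y \<notin> P" if "y \<in> Y" for y
        using that WXY XYN inW by (auto simp: P_def)
      have fin: "finite X" "finite Y" "finite N" using sub fH by (auto simp: P_def Q_def intro: finite_subset)
      have "card P = card X + card N" "card Q = card Y + card N"
        using XYN fin by (simp_all add: P_def Q_def card_Un_disjoint)
      hence "mdeg u = mdeg v"
        using XY(2) by (simp add: u_def v_def deg[OF sub(1)] deg[OF sub(2)] mdeg_add)
      moreover have "u \<in> ?T" unfolding u_def P_def using cov by (intro cover) blast
      moreover have "v \<in> ?T"
        unfolding v_def Q_def using cov by (intro fractional_covers_add cover) blast
      moreover have "keys u \<subseteq> ?V" "keys v \<subseteq> ?V"
        using m(2) y0 YW(2) HV by (auto simp: u_def v_def keys_monom_add split: if_splits)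
      moreover have "u \<noteq> v"
      proof
        assume "u = v"
        hence "lookup u z0 = lookup v z0" by simp
        moreover have z: "z0 \<noteq> y0" "z0 \<in> verts H" "z0 \<in> P" "z0 \<notin> Q"
          using z0 y0 WXY XYN sub by (auto simp: P_def Q_def)
        ultimately show False
          using HV[OF z(2)] by (simp add: u_def v_def m valH lookup_add lookup_single split: if_splits)
      qed
      ultimately obtain x y w where xyw: "x \<noteq> y" "lookup u y < lookup v y" "0 < lookup u x" "w \<in> ?T"
        "w + single x 1 = u + single y 1"
        using exch[of u v] m(2) by blast
      have y: "y \<in> Y"
      proof (rule ccontr)
        assume ny: "y \<notin> Y"
        hence "y \<in> Q \<Longrightarrow> y \<in> P" by (auto simp: P_def Q_def)
        hence "lookup v y \<le> lookup u y"
          using ny y0 by (auto simp: u_def v_def lookup_add lookup_single when_def m val_def)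
        thus False using xyw(2) by simp
      qed
      have lw: "lookup w z + (if z = x then 1 else 0) = lookup u z + (if z = y then 1 else 0)" for z
        using arg_cong[OF xyw(5), of "\<lambda>t. lookup t z"]
        by (auto simp: lookup_add lookup_single when_def)
      have wx: "lookup w x = lookup u x - 1" using lw[of x] xyw(1) by simp
      have wz: "lookup w z = lookup u z" if "z \<noteq> x" "z \<noteq> y" for z using lw[of z] that by simp
      have wcov: "k \<le> lookup w a + lookup w b" if "adj G a b" for a b
        using xyw(4) that by (simp add: fractional_covers_def)
      have xV: "x \<in> ?V" using xyw(3) by (auto simp: u_def m split: if_splits)
      have xA: "x \<notin> A" using xyw(3) by (auto simp: u_def m val_def split: if_splits)
      consider "x \<notin> verts H" | "x \<in> P" | "x \<in> verts H" "x \<notin> P" by blast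
      thus False
      proof cases
        case 1
        \<comment> \<open>\<open>x\<close> has value \<open>k\<close> and its neighbour in
          \<open>A\<close> value zero, so lowering \<open>x\<close> breaks this edge.\<close>
        then obtain z where z: "z \<in> A" "adj G z x" using xV xA VH by blast
        have "z \<noteq> y" "z \<noteq> x" using z xA HV(2)[OF YW(2)[OF y]] by auto
        hence "lookup w z = 0" using z wz by (simp add: u_def m val_def)
        moreover have "lookup w x = k - 1" using 1 xA xV asH wx by (auto simp: u_def m val_def B_def)
        ultimately show False using wcov[OF z(2)] k by simp
      next
        case 2
        \<comment> \<open>A neighbour of \<open>x\<close> outside the cover and different from
          \<open>y\<close>: in \<open>S\<close> if \<open>x\<close> belongs to \<open>N\<close>, and
          otherwise in \<open>Y\<close>, where \<open>x\<close> has at least two neighbours.\<close>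
        have "\<exists>z. adj D x z \<and> z \<noteq> y \<and> z \<notin> P"
        proof (cases "x \<in> N")
          case True
          then obtain s where s: "s \<in> S" "adj D s x" using inN by blast
          hence "s \<notin> W" "s \<notin> N" using SN inW by auto
          thus ?thesis using s YW(1)[OF y] WXY(1) adj_sym[of s x D] by (auto simp: P_def)
        next
          case False
          hence "x \<in> X" "x \<in> W" using 2 WXY(1) by (auto simp: P_def)
          then obtain z where z: "z \<in> W" "adj D x z" "z \<noteq> y" using nb by blast
          hence "z \<in> Y" using side[of x z] \<open>x \<in> X\<close> \<open>x \<in> W\<close> by blast
          thus ?thesis using z YW(3) by blast
        qed
        then obtain z where z: "adj D x z" "z \<noteq> y" "z \<notin> P" by blast
        have zx: "z \<noteq> x" using simple_graphD[OF D z(1)] by simp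
        have xzH: "adj H x z" using z(1) adjD by blast
        have h: "x \<in> verts H" "z \<in> verts H" "x \<in> set as \<longleftrightarrow> z \<notin> set as"
          using simple_graphD[OF H xzH] z(1) adjD by auto
        have "lookup u x + lookup u z = k"
          using h z(3) 2 HV(1)[OF h(1)] HV(1)[OF h(2)] k by (auto simp: u_def m valH)
        moreover have "adj G x z" using xzH HG by blast
        ultimately show False using wcov[of x z] wx wz[OF zx z(2)] xyw(3) by simp
      next
        case 3
        \<comment> \<open>Inside \<open>H\<close> but outside \<open>P\<close>, only members of
          \<open>as\<close> can have positive value, namely \<open>k - 1\<close>. After the step
          \<open>x\<close> has value \<open>k - 2\<close>, and a neighbour in \<open>B\<close> has
          value at most one, even if it is \<open>y\<close>.\<close>
        hence xa: "x \<in> set as" using xyw(3) xV by (auto simp: u_def m valH split: if_splits)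
        obtain b where b: "b \<in> B" "adj H x b" using Bnb[OF xa] by blast
        have bH: "b \<in> verts H" "b \<notin> set as" "b \<noteq> x" using b xa by (auto simp: B_def)
        have "lookup w b \<le> 1"
          using lw[of b] bH HV(1)[OF bH(1)] YW(3)[OF y] by (auto simp: u_def m valH split: if_splits)
        moreover have "lookup w x = k - 2" using 3 xa xV wx by (simp add: u_def m valH)
        moreover have "adj G x b" using b HG by blast
        ultimately show False using wcov[of x b] k by simp
      qed
    qed
    show False using contra[of V1 V2] contra[of V2 V1] by (metis nat_le_linear)
  qed
  thus "residually_simplicial (shed_bip (residual G A) as)" by (simp add: D_def H_def)
qed

theorem theorem1p2:
  fixes G :: "'v graph"
    and J :: "nat \<Rightarrow> ('v, 'k::field) mpoly set"
    and \<sigma> :: "'v graph \<Rightarrow> 'v list"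
  assumes "simple_graph G"
    and "\<And>A. indep_set G A \<Longrightarrow> verts (delete_verts G (closed_nbrs G A)) \<noteq> {} \<Longrightarrow>
           \<exists>x. simplicial (delete_verts G (closed_nbrs G A)) x"
    and "\<And>H. simple_graph H \<Longrightarrow> vertex_decomposable H \<Longrightarrow> shedding_order H (\<sigma> H)"
    and "J = cover_ideal_sympow G"
  shows "((\<forall>A. indep_set G A \<longrightarrow>
             vertex_decomposable (shed_bip (delete_verts G (closed_nbrs G A))
                                    (\<sigma> (delete_verts G (closed_nbrs G A)))))
           \<longleftrightarrow> (\<forall>k\<ge>1. linear_quotients (verts G) (J k)))
       \<and> ((\<forall>k\<ge>1. linear_quotients (verts G) (J k))
           \<longleftrightarrow> (\<forall>k\<ge>1. componentwise_linear (verts G) (J k)))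
       \<and> ((\<forall>k\<ge>1. componentwise_linear (verts G) (J k))
           \<longleftrightarrow> (\<exists>k\<ge>2. componentwise_linear (verts G) (J k)))"
proof -
  note G = assms(1)
  have rs: "residually_simplicial G" using assms(2) unfolding residually_simplicial_def by blast
  \<comment> \<open>Residual graphs inherit the simplicial hypothesis and so are vertex
    decomposable, which is the condition under which \<open>\<sigma>\<close> returns a shedding
    order.\<close>
  have \<sigma>: "shedding_order (residual G A) (\<sigma> (residual G A))" if A: "indep_set G A" for A
    using assms(3)[OF simple_delete[OF G]]
      residually_simplicial_imp_vertex_decomposable[OF simple_delete[OF G]
        residually_simplicial_residual[OF G rs A]] by blast
  let ?P1 = "\<forall>A. indep_set G A \<longrightarrow> vertex_decomposable (shed_bip (residual G A) (\<sigma> (residual G A)))"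
  let ?P2 = "\<forall>k\<ge>1. linear_quotients (verts G) (J k)"
  let ?P3 = "\<forall>k\<ge>1. componentwise_linear (verts G) (J k)"
  let ?P4 = "\<exists>k\<ge>2. componentwise_linear (verts G) (J k)"
  have 12: ?P2 if P1: ?P1
  proof (intro allI impI)
    fix k :: nat
    have "leaf_condition (residual G A)" if A: "indep_set G A" for A
      using shed_bip_leaf_condition[OF simple_delete[OF G] \<sigma>[OF A]] P1 A by blast
    hence "residually_simplicial (polarization G k)"
      by (rule residually_simplicial_polarization[OF G rs])
    hence "shelled (polarization G k)"
      using simple_polarization[OF G] residually_simplicial_imp_vertex_decomposable
        vertex_decomposable_imp_shelled by blast
    thus "linear_quotients (verts G) (J k)"
      unfolding assms(4) by (rule shelled_polarization_imp_linear_quotients[OF G])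
  qed
  have 23: ?P3 if ?P2
    using that linear_quotients_imp_componentwise_linear[OF simple_graph_finite[OF G]] by blast
  have 34: ?P4 if ?P3 using that by (intro exI[of _ 2]) simp
  have 41: ?P1 if P4: ?P4
  proof (intro allI impI)
    fix A assume A: "indep_set G A"
    obtain k where "k \<ge> 2" "componentwise_linear (verts G) (J k)" using P4 by blast
    thus "vertex_decomposable (shed_bip (residual G A) (\<sigma> (residual G A)))"
      unfolding assms(4) by (rule componentwise_linear_imp_shed_bip[OF G _ _ A \<sigma>[OF A]])
  qed
  show ?thesis using 12 23 34 41 by argo
qed

end
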